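(* Let $\mathcal{P}=\{(P_{\alpha_1u_1},\pi_{\alpha_1v_1}),\dots,(P_{\alpha_{q+1}u_{q+1}},\pi_{\alpha_{q+1}v_{q+1}})\}$ be a set of $q+1$ (distinct) pairs, where $\alpha_i\in\mathcal{I}$ and $u_i,v_i\in\mathcal{U}$, and let $\mathcal{L}_{\mathcal{P}}$ be the set of all lines lying in $p(P_{\alpha_iu_i},\pi_{\alpha_iv_i})\setminus\{r_{U_1}\}$ for some $i\in\{1,\dots,q+1\}$. Then the set $$\Pi_{\mathcal{P}}=\{(\mathcal{S}_\ell\setminus\mathcal{R}_\ell)\cup\mathcal{R}_\ell^{o} : \ell\in\mathcal{L}_{\mathcal{P}}\}\cup\{\mathcal{D}_\eta\}$$ is a line-parallelism of $\Sigma_\eta$ if and only if $\mathcal{P}$ is a good set.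
   Context: Throughout, $q\ge 3$ is a prime power. Points of $\mathrm{PG}(3,q^2)$ have homogeneous coordinates $(x_1,x_2,x_3,x_4)$; $U_i$ is the point with $1$ in position $i$ and $0$ elsewhere; $t_1=\langle U_1,U_2\rangle$, $t_2=\langle U_3,U_4\rangle$, $r_{U_1}=\langle U_1,U_3\rangle$. Let $\Lambda\subset\mathbb{F}_{q^2}\setminus\{0\}$ be a fixed set of $q-1$ elements with pairwise distinct norms $\alpha^{q+1}$. For $\alpha\in\Lambda$, $\tau_\alpha:(x_1,x_2,x_3,x_4)\mapsto(x_3^q,x_4^q,\alpha^{q+1}x_1^q,\alpha^{q+1}x_2^q)$ is an involution whose set of fixed points is the Baer subgeometry $\Sigma_\alpha=\{(x,y,\alpha x^q,\alpha y^q): x,y\in\mathbb{F}_{q^2},(x,y)\neq(0,0)\}\simeq\mathrm{PG}(3,q)$. Let $\mathcal{U}=\{u\in\mathbb{F}_{q^2}:u^{q+1}=1\}$ and let $\eta$ be the unique element of $\mathcal{U}\cap\Lambda$. A set $A=\{a_1,\dots,a_t\}\subset\mathbb{F}_q\setminus\{0\}$ is fixed as follows. If $q$ is even, $t=(q-2)/2$ and $\{1\}\cup A\cup A^{-1}=\mathbb{F}_q\setminus\{0\}$ is a partition. If $q$ is odd, $t=(q-3)/2$, $\{\pm1\}\cup A\cup A^{-1}=\mathbb{F}_q\setminus\{0\}$ is a partition, and $-a\notin A$ for every $a\in A$. Here $A^{-1}=\{a^{-1}:a\in A\}$. Put $\mathcal{I}=\{\alpha\in\Lambda:\alpha^{q+1}\in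 A\}$ if $q$ is even and $\mathcal{I}=\{\alpha\in\Lambda:\alpha^{q+1}\in A\cup\{-1\}\}$ if $q$ is odd. For $P\in t_1$ let $r_P=\langle P,P^{\tau_\eta}\rangle$. $\mathcal{D}_\eta=\{r_P\cap\Sigma_\eta:P\in t_1\}$ is a Desarguesian line-spread of $\Sigma_\eta$. In general, if $\ell$ is a line of $\mathrm{PG}(3,q^2)$ with $\ell,\ell^{\tau_\eta}$ skew, $\mathcal{S}_\ell=\{\langle P,P^{\tau_\eta}\rangle\cap\Sigma_\eta:P\in\ell\}$ is the Desarguesian line-spread of $\Sigma_\eta$ with transversals $\ell,\ell^{\tau_\eta}$. For $\alpha\in\mathcal{I}$, $u,v\in\mathcal{U}$: $P_{\alpha u}=(1,0,\alpha u,0)$ is a point of $r_{U_1}\cap\Sigma_\alpha$; $\pi_{\alpha v}$ is the plane $X_4=\alpha vX_2$ (it contains $r_{U_1}$ and meets $\Sigma_\alpha$ in a Baer subplane); $p(P_{\alpha u},\pi_{\alpha v})$ is the set of the $q+1$ lines of $\pi_{\alpha v}$ through $P_{\alpha u}$ meeting $\pi_{\alpha v}\cap\Sigma_\alpha$ in a Baer subline (one of them is $r_{U_1}$). For each line $\ell\ne r_{U_1}$ in such a $p(P_{\alpha u},\pi_{\alpha v})$, the lines $\ell,\ell^{\tau_\eta}$ are skew and $\mathcal{R}_\ell:=\mathcal{D}_\eta\cap\mathcal{S}_\ell$ is a regulus of $\Sigma_\eta$ containing $r_{U_1}\cap\Sigma_\eta$; $\mathcal{R}_\ell^{o}$ is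 its opposite regulus. A set $\mathcal{P}$ of $q+1$ pairs as in the claim is a good set if for any two of its members with $(\alpha_i,u_i,v_i)\ne(\alpha_j,u_j,v_j)$ both $u_iv_j-v_iu_j\neq0$ and $\alpha_iu_i(\alpha_jv_j)^q-(\alpha_iv_i)^q\alpha_ju_j\neq0$ hold. A line-spread of $\mathrm{PG}(3,q)$ is a set of lines partitioning the points; a line-parallelism is a set of pairwise disjoint line-spreads such that every line lies in exactly one of them. *)

theory Defs
  imports "HOL-Analysis.Analysis" "HOL-Number_Theory.Prime_Powers" "HOL-Library.Disjoint_Sets"
begin

section \<open>Projective space over a field\<close>

text \<open>
  Points of PG(3,K) are the one-dimensional subspaces of \<open>K\<^sup>4\<close>, as sets of vectors.
  Lines, planes, subgeometries and reguli are sets of points (or sets of such sets), so that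
  intersecting a line with a subgeometry is plain set intersection.
\<close>

type_synonym 'a ppoint = "('a ^ 4) set"

definition pt :: "'a::field ^ 4 \<Rightarrow> 'a ppoint" where
  "pt x = vec.span {x}"

definition pg_points :: "'a::field ppoint set" where
  "pg_points = {pt x | x. x \<noteq> 0}"

definition join :: "'a::field ppoint \<Rightarrow> 'a ppoint \<Rightarrow> 'a ppoint set" where
  "join P Q = {R \<in> pg_points. R \<subseteq> vec.span (P \<union> Q)}"

definition pg_lines :: "'a::field ppoint set set" where
  "pg_lines = {join P Q | P Q. P \<in> pg_points \<and> Q \<in> pg_points \<and> P \<noteq> Q}"

text \<open>The lines of a subgeometry \<open>\<Sigma>\<close>, as sets of points of \<open>\<Sigma>\<close>.\<close>

definition sub_lines :: "'a::field ppoint set \<Rightarrow> 'a ppoint set set" where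
  "sub_lines \<Sigma> = {join P Q \<inter> \<Sigma> | P Q. P \<in> \<Sigma> \<and> Q \<in> \<Sigma> \<and> P \<noteq> Q}"

definition line_spread :: "'a::field ppoint set \<Rightarrow> 'a ppoint set set \<Rightarrow> bool" where
  "line_spread \<Sigma> S \<longleftrightarrow> S \<subseteq> sub_lines \<Sigma> \<and> partition_on \<Sigma> S"

definition line_parallelism :: "'a::field ppoint set \<Rightarrow> 'a ppoint set set set \<Rightarrow> bool" where
  "line_parallelism \<Sigma> Ss \<longleftrightarrow>
     (\<forall>S\<in>Ss. line_spread \<Sigma> S) \<and> disjoint Ss \<and> (\<forall>l\<in>sub_lines \<Sigma>. \<exists>!S. S \<in> Ss \<and> l \<in> S)"

definition opposite_regulus :: "'a::field ppoint set \<Rightarrow> 'a ppoint set set \<Rightarrow> 'a ppoint set set" where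
  "opposite_regulus \<Sigma> R = {m \<in> sub_lines \<Sigma>. \<forall>r\<in>R. m \<inter> r \<noteq> {}}"

section \<open>The field of order \<open>q\<^sup>2\<close>\<close>

text \<open>In all that follows \<open>'a\<close> is meant to be a field with \<open>q\<^sup>2\<close> elements.\<close>

definition subfield_q :: "nat \<Rightarrow> 'a::field set" where
  "subfield_q q = {x. x ^ q = x}"

definition norm_one :: "nat \<Rightarrow> 'a::field set" where
  "norm_one q = {u. u ^ (q + 1) = 1}"

definition norm_transversal :: "nat \<Rightarrow> 'a::field set \<Rightarrow> bool" where
  "norm_transversal q \<Lambda> \<longleftrightarrow>
     0 \<notin> \<Lambda> \<and> card \<Lambda> = q - 1 \<and> inj_on (\<lambda>\<alpha>. \<alpha> ^ (q + 1)) \<Lambda>"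

definition admissible_set :: "nat \<Rightarrow> 'a::field set \<Rightarrow> bool" where
  "admissible_set q A \<longleftrightarrow>
     A \<subseteq> subfield_q q - {0} \<and>
     (if even q then
        card A = (q - 2) div 2 \<and>
        {1} \<union> A \<union> inverse ` A = subfield_q q - {0} \<and>
        {1} \<inter> A = {} \<and> {1} \<inter> inverse ` A = {} \<and> A \<inter> inverse ` A = {}
      else
        card A = (q - 3) div 2 \<and>
        {1, -1} \<union> A \<union> inverse ` A = subfield_q q - {0} \<and>
        {1, -1} \<inter> A = {} \<and> {1, -1} \<inter> inverse ` A = {} \<and> A \<inter> inverse ` A = {} \<and>
        (\<forall>a\<in>A. - a \<notin> A))"

definition index_set :: "nat \<Rightarrow> 'a::field set \<Rightarrow> 'a set \<Rightarrow> 'a set" where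
  "index_set q \<Lambda> A =
     {\<alpha> \<in> \<Lambda>. \<alpha> ^ (q + 1) \<in> (if even q then A else A \<union> {-1})}"

section \<open>Baer sublines and Baer subgeometries\<close>

definition baer_sublines :: "nat \<Rightarrow> 'a::field ppoint set set" where
  "baer_sublines q =
     {{pt (a *s x + b *s y) | a b. a \<in> subfield_q q \<and> b \<in> subfield_q q \<and> (a, b) \<noteq> (0, 0)}
      | x y. x \<noteq> 0 \<and> y \<noteq> 0 \<and> pt x \<noteq> pt y}"

definition Sigma_geom :: "nat \<Rightarrow> 'a::field \<Rightarrow> 'a ppoint set" where
  "Sigma_geom q \<alpha> = {pt (vector [x, y, \<alpha> * x ^ q, \<alpha> * y ^ q]) | x y. (x, y) \<noteq> (0, 0)}"

text \<open>
  \<open>tau_vec\<close> is semilinear, so its image on a one-dimensional subspace (that is, on a point)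
  is again one.
\<close>

definition tau_vec :: "nat \<Rightarrow> 'a::field \<Rightarrow> 'a ^ 4 \<Rightarrow> 'a ^ 4" where
  "tau_vec q \<alpha> x =
     vector [(x $ 3) ^ q, (x $ 4) ^ q, \<alpha> ^ (q + 1) * (x $ 1) ^ q, \<alpha> ^ (q + 1) * (x $ 2) ^ q]"

definition tau :: "nat \<Rightarrow> 'a::field \<Rightarrow> 'a ppoint \<Rightarrow> 'a ppoint" where
  "tau q \<alpha> P = tau_vec q \<alpha> ` P"

definition U1 :: "'a::field ppoint" where "U1 = pt (vector [1, 0, 0, 0])"
definition U2 :: "'a::field ppoint" where "U2 = pt (vector [0, 1, 0, 0])"
definition U3 :: "'a::field ppoint" where "U3 = pt (vector [0, 0, 1, 0])"

definition t1 :: "'a::field ppoint set" where "t1 = join U1 U2"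

definition r_U1 :: "'a::field ppoint set" where "r_U1 = join U1 U3"

section \<open>Spreads, reguli and pencils\<close>

definition S_spread :: "nat \<Rightarrow> 'a::field \<Rightarrow> 'a ppoint set \<Rightarrow> 'a ppoint set set" where
  "S_spread q \<eta> l = {join P (tau q \<eta> P) \<inter> Sigma_geom q \<eta> | P. P \<in> l}"

definition D_spread :: "nat \<Rightarrow> 'a::field \<Rightarrow> 'a ppoint set set" where
  "D_spread q \<eta> = S_spread q \<eta> t1"

definition R_regulus :: "nat \<Rightarrow> 'a::field \<Rightarrow> 'a ppoint set \<Rightarrow> 'a ppoint set set" where
  "R_regulus q \<eta> l = D_spread q \<eta> \<inter> S_spread q \<eta> l"

definition P_point :: "'a::field \<Rightarrow> 'a ppoint" where
  "P_point c = pt (vector [1, 0, c, 0])"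

definition pi_plane :: "'a::field \<Rightarrow> 'a ppoint set" where
  "pi_plane c = {R \<in> pg_points. \<forall>x\<in>R. x $ 4 = c * x $ 2}"

text \<open>The lines of the plane \<open>\<pi>\<close> through \<open>P\<close> meeting \<open>\<pi> \<inter> \<Sigma>\<^sub>\<alpha>\<close> in a Baer subline.\<close>

definition pencil :: "nat \<Rightarrow> 'a::field \<Rightarrow> 'a ppoint \<Rightarrow> 'a ppoint set \<Rightarrow> 'a ppoint set set" where
  "pencil q \<alpha> P \<pi> =
     {l \<in> pg_lines. l \<subseteq> \<pi> \<and> P \<in> l \<and> l \<inter> (\<pi> \<inter> Sigma_geom q \<alpha>) \<in> baer_sublines q}"

section \<open>Sets of pairs\<close>

text \<open>
  The parameters \<open>\<alpha>\<close>, \<open>u\<close>, \<open>v\<close> are determined by the pair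
  \<open>(P_point (\<alpha> * u), pi_plane (\<alpha> * v))\<close> as long as \<open>\<alpha>\<close> ranges over elements with pairwise distinct
  norms and \<open>u\<close>, \<open>v\<close> over elements of norm 1.  Hence it does no harm to quantify over them below.
\<close>

definition pairs :: "nat \<Rightarrow> 'a::field set \<Rightarrow> ('a ppoint \<times> 'a ppoint set) set" where
  "pairs q I =
     {(P_point (\<alpha> * u), pi_plane (\<alpha> * v)) | \<alpha> u v.
        \<alpha> \<in> I \<and> u \<in> norm_one q \<and> v \<in> norm_one q}"

definition lines_of_pairs ::
    "nat \<Rightarrow> 'a::field set \<Rightarrow> ('a ppoint \<times> 'a ppoint set) set \<Rightarrow> 'a ppoint set set" where
  "lines_of_pairs q I Ps =
     {l. \<exists>\<alpha> u v. \<alpha> \<in> I \<and> u \<in> norm_one q \<and> v \<in> norm_one q \<and>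
           (P_point (\<alpha> * u), pi_plane (\<alpha> * v)) \<in> Ps \<and>
           l \<in> pencil q \<alpha> (P_point (\<alpha> * u)) (pi_plane (\<alpha> * v)) - {r_U1}}"

definition good_set :: "nat \<Rightarrow> 'a::field set \<Rightarrow> ('a ppoint \<times> 'a ppoint set) set \<Rightarrow> bool" where
  "good_set q I Ps \<longleftrightarrow>
     (\<forall>\<alpha>\<in>I. \<forall>u\<in>norm_one q. \<forall>v\<in>norm_one q.
      \<forall>\<beta>\<in>I. \<forall>u'\<in>norm_one q. \<forall>v'\<in>norm_one q.
        (P_point (\<alpha> * u), pi_plane (\<alpha> * v)) \<in> Ps \<longrightarrow>
        (P_point (\<beta> * u'), pi_plane (\<beta> * v')) \<in> Ps \<longrightarrow>
        (\<alpha>, u, v) \<noteq> (\<beta>, u', v') \<longrightarrow>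
          u * v' - v * u' \<noteq> 0 \<and>
          \<alpha> * u * (\<beta> * v') ^ q - (\<alpha> * v) ^ q * (\<beta> * u') \<noteq> 0)"

definition Pi_set ::
    "nat \<Rightarrow> 'a::field \<Rightarrow> 'a set \<Rightarrow> ('a ppoint \<times> 'a ppoint set) set \<Rightarrow> 'a ppoint set set set" where
  "Pi_set q \<eta> I Ps =
     {(S_spread q \<eta> l - R_regulus q \<eta> l) \<union> opposite_regulus (Sigma_geom q \<eta>) (R_regulus q \<eta> l)
      | l. l \<in> lines_of_pairs q I Ps} \<union> {D_spread q \<eta>}"

end

theory Submission
  imports Defs "HOL-Computational_Algebra.Polynomial"
begin

text \<open>
  Write \<open>K\<close> for the field with \<open>q\<^sup>2\<close> elements and \<open>cj x = x\<^sup>q\<close>.  As \<open>\<eta>\<close> has norm 1, \<open>\<Sigma>\<^sub>\<eta>\<close> consists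
  of the points \<open>(x, y, cj x, cj y)\<close>, so its lines are the two-dimensional \<open>F\<^sub>q\<close>-subspaces of \<open>K\<^sup>2\<close>,
  and \<open>\<D>\<^sub>\<eta>\<close> consists of the one-dimensional \<open>K\<close>-subspaces.  A line of the pencil of
  \<open>(P\<^bsub>\<alpha>u\<^esub>, \<pi>\<^bsub>\<alpha>v\<^esub>)\<close> other than \<open>r\<^bsub>U1\<^esub>\<close> is \<open>{(s, t, a s + c t, b t)}\<close> with \<open>a = \<alpha> u\<close>, \<open>b = \<alpha> v\<close> and one of
  \<open>q\<close> possible values of \<open>c\<close>; its spread is the image of \<open>\<D>\<^sub>\<eta>\<close> under the \<open>F\<^sub>q\<close>-linear bijection
  \<open>(s, t) \<mapsto> (s + cj (a s + c t), t + cj (b t))\<close>.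

  Every point of \<open>\<Sigma>\<^sub>\<eta>\<close> is on \<open>q\<^sup>2 + q + 1\<close> lines and there are \<open>q (q + 1)\<close> lines in the pencils, so
  one has a parallelism iff the switched spreads of distinct lines are disjoint.  Two opposite
  reguli share a line iff the reguli agree, which happens for some lines of two different pairs iff
  \<open>u v' = v u'\<close>.  A common line of the two remaining parts amounts to a solution \<open>s\<close> of an equation
  \<open>E s - F cj s = const\<close> outside the reguli.  If \<open>u v' \<noteq> v u'\<close>, the second common element of the two
  reguli, besides the one on \<open>r\<^bsub>U1\<^esub>\<close>, yields a solution, so there is one outside the reguli iff \<open>E\<close> and \<open>F\<close> have the same norm; the difference of the norms is
  \<open>(1 - N a) (1 - N a') (Tr (b' cj b) - Tr (a' cj a))\<close>, and since \<open>a' cj a\<close> and \<open>b' cj b\<close> have the same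
  norm, the traces agree iff one of the two conditions of goodness fails.
\<close>

section \<open>Finite field arithmetic and the conjugation \<open>cj\<close>\<close>

declare split_paired_All [simp del] split_paired_Ex [simp del]

text \<open>Multiplication by a non-zero \<open>x\<close> permutes the non-zero elements; comparing
  the products over them gives \<open>x ^ (CARD('a) - 1) = 1\<close>.\<close>

lemma finite_field_power_CARD:
  fixes x :: "'a::{field,finite}"
  shows "x ^ CARD('a) = x"
proof (cases "x = 0")
  case True
  then show ?thesis by (simp add: zero_power)
next
  case False
  have "(\<Prod>y\<in>UNIV - {0}. x * y) = (\<Prod>y\<in>UNIV - {0}. y)"
    by (rule prod.reindex_bij_witness[of _ "\<lambda>y. y / x" "\<lambda>y. x * y"]) (use False in auto)
  then have "x ^ (CARD('a) - 1) = 1"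
    by (simp add: prod.distrib)
  then have "x * x ^ (CARD('a) - 1) = x"
    by simp
  then show ?thesis
    by (metis Suc_diff_1 power_Suc zero_less_card_finite)
qed

text \<open>Conjugation is a parameter tied to the power by \<open>cj_eq\<close>, so that
  computations with conjugates do not involve exponents.\<close>

locale quadratic_extension =
  fixes q :: nat and cj :: "'a::{field,finite} \<Rightarrow> 'a"
  assumes primepow_q: "primepow q"
    and CARD_eq: "CARD('a) = q ^ 2"
    and cj_eq: "cj x = x ^ q"
begin

lemma q_gt_1: "q > 1"
  using primepow_q primepow_gt_Suc_0 by auto

lemma q_pos: "q > 0"
  using q_gt_1 by simp

text \<open>Translation by 1 permutes the field, so \<open>CARD('a)\<close> vanishes in it. Hence
  the characteristic is the prime dividing \<open>q\<close>, and the freshman's dream applies to the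
  power \<open>q\<close>.\<close>

lemma cj_add: "cj (x + y) = cj x + cj y"
proof -
  obtain p k where p: "prime p" "k > 0" "q = p ^ k"
    using primepow_q by (auto simp: primepow_def)
  have pos: "CHAR('a) > 0"
    using finite_imp_CHAR_pos[where ?'a = 'a] by simp
  then have prm: "prime CHAR('a)"
    by (rule prime_CHAR_semidom)
  have "(\<Sum>x\<in>UNIV. x + 1) = (\<Sum>x\<in>UNIV. x :: 'a)"
    by (rule sum.reindex_bij_witness[of _ "\<lambda>x. x - 1" "\<lambda>x. x + 1"]) auto
  then have "of_nat CARD('a) = (0 :: 'a)"
    by (simp add: sum.distrib)
  then have "CHAR('a) dvd CARD('a)"
    by (simp only: of_nat_eq_0_iff_char_dvd)
  then have "CHAR('a) dvd p ^ (k * 2)"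
    by (simp only: CARD_eq p(3) power_mult)
  then have "CHAR('a) = p"
    using prm p(1) by (metis prime_dvd_power primes_dvd_imp_eq)
  then show ?thesis
    using freshmans_dream'[OF prm, of q k] p by (simp add: cj_eq)
qed

lemma cj_mult: "cj (x * y) = cj x * cj y"
  by (simp add: cj_eq power_mult_distrib)

lemma cj_0 [simp]: "cj 0 = 0"
  using q_pos by (simp add: cj_eq)

lemma cj_1 [simp]: "cj 1 = 1"
  by (simp add: cj_eq)

lemma cj_minus: "cj (- x) = - cj x"
  using cj_add[of x "- x"] by (simp add: eq_neg_iff_add_eq_0 add.commute)

lemma cj_diff: "cj (x - y) = cj x - cj y"
  using cj_add[of x "- y"] by (simp add: cj_minus)

lemma cj_divide: "cj (x / y) = cj x / cj y"
  by (simp add: cj_eq power_divide)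

lemma cj_cj [simp]: "cj (cj x) = x"
  using finite_field_power_CARD[of x] by (simp add: cj_eq CARD_eq power_mult power2_eq_square)

lemmas cj_hom = cj_add cj_diff cj_minus cj_mult cj_divide

lemma cj_eq_0_iff [simp]: "cj x = 0 \<longleftrightarrow> x = 0"
  using q_pos by (simp add: cj_eq)

lemma norm_eq: "x ^ (q + 1) = x * cj x"
  by (simp add: cj_eq)

lemma norm_one_iff: "u \<in> norm_one q \<longleftrightarrow> u * cj u = 1"
  by (simp add: norm_one_def cj_eq)

definition Fq :: "'a set" where
  "Fq = {x. cj x = x}"

lemma subfield_q_eq: "subfield_q q = Fq"
  by (simp add: subfield_q_def Fq_def cj_eq)

lemma Fq_0 [simp]: "0 \<in> Fq" and Fq_1 [simp]: "1 \<in> Fq"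
  and Fq_add: "x \<in> Fq \<Longrightarrow> y \<in> Fq \<Longrightarrow> x + y \<in> Fq"
  and Fq_mult: "x \<in> Fq \<Longrightarrow> y \<in> Fq \<Longrightarrow> x * y \<in> Fq"
  and Fq_divide: "x \<in> Fq \<Longrightarrow> y \<in> Fq \<Longrightarrow> x / y \<in> Fq"
  and Fq_minus: "x \<in> Fq \<Longrightarrow> - x \<in> Fq"
  and Fq_diff: "x \<in> Fq \<Longrightarrow> y \<in> Fq \<Longrightarrow> x - y \<in> Fq"
  by (auto simp: Fq_def cj_hom)

text \<open>The elements counted are the roots of the polynomial X^q - u X - w.\<close>

lemma card_semilinear_roots_le: "card {x. cj x - u * x = w} \<le> q"
proof -
  define p where "p = monom 1 q - [:w, u:]"
  \<comment> \<open>As q > 1, the linear term does not touch the leading one.\<close>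
  have c: "coeff p q = 1"
    using q_gt_1 by (auto simp: p_def coeff_pCons split: nat.splits)
  have "degree p \<le> q"
    unfolding p_def
    by (rule degree_diff_le) (use q_gt_1 in \<open>auto simp: degree_monom_eq\<close>)
  moreover have "p \<noteq> 0"
    using c by auto
  moreover have "poly p x = cj x - w - u * x" for x
    by (simp add: p_def poly_monom cj_eq algebra_simps)
  ultimately have "card {x. cj x - w - u * x = 0} \<le> q"
    using card_poly_roots_bound[of p] by simp
  moreover have "{x. cj x - u * x = w} = {x. cj x - w - u * x = 0}"
    by (auto simp: algebra_simps)
  ultimately show ?thesis
    by simp
qed

text \<open>Both the fibres and the image of \<open>x \<mapsto> cj x - u * x\<close> have at most \<open>q\<close> elements, while the
  domain has \<open>q\<^sup>2\<close>; so all these bounds are attained.\<close>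

lemma
  assumes "u * cj u = 1"
  shows range_semilinear: "range (\<lambda>x. cj x - u * x) = {w. cj w = - cj u * w}" (is "?I = ?J")
    and card_range_semilinear: "card {w. cj w = - cj u * w} = q"
proof -
  let ?f = "\<lambda>x. cj x - u * x"
  have sub: "?I \<subseteq> ?J"
  proof clarify
    fix x
    have "cj u * (u * x) = x"
      using assms by (simp add: mult.assoc[symmetric] mult.commute)
    then show "cj (cj x - u * x) = - cj u * (cj x - u * x)"
      by (simp add: cj_hom algebra_simps)
  qed
  \<comment> \<open>\<open>?J\<close> is itself a fibre: the one over 0 of the map with
    \<open>- cj u\<close> in place of \<open>u\<close>.\<close>
  have J: "card ?J \<le> q"
    using card_semilinear_roots_le[of "- cj u" 0] by (simp add: eq_neg_iff_add_eq_0)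
  have "q ^ 2 = card (\<Union>w\<in>?I. {x. ?f x = w})"
    by (subst CARD_eq[symmetric]) (rule arg_cong[of _ _ card], auto)
  also have "\<dots> \<le> (\<Sum>w\<in>?I. card {x. ?f x = w})"
    by (rule card_UN_le) simp
  also have "\<dots> \<le> (\<Sum>w\<in>?I. q)"
    by (rule sum_mono) (rule card_semilinear_roots_le)
  finally have "q * q \<le> card ?I * q"
    by (simp add: power2_eq_square)
  then have "q \<le> card ?I"
    using q_pos by simp
  moreover have "card ?I \<le> card ?J"
    by (rule card_mono) (use sub in auto)
  ultimately have "card ?I = card ?J" "card ?J = q"
    using J by linarith+
  then show "?I = ?J" and "card ?J = q"
    using card_subset_eq[OF _ sub] by auto
qed

text \<open>Instance \<open>- cj u\<close> of the previous count: its norm is 1 as well, and the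
  image found there becomes the kernel wanted here.\<close>

lemma card_semilinear_kernel:
  assumes "u * cj u = 1"
  shows "card {x. cj x = u * x} = q"
proof -
  have "(- cj u) * cj (- cj u) = 1"
    using assms by (simp add: cj_minus mult.commute)
  then show ?thesis
    using card_range_semilinear[of "- cj u"] by (simp add: cj_minus)
qed

text \<open>The kernel has q > 1 elements, so one of them is not 0. This is the source of
  \<open>\<sigma>\<close> and of the scalings used below.\<close>

lemma hilbert90:
  assumes "u * cj u = 1"
  obtains y where "y \<noteq> 0" "cj y = u * y"
proof -
  have "\<not> {x. cj x = u * x} \<subseteq> {0}"
    using card_mono[of "{0}" "{x. cj x = u * x}"] card_semilinear_kernel[OF assms] q_gt_1 by auto
  then show ?thesis
    using that by auto
qed

lemma card_Fq: "card Fq = q"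
  using card_semilinear_kernel[of 1] by (simp add: Fq_def)

lemma ex_not_Fq: obtains w where "w \<notin> Fq"
proof -
  have "Fq \<noteq> UNIV"
    using card_Fq CARD_eq q_gt_1 by (auto simp: power2_eq_square)
  then show ?thesis
    using that by auto
qed

section \<open>Lines of the Baer subgeometry as subspaces\<close>

definition sm :: "'a \<Rightarrow> 'a \<times> 'a \<Rightarrow> 'a \<times> 'a" where
  "sm k w = (k * fst w, k * snd w)"

lemma sm_simps [simp]:
  "fst (sm k w) = k * fst w" "snd (sm k w) = k * snd w" "sm 0 w = 0" "sm 1 w = w" "sm k 0 = 0"
  "sm k (sm l w) = sm (k * l) w" "sm k (x, y) = (k * x, k * y)"
  by (auto simp: sm_def prod_eq_iff)

lemma sm_eq_0_iff [simp]: "sm k w = 0 \<longleftrightarrow> k = 0 \<or> w = 0"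
  by (auto simp: sm_def prod_eq_iff)

lemma sm_add_left: "sm (k + l) w = sm k w + sm l w"
  and sm_add_right: "sm k (v + w) = sm k v + sm k w"
  and sm_diff_left: "sm (k - l) w = sm k w - sm l w"
  by (auto simp: sm_def prod_eq_iff algebra_simps)

lemma sm_inj: "w \<noteq> 0 \<Longrightarrow> sm k w = sm l w \<longleftrightarrow> k = l"
  by (auto simp: sm_def prod_eq_iff)

definition Fq_closed :: "('a \<times> 'a) set \<Rightarrow> bool" where
  "Fq_closed W \<longleftrightarrow> (\<forall>w\<in>W. \<forall>w'\<in>W. w + w' \<in> W) \<and> (\<forall>k\<in>Fq. \<forall>w\<in>W. sm k w \<in> W)"

text \<open>Under the identification of \<open>\<Sigma>\<^sub>\<eta>\<close> with \<open>K\<^sup>2\<close> modulo \<open>F\<^sub>q\<close>, these are the lines of \<open>\<Sigma>\<^sub>\<eta>\<close>.\<close>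

definition Lines :: "('a \<times> 'a) set set" where
  "Lines = {W. Fq_closed W \<and> card W = q ^ 2}"

definition lin :: "'a \<times> 'a \<Rightarrow> 'a \<times> 'a \<Rightarrow> ('a \<times> 'a) set" where
  "lin v w = (\<lambda>(i, j). sm i v + sm j w) ` (Fq \<times> Fq)"

definition indep :: "'a \<times> 'a \<Rightarrow> 'a \<times> 'a \<Rightarrow> bool" where
  "indep v w \<longleftrightarrow> (\<forall>i\<in>Fq. \<forall>j\<in>Fq. sm i v + sm j w = 0 \<longrightarrow> i = 0 \<and> j = 0)"

lemma mem_lin_iff: "x \<in> lin v w \<longleftrightarrow> (\<exists>i\<in>Fq. \<exists>j\<in>Fq. x = sm i v + sm j w)"
  by (auto simp: lin_def)

lemma indepI:
  assumes "v \<noteq> 0" "\<And>k. k \<in> Fq \<Longrightarrow> w \<noteq> sm k v"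
  shows "indep v w"
  unfolding indep_def
proof (intro ballI impI)
  fix i j assume ij: "i \<in> Fq" "j \<in> Fq" and eq: "sm i v + sm j w = 0"
  have "j = 0"
  proof (rule ccontr)
    assume "j \<noteq> 0"
    have "sm (1 / j) (sm i v + sm j w) = 0"
      using eq by simp
    then have "w = sm (- i / j) v"
      using \<open>j \<noteq> 0\<close> by (simp add: prod_eq_iff field_simps eq_neg_iff_add_eq_0)
    moreover have "- i / j \<in> Fq"
      using ij by (intro Fq_divide Fq_minus)
    ultimately show False
      using assms(2) by blast
  qed
  then show "i = 0 \<and> j = 0"
    using eq assms(1) by simp
qed

lemma card_lin:
  assumes "indep v w"
  shows "card (lin v w) = q ^ 2"
proof -
  have "inj_on (\<lambda>(i, j). sm i v + sm j w) (Fq \<times> Fq)"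
  proof (rule inj_onI, clarify)
    fix i j k l assume F: "i \<in> Fq" "j \<in> Fq" "k \<in> Fq" "l \<in> Fq"
      and "sm i v + sm j w = sm k v + sm l w"
    then have "sm (i - k) v + sm (j - l) w = 0"
      by (simp add: sm_diff_left algebra_simps)
    then have "i - k = 0 \<and> j - l = 0"
      using assms F unfolding indep_def by (meson Fq_diff)
    then show "i = k \<and> j = l"
      by simp
  qed
  then show ?thesis
    by (simp add: lin_def card_image card_Fq power2_eq_square)
qed

lemma Fq_closed_lin: "Fq_closed (lin v w)"
  unfolding Fq_closed_def
proof (intro conjI ballI)
  fix x y assume "x \<in> lin v w" "y \<in> lin v w"
  then obtain i j k l where F: "i \<in> Fq" "j \<in> Fq" "k \<in> Fq" "l \<in> Fq"
    and "x = sm i v + sm j w" "y = sm k v + sm l w"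
    by (auto simp: mem_lin_iff)
  then have "x + y = sm (i + k) v + sm (j + l) w"
    by (simp add: sm_add_left algebra_simps)
  then show "x + y \<in> lin v w"
    using F by (auto simp: mem_lin_iff intro!: bexI Fq_add)
next
  fix x k assume "x \<in> lin v w" "k \<in> Fq"
  then show "sm k x \<in> lin v w"
    by (force simp: mem_lin_iff sm_add_right intro: Fq_mult)
qed

lemma lin_in_Lines: "indep v w \<Longrightarrow> lin v w \<in> Lines"
  by (simp add: Lines_def card_lin Fq_closed_lin)

text \<open>Between finite sets of equal size one inclusion is enough; lines are identified in this
  way throughout.\<close>

lemma Lines_eqI:
  assumes "W \<subseteq> W'" "card W = q ^ 2" "W' \<in> Lines"
  shows "W = W'"
  using assms by (intro card_subset_eq) (auto simp: Lines_def)

lemma Lines_add: "W \<in> Lines \<Longrightarrow> v \<in> W \<Longrightarrow> w \<in> W \<Longrightarrow> v + w \<in> W"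
  and Lines_sm: "W \<in> Lines \<Longrightarrow> k \<in> Fq \<Longrightarrow> w \<in> W \<Longrightarrow> sm k w \<in> W"
  by (auto simp: Lines_def Fq_closed_def)

lemma Lines_eq_lin:
  assumes "W \<in> Lines" "v \<in> W" "w \<in> W" "indep v w"
  shows "W = lin v w"
proof -
  have "lin v w \<subseteq> W"
    using assms by (auto simp: mem_lin_iff intro!: Lines_add Lines_sm)
  then show ?thesis
    using Lines_eqI[OF _ card_lin] assms by metis
qed

lemma Lines_basis:
  assumes "W \<in> Lines" "v \<in> W" "v \<noteq> 0"
  obtains w where "w \<in> W" "w \<noteq> 0" "indep v w"
proof -
  have "card ((\<lambda>k. sm k v) ` Fq) \<le> q"
    using card_image_le[of Fq "\<lambda>k. sm k v"] card_Fq by simp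
  also have "\<dots> < card W"
    using assms(1) q_gt_1 by (simp add: Lines_def power2_eq_square)
  finally have "\<not> W \<subseteq> (\<lambda>k. sm k v) ` Fq"
    using card_mono[of "(\<lambda>k. sm k v) ` Fq" W] by fastforce
  then obtain w where w: "w \<in> W" "w \<notin> (\<lambda>k. sm k v) ` Fq"
    by blast
  then have "w \<noteq> 0"
    by (metis Fq_0 image_eqI sm_simps(3))
  then show ?thesis
    using that[of w] w assms indepI by blast
qed

lemma Lines_card_gt_1: "W \<in> Lines \<Longrightarrow> card W > 1"
  using one_less_power[OF q_gt_1, of 2] by (simp add: Lines_def)

lemma Lines_0:
  assumes "W \<in> Lines"
  shows "0 \<in> W"
proof -
  have "W \<noteq> {}"
    using Lines_card_gt_1[OF assms] by auto
  then obtain w where "w \<in> W"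
    by blast
  then show ?thesis
    using Lines_sm[OF assms, of 0 w] by simp
qed

lemma Lines_nonzero:
  assumes "W \<in> Lines"
  obtains w where "w \<in> W" "w \<noteq> 0"
proof -
  have "\<not> W \<subseteq> {0}"
    using card_mono[of "{0}" W] Lines_card_gt_1[OF assms] by auto
  then show ?thesis
    using that by auto
qed

text \<open>The lines through \<open>x\<close> partition the q^4 - q vectors that are not
  F_q-multiples of \<open>x\<close>, and each line holds q^2 - q of them.\<close>

lemma card_Lines_through:
  assumes "x \<noteq> 0"
  shows "card {W \<in> Lines. x \<in> W} = q ^ 2 + q + 1"
proof -
  define X where "X = (\<lambda>k. sm k x) ` Fq"
  let ?L = "{W \<in> Lines. x \<in> W}"
  have cX: "card X = q"
    unfolding X_def using assms by (subst card_image) (auto simp: inj_on_def sm_inj card_Fq)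
  have sub: "X \<subseteq> W" if "W \<in> ?L" for W
    using that by (auto simp: X_def Lines_sm)
  have ind: "indep x y" if "y \<notin> X" for y
    using that assms by (intro indepI) (auto simp: X_def)
  have cW: "card (W - X) = q ^ 2 - q" if "W \<in> ?L" for W
    using sub[OF that] that by (subst card_Diff_subset) (auto simp: cX Lines_def)
  have cover: "UNIV - X = (\<Union>W\<in>?L. W - X)"
  proof safe
    fix y assume y: "y \<notin> X"
    have "x = sm 1 x + sm 0 y" "y = sm 0 x + sm 1 y"
      by simp_all
    then have "x \<in> lin x y" "y \<in> lin x y"
      unfolding mem_lin_iff by (metis Fq_0 Fq_1)+
    then show "y \<in> (\<Union>W\<in>?L. W - X)"
      using y lin_in_Lines[OF ind[OF y]] by auto
  qed auto
  have "card (UNIV - X) = (\<Sum>W\<in>?L. card (W - X))"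
    unfolding cover
  proof (rule card_UN_disjoint)
    show "\<forall>W\<in>?L. \<forall>W'\<in>?L. W \<noteq> W' \<longrightarrow> (W - X) \<inter> (W' - X) = {}"
      using Lines_eq_lin ind by blast
  qed auto
  moreover have "card (UNIV - X) = q ^ 4 - q"
    by (simp add: card_Diff_subset cX CARD_eq power2_eq_square power4_eq_xxxx mult.assoc)
  ultimately have "q ^ 4 - q = card ?L * (q ^ 2 - q)"
    using cW by simp
  moreover have "q ^ 4 - q = (q ^ 2 + q + 1) * (q ^ 2 - q)"
    by (simp add: diff_mult_distrib2 algebra_simps power2_eq_square power4_eq_xxxx)
  ultimately have "card ?L * (q ^ 2 - q) = (q ^ 2 + q + 1) * (q ^ 2 - q)"
    by simp
  moreover have "q ^ 2 - q \<noteq> 0"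
    using q_gt_1 by (simp add: power2_eq_square)
  ultimately show ?thesis
    by (metis mult_cancel2)
qed

section \<open>Spreads, parallelisms and the counting criterion\<close>

definition spread :: "('a \<times> 'a) set set \<Rightarrow> bool" where
  "spread S \<longleftrightarrow> S \<subseteq> Lines \<and> (\<forall>w. w \<noteq> 0 \<longrightarrow> (\<exists>!W. W \<in> S \<and> w \<in> W))"

definition parallelism :: "('a \<times> 'a) set set set \<Rightarrow> bool" where
  "parallelism \<S> \<longleftrightarrow> (\<forall>S\<in>\<S>. spread S) \<and> (\<forall>W\<in>Lines. \<exists>!S. S \<in> \<S> \<and> W \<in> S)"

lemma spread_ex1:
  assumes "spread S" "w \<noteq> 0"
  shows "\<exists>!W. W \<in> S \<and> w \<in> W"
  using assms unfolding spread_def by (elim conjE allE impE)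

lemma spread_Lines: "spread S \<Longrightarrow> W \<in> S \<Longrightarrow> W \<in> Lines"
  unfolding spread_def by (erule conjE) (rule subsetD)

lemma spread_unique:
  assumes "spread S" "W \<in> S" "W' \<in> S" "w \<in> W" "w \<in> W'" "w \<noteq> 0"
  shows "W = W'"
  using spread_ex1[OF assms(1,6)] assms(2-5) by blast

lemma spread_nonempty:
  assumes "spread S"
  shows "S \<noteq> {}"
proof -
  have "(1, 0) \<noteq> (0 :: 'a \<times> 'a)"
    by (simp add: prod_eq_iff)
  then show ?thesis
    using spread_ex1[OF assms] by blast
qed

lemma parallelism_ex1: "parallelism \<S> \<Longrightarrow> W \<in> Lines \<Longrightarrow> \<exists>!S. S \<in> \<S> \<and> W \<in> S"
  unfolding parallelism_def by (erule conjE) (rule bspec)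

text \<open>Take a point \<open>x\<close> on the line in question and send each spread to its line
  through \<open>x\<close>. Disjointness makes this map injective; there are as many spreads as
  lines through \<open>x\<close>, so it is onto and every line through \<open>x\<close> belongs to
  some spread.\<close>

lemma parallelism_if_disjoint:
  assumes spr: "\<And>S. S \<in> \<S> \<Longrightarrow> spread S" and "card \<S> = q ^ 2 + q + 1"
    and disj: "\<And>S S'. S \<in> \<S> \<Longrightarrow> S' \<in> \<S> \<Longrightarrow> S \<noteq> S' \<Longrightarrow> S \<inter> S' = {}"
  shows "parallelism \<S>"
  unfolding parallelism_def
proof (intro conjI ballI spr)
  fix W assume W: "W \<in> Lines"
  then obtain x where x: "x \<in> W" "x \<noteq> 0"
    using Lines_nonzero by blast
  define f where "f S = (THE W. W \<in> S \<and> x \<in> W)" for S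
  have f: "f S \<in> S \<and> x \<in> f S" if "S \<in> \<S>" for S
    unfolding f_def by (rule theI') (rule spread_ex1[OF spr[OF that] x(2)])
  have "inj_on f \<S>"
  proof (rule inj_onI)
    fix S S' assume "S \<in> \<S>" "S' \<in> \<S>" "f S = f S'"
    then show "S = S'"
      using f[of S] f[of S'] disj[of S S'] by auto
  qed
  then have "card (f ` \<S>) = card {W \<in> Lines. x \<in> W}"
    by (simp add: card_image assms(2) card_Lines_through x)
  moreover have "f ` \<S> \<subseteq> {W \<in> Lines. x \<in> W}"
    using f spr spread_Lines by blast
  ultimately have "f ` \<S> = {W \<in> Lines. x \<in> W}"
    by (intro card_subset_eq) auto
  then obtain S where S: "S \<in> \<S>" "W \<in> S"
    using W x(1) f by (metis (mono_tags, lifting) imageE mem_Collect_eq)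
  then show "\<exists>!S. S \<in> \<S> \<and> W \<in> S"
    by (intro ex1I[of _ S]) (use disj in blast)+
qed

text \<open>The lines through one point lie in pairwise different spreads, because two lines of a
  spread have no common point.\<close>

lemma parallelism_card_ge:
  assumes "parallelism \<S>"
  shows "q ^ 2 + q + 1 \<le> card \<S>"
proof -
  define x :: "'a \<times> 'a" where "x = (1, 0)"
  have x: "x \<noteq> 0"
    by (simp add: x_def prod_eq_iff)
  define g where "g W = (THE S. S \<in> \<S> \<and> W \<in> S)" for W
  have g: "g W \<in> \<S> \<and> W \<in> g W" if "W \<in> Lines" for W
    unfolding g_def by (rule theI') (rule parallelism_ex1[OF assms that])
  have "inj_on g {W \<in> Lines. x \<in> W}"
  proof (rule inj_onI)
    fix W W' assume W: "W \<in> {W \<in> Lines. x \<in> W}" "W' \<in> {W \<in> Lines. x \<in> W}" "g W = g W'"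
    have "spread (g W)"
      using assms g[of W] W by (simp add: parallelism_def)
    then show "W = W'"
      using g[of W] g[of W'] W x by (elim spread_unique) simp_all
  qed
  then have "card {W \<in> Lines. x \<in> W} \<le> card \<S>"
    by (rule card_inj_on_le) (use g in auto)
  then show ?thesis
    by (simp add: card_Lines_through x)
qed

text \<open>Two indices with the same spread violate the right-hand side, so \<open>T\<close> must
  be shown injective for a parallelism. The lower bound on the number of its members forces this,
  and uniqueness of the spread on a line then gives disjointness.\<close>

lemma parallelism_iff_pairwise_disjoint:
  assumes J: "finite J" "card J = q ^ 2 + q"
    and T: "\<And>j. j \<in> J \<Longrightarrow> spread (T j)" and D: "spread D"
    and TD: "\<And>j. j \<in> J \<Longrightarrow> T j \<inter> D = {}"
  shows "parallelism (T ` J \<union> {D}) \<longleftrightarrow> (\<forall>i\<in>J. \<forall>j\<in>J. i \<noteq> j \<longrightarrow> T i \<inter> T j = {})"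
proof
  have DJ: "D \<notin> T ` J"
    using TD spread_nonempty[OF D] by blast
  {
    assume disj: "\<forall>i\<in>J. \<forall>j\<in>J. i \<noteq> j \<longrightarrow> T i \<inter> T j = {}"
    have "inj_on T J"
    proof (rule inj_onI)
      fix i j assume "i \<in> J" "j \<in> J" "T i = T j"
      then show "i = j"
        using disj spread_nonempty[OF T[of i]] by force
    qed
    then have card: "card (T ` J \<union> {D}) = q ^ 2 + q + 1"
      using DJ J by (simp add: card_image)
    show "parallelism (T ` J \<union> {D})"
    proof (rule parallelism_if_disjoint[OF _ card])
      show "spread S" if "S \<in> T ` J \<union> {D}" for S
        using that T D by blast
      fix S S' assume S: "S \<in> T ` J \<union> {D}" "S' \<in> T ` J \<union> {D}" "S \<noteq> S'"
      then consider i j where "i \<in> J" "j \<in> J" "S = T i" "S' = T j" "i \<noteq> j"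
        | i where "i \<in> J" "S = T i" "S' = D" | i where "i \<in> J" "S = D" "S' = T i"
        by auto
      then show "S \<inter> S' = {}"
        using disj TD by cases (simp_all add: Int_commute)
    qed
  }
  assume par: "parallelism (T ` J \<union> {D})"
  then have "card J \<le> card (T ` J)"
    using parallelism_card_ge[OF par] DJ J by simp
  then have inj: "inj_on T J"
    using J card_image_le[of J T] by (intro eq_card_imp_inj_on) auto
  show "\<forall>i\<in>J. \<forall>j\<in>J. i \<noteq> j \<longrightarrow> T i \<inter> T j = {}"
  proof (intro ballI impI equals0I)
    fix i j W assume ij: "i \<in> J" "j \<in> J" "i \<noteq> j" and W: "W \<in> T i \<inter> T j"
    then have "W \<in> Lines"
      using spread_Lines[OF T[of i]] by blast
    then have "\<exists>!S. S \<in> T ` J \<union> {D} \<and> W \<in> S"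
      by (rule parallelism_ex1[OF par])
    then have "T i = T j"
      using ij W by blast
    then show False
      using inj ij by (auto dest: inj_onD)
  qed
qed

section \<open>Regular spreads and reguli\<close>

definition K_line :: "'a \<times> 'a \<Rightarrow> ('a \<times> 'a) set" where
  "K_line p = range (\<lambda>k. sm k p)"

definition D_lines :: "('a \<times> 'a) set set" where
  "D_lines = {K_line p | p. p \<noteq> 0}"

text \<open>For w = (s, t) these are the first two coordinates of the image under \<tau> of the
  point (s, t, a s + c t, b t).\<close>

definition G :: "'a \<Rightarrow> 'a \<Rightarrow> 'a \<Rightarrow> 'a \<times> 'a \<Rightarrow> 'a \<times> 'a" where
  "G a b c w = (cj (a * fst w + c * snd w), cj (b * snd w))"

definition M :: "'a \<Rightarrow> 'a \<Rightarrow> 'a \<Rightarrow> 'a \<times> 'a \<Rightarrow> 'a \<times> 'a" where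
  "M a b c w = w + G a b c w"

text \<open>By \<open>join_tau\<close> below, the image of the K-line of \<open>p\<close> is the
  line of the Baer subgeometry on the join of the point over \<open>p\<close> and its image under
  \<tau>.\<close>

definition S_lines :: "'a \<Rightarrow> 'a \<Rightarrow> 'a \<Rightarrow> ('a \<times> 'a) set set" where
  "S_lines a b c = {M a b c ` K_line p | p. p \<noteq> 0}"

text \<open>\<open>M\<close> maps the \<open>K\<close>-line of \<open>p\<close> to a \<open>K\<close>-line iff \<open>p\<close> and \<open>G p\<close> are linearly dependent.\<close>

definition reg :: "'a \<Rightarrow> 'a \<Rightarrow> 'a \<Rightarrow> 'a \<times> 'a \<Rightarrow> bool" where
  "reg a b c p \<longleftrightarrow> fst p * snd (G a b c p) = snd p * fst (G a b c p)"

lemma mem_K_line_iff: "x \<in> K_line p \<longleftrightarrow> (\<exists>k. x = sm k p)"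
  by (auto simp: K_line_def)

lemma mem_K_line_self [simp]: "p \<in> K_line p"
  unfolding mem_K_line_iff by (rule exI[of _ 1]) simp

lemma K_line_sm: "k \<noteq> 0 \<Longrightarrow> K_line (sm k p) = K_line p"
proof (intro set_eqI iffI)
  fix x assume "k \<noteq> 0" "x \<in> K_line p"
  then obtain l where "x = sm (l / k) (sm k p)"
    by (auto simp: mem_K_line_iff)
  then show "x \<in> K_line (sm k p)"
    unfolding mem_K_line_iff by blast
qed (auto simp: mem_K_line_iff)

lemma K_line_eqI: "x \<in> K_line p \<Longrightarrow> x \<noteq> 0 \<Longrightarrow> K_line x = K_line p"
  by (auto simp: mem_K_line_iff K_line_sm)

lemma K_line_eq_normal: "snd p \<noteq> 0 \<Longrightarrow> K_line p = K_line (fst p / snd p, 1)"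
  using K_line_sm[of "snd p" "(fst p / snd p, 1)"] by (simp add: prod_eq_iff)

lemma K_line_closed:
  "x \<in> K_line p \<Longrightarrow> y \<in> K_line p \<Longrightarrow> x + y \<in> K_line p"
  "x \<in> K_line p \<Longrightarrow> y \<in> K_line p \<Longrightarrow> x - y \<in> K_line p"
  "x \<in> K_line p \<Longrightarrow> sm k x \<in> K_line p"
  by (auto simp: mem_K_line_iff simp flip: sm_add_left sm_diff_left)

lemma card_K_line: "p \<noteq> 0 \<Longrightarrow> card (K_line p) = q ^ 2"
  by (simp add: K_line_def card_image inj_on_def sm_inj CARD_eq)

lemma K_line_in_Lines: "p \<noteq> 0 \<Longrightarrow> K_line p \<in> Lines"
  by (auto simp: Lines_def Fq_closed_def card_K_line K_line_closed)

lemma G_sm: "G a b c (sm k w) = sm (cj k) (G a b c w)"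
  by (simp add: G_def cj_hom algebra_simps)

lemma G_add: "G a b c (v + w) = G a b c v + G a b c w"
  by (simp add: G_def cj_hom algebra_simps)

lemma M_sm: "M a b c (sm k w) = sm k w + sm (cj k) (G a b c w)"
  by (simp add: M_def G_sm)

lemma M_add: "M a b c (v + w) = M a b c v + M a b c w"
  by (simp add: M_def G_add algebra_simps)

lemma M_sm_Fq: "k \<in> Fq \<Longrightarrow> M a b c (sm k w) = sm k (M a b c w)"
  unfolding M_def sm_add_right G_sm by (simp add: Fq_def)

text \<open>Conjugating gives \<open>cj x = - (a * x)\<close>; substituted back, this becomes
  \<open>x * (1 - a * cj a) = 0\<close>.\<close>

lemma cj_fixed_eq_0:
  assumes "x + cj (a * x) = 0" "a * cj a \<noteq> 1"
  shows "x = 0"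
proof -
  have "cj x + a * x = 0"
    using arg_cong[OF assms(1), of cj] by (simp add: cj_hom)
  then have *: "cj x = - (a * x)"
    by (rule eq_neg_iff_add_eq_0[THEN iffD2])
  have "x * (1 - a * cj a) = x + cj (a * x)"
    unfolding cj_mult * by (simp add: algebra_simps)
  then have "x * (1 - a * cj a) = 0"
    using assms(1) by simp
  then show ?thesis
    using assms(2) by auto
qed

lemma M_eq_0:
  assumes "a * cj a \<noteq> 1" "b * cj b \<noteq> 1" "M a b c w = 0"
  shows "w = 0"
proof -
  have eq: "fst w + cj (a * fst w + c * snd w) = 0" "snd w + cj (b * snd w) = 0"
    using assms(3) unfolding M_def G_def prod_eq_iff by simp_all
  have snd: "snd w = 0"
    by (rule cj_fixed_eq_0[OF eq(2) assms(2)])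
  then have "fst w + cj (a * fst w) = 0"
    using eq(1) by simp
  then have "fst w = 0"
    using assms(1) by (rule cj_fixed_eq_0)
  with snd show ?thesis
    by (simp add: prod_eq_iff)
qed

lemma inj_M:
  assumes "a * cj a \<noteq> 1" "b * cj b \<noteq> 1"
  shows "inj (M a b c)"
proof (rule injI)
  fix v w assume "M a b c v = M a b c w"
  then have "M a b c (v - w) = 0"
    using M_add[of a b c "v - w" w] by simp
  then have "v - w = 0"
    by (rule M_eq_0[OF assms])
  then show "v = w"
    by simp
qed

lemma M_K_line_in_Lines:
  assumes "a * cj a \<noteq> 1" "b * cj b \<noteq> 1" "p \<noteq> 0"
  shows "M a b c ` K_line p \<in> Lines"
proof -
  have "card (M a b c ` K_line p) = q ^ 2"
    using card_image[OF inj_on_subset[OF inj_M[OF assms(1,2)] subset_UNIV]] card_K_line[OF assms(3)]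
    by simp
  moreover have "Fq_closed (M a b c ` K_line p)"
    unfolding Fq_closed_def
  proof (intro conjI ballI)
    fix x y assume "x \<in> M a b c ` K_line p" "y \<in> M a b c ` K_line p"
    then show "x + y \<in> M a b c ` K_line p"
      by (elim imageE) (simp add: K_line_closed flip: M_add)
  next
    fix k x assume "k \<in> Fq" "x \<in> M a b c ` K_line p"
    then show "sm k x \<in> M a b c ` K_line p"
      by (elim imageE) (simp add: K_line_closed flip: M_sm_Fq)
  qed
  ultimately show ?thesis
    by (simp add: Lines_def)
qed

text \<open>The K-lines partition the non-zero vectors, and the F_q-linear bijection
  \<open>M\<close> carries this partition over.\<close>

lemma spread_S_lines:
  assumes "a * cj a \<noteq> 1" "b * cj b \<noteq> 1"
  shows "spread (S_lines a b c)"
  unfolding spread_def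
proof (intro conjI allI impI)
  show "S_lines a b c \<subseteq> Lines"
    using M_K_line_in_Lines[OF assms] by (auto simp: S_lines_def)
next
  fix w :: "'a \<times> 'a" assume w: "w \<noteq> 0"
  have "surj (M a b c)"
    using inj_M[OF assms] by (simp add: finite_UNIV_inj_surj)
  then obtain p where p: "w = M a b c p"
    by blast
  have M0: "M a b c 0 = 0"
    by (simp add: M_def G_def prod_eq_iff)
  then have "p \<noteq> 0"
    using w p by auto
  show "\<exists>!W. W \<in> S_lines a b c \<and> w \<in> W"
  proof (rule ex1I[of _ "M a b c ` K_line p"])
    show "M a b c ` K_line p \<in> S_lines a b c \<and> w \<in> M a b c ` K_line p"
      using \<open>p \<noteq> 0\<close> p unfolding S_lines_def by (simp, blast)
  next
    fix W assume W: "W \<in> S_lines a b c \<and> w \<in> W"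
    then obtain p' where p': "W = M a b c ` K_line p'"
      unfolding S_lines_def by blast
    then have "p \<in> K_line p'"
      using W p inj_image_mem_iff[OF inj_M[OF assms]] by blast
    with p' show "W = M a b c ` K_line p"
      using K_line_eqI \<open>p \<noteq> 0\<close> by metis
  qed
qed

text \<open>Zero parameters make \<open>M\<close> the identity, so results on \<open>S_lines\<close>
  with norms different from 1 also cover \<open>D_lines\<close>.\<close>

lemma S_lines_0: "S_lines 0 0 0 = D_lines"
proof -
  have "M 0 0 0 = id"
    by (auto simp: M_def G_def prod_eq_iff)
  then show ?thesis
    by (simp add: S_lines_def D_lines_def)
qed

lemma spread_D_lines: "spread D_lines"
  using spread_S_lines[of 0 0 0] by (simp add: S_lines_0)

lemma reg_iff_K_line: "p \<noteq> 0 \<Longrightarrow> reg a b c p \<longleftrightarrow> G a b c p \<in> K_line p"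
proof
  assume p: "p \<noteq> 0" and r: "reg a b c p"
  show "G a b c p \<in> K_line p"
  proof (cases "snd p = 0")
    case True
    then have "fst p \<noteq> 0"
      using p by (simp add: prod_eq_iff)
    then have "G a b c p = sm (fst (G a b c p) / fst p) p"
      using r True by (simp add: prod_eq_iff reg_def)
    then show ?thesis
      unfolding mem_K_line_iff by blast
  next
    case False
    then have "G a b c p = sm (snd (G a b c p) / snd p) p"
      using r by (simp add: prod_eq_iff reg_def field_simps)
    then show ?thesis
      unfolding mem_K_line_iff by blast
  qed
qed (auto simp: mem_K_line_iff reg_def)

lemma M_K_line_reg:
  assumes "a * cj a \<noteq> 1" "b * cj b \<noteq> 1" "p \<noteq> 0" "reg a b c p"
  shows "M a b c ` K_line p = K_line p"
proof (rule Lines_eqI)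
  show "card (M a b c ` K_line p) = q ^ 2"
    using M_K_line_in_Lines[OF assms(1-3)] by (simp add: Lines_def)
  have "G a b c p \<in> K_line p"
    using assms reg_iff_K_line by blast
  then have "M a b c (sm k p) \<in> K_line p" for k
    unfolding M_sm by (intro K_line_closed(1) K_line_closed(3)) simp_all
  then show "M a b c ` K_line p \<subseteq> K_line p"
    by (auto simp: K_line_def)
qed (use K_line_in_Lines assms in auto)

text \<open>For \<open>k\<close> outside F_q, combining the images of \<open>p\<close> and
  \<open>sm k p\<close> eliminates \<open>G a b c p\<close> and leaves a non-zero multiple of
  \<open>p\<close>. So \<open>p\<close>, and then \<open>G a b c p\<close>, lies on the K-line of
  \<open>p'\<close>.\<close>

lemma reg_if_M_K_line:
  assumes "M a b c ` K_line p = K_line p'" "p \<noteq> 0"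
  shows "reg a b c p"
proof -
  obtain k where k: "k \<notin> Fq"
    by (rule ex_not_Fq)
  then have d: "cj k - k \<noteq> 0"
    by (auto simp: Fq_def)
  have Mp: "M a b c x \<in> K_line p'" if "x \<in> K_line p" for x
    using imageI[OF that, of "M a b c"] unfolding assms(1) .
  have 1: "p + G a b c p \<in> K_line p'"
    using Mp[OF mem_K_line_self] unfolding M_def .
  moreover have "sm k p + sm (cj k) (G a b c p) \<in> K_line p'"
    using Mp[OF K_line_closed(3)[OF mem_K_line_self]] unfolding M_sm .
  ultimately have "sm (cj k) (p + G a b c p) - (sm k p + sm (cj k) (G a b c p)) \<in> K_line p'"
    by (intro K_line_closed(2) K_line_closed(3))
  also have "sm (cj k) (p + G a b c p) - (sm k p + sm (cj k) (G a b c p)) = sm (cj k - k) p"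
    by (simp add: prod_eq_iff algebra_simps)
  finally have "sm (1 / (cj k - k)) (sm (cj k - k) p) \<in> K_line p'"
    by (rule K_line_closed(3))
  then have p: "p \<in> K_line p'"
    using d by simp
  then have "K_line p = K_line p'"
    using assms(2) by (rule K_line_eqI)
  moreover have "(p + G a b c p) - p \<in> K_line p'"
    by (rule K_line_closed(2)[OF 1 p])
  ultimately show ?thesis
    using assms(2) by (simp add: reg_iff_K_line)
qed

definition R_lines :: "'a \<Rightarrow> 'a \<Rightarrow> 'a \<Rightarrow> ('a \<times> 'a) set set" where
  "R_lines a b c = D_lines \<inter> S_lines a b c"

lemma R_lines_eq:
  assumes "a * cj a \<noteq> 1" "b * cj b \<noteq> 1"
  shows "R_lines a b c = {K_line p | p. p \<noteq> 0 \<and> reg a b c p}"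
proof (intro set_eqI iffI)
  fix L assume "L \<in> R_lines a b c"
  then obtain p p' where "L = M a b c ` K_line p" "p \<noteq> 0" "L = K_line p'"
    by (auto simp: R_lines_def D_lines_def S_lines_def)
  then show "L \<in> {K_line p | p. p \<noteq> 0 \<and> reg a b c p}"
    using reg_if_M_K_line M_K_line_reg[OF assms] by blast
next
  fix L assume "L \<in> {K_line p | p. p \<noteq> 0 \<and> reg a b c p}"
  then show "L \<in> R_lines a b c"
    using M_K_line_reg[OF assms] unfolding R_lines_def D_lines_def S_lines_def by blast
qed

lemma M_K_line_in_R_lines_iff:
  assumes "a * cj a \<noteq> 1" "b * cj b \<noteq> 1" "p \<noteq> 0"
  shows "M a b c ` K_line p \<in> R_lines a b c \<longleftrightarrow> reg a b c p"
  unfolding R_lines_eq[OF assms(1,2)]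
  using assms M_K_line_reg[OF assms] reg_if_M_K_line[of a b c p] by blast

section \<open>Opposite reguli and switched spreads\<close>

definition opp :: "('a \<times> 'a) set set \<Rightarrow> ('a \<times> 'a) set set" where
  "opp \<R> = {m \<in> Lines. \<forall>r\<in>\<R>. \<exists>w. w \<noteq> 0 \<and> w \<in> m \<and> w \<in> r}"

definition switched :: "'a \<Rightarrow> 'a \<Rightarrow> 'a \<Rightarrow> ('a \<times> 'a) set set" where
  "switched a b c = (S_lines a b c - R_lines a b c) \<union> opp (R_lines a b c)"

text \<open>With \<open>\<sigma>\<close> and \<open>s\<close> as in \<open>opp_basis\<close> below, the regulus consists of the \<open>K\<close>-lines of \<open>(1, 0)\<close> and of
  \<open>(k * \<sigma> + s, 1)\<close> for \<open>k \<in> F\<^sub>q\<close>, and the \<open>F\<^sub>q\<close>-span of \<open>(\<sigma>, 0)\<close> and \<open>(s, 1)\<close> meets all of them.\<close>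

definition opp_line :: "'a \<Rightarrow> 'a \<Rightarrow> 'a \<Rightarrow> ('a \<times> 'a) set" where
  "opp_line \<sigma> s r = lin (r * \<sigma>, 0) (r * s, r)"

text \<open>What is retained of a = \<alpha> u and b = \<alpha> v with u, v of norm 1: the common
  norm, neither 0 nor 1.\<close>

definition param :: "'a \<Rightarrow> 'a \<Rightarrow> bool" where
  "param a b \<longleftrightarrow> a \<noteq> 0 \<and> b \<noteq> 0 \<and> a * cj a = b * cj b \<and> a * cj a \<noteq> 1"

text \<open>The values of \<open>c\<close> for which the line \<open>{(s, t, a s + c t, b t)}\<close> belongs to the pencil.\<close>

definition pencil_coeffs :: "'a \<Rightarrow> 'a \<Rightarrow> 'a set" where
  "pencil_coeffs a b = {c. b * cj c = - cj a * c}"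

lemma paramD:
  assumes "param a b"
  shows "a \<noteq> 0" "b \<noteq> 0" "a * cj a = b * cj b" "a * cj a \<noteq> 1" "b * cj b \<noteq> 1"
  using assms by (auto simp: param_def)

text \<open>In this form the regulus, apart from its horizontal K-line, is the solution set of an
  affine equation over F_q.\<close>

lemma reg_normal: "reg a b c (s, 1) \<longleftrightarrow> b * cj s - a * s = c"
proof -
  have "reg a b c (s, 1) \<longleftrightarrow> s * cj b = cj (a * s + c)"
    by (simp add: reg_def G_def)
  also have "\<dots> \<longleftrightarrow> cj (s * cj b) = a * s + c"
    by (metis cj_cj)
  also have "\<dots> \<longleftrightarrow> b * cj s - a * s = c"
    by (auto simp: cj_hom algebra_simps)
  finally show ?thesis .
qed

text \<open>The horizontal K-line is the line of the subgeometry on \<open>r_U1\<close>, common to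
  all the reguli.\<close>

lemma reg_horizontal: "snd p = 0 \<Longrightarrow> reg a b c p"
  by (simp add: reg_def G_def)

text \<open>Both sides scale by the norm \<open>k * cj k\<close>, so the condition depends on the
  K-line only.\<close>

lemma reg_sm:
  assumes "k \<noteq> 0"
  shows "reg a b c (sm k p) \<longleftrightarrow> reg a b c p"
proof -
  have "reg a b c (sm k p) \<longleftrightarrow>
      (k * cj k) * (fst p * snd (G a b c p)) = (k * cj k) * (snd p * fst (G a b c p))"
    by (simp only: reg_def G_sm sm_simps mult_ac)
  also have "\<dots> \<longleftrightarrow> reg a b c p"
    using assms by (simp add: reg_def)
  finally show ?thesis .
qed

text \<open>\<open>\<sigma>\<close> spans the kernel of the map taking x to b cj x - a x, and
  \<open>s\<close> solves the inhomogeneous equation. The kernel is non-zero because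
  \<open>a / b\<close> has norm 1; membership in \<open>pencil_coeffs a b\<close> is the solvability
  condition.\<close>

lemma opp_basis:
  assumes "param a b" "c \<in> pencil_coeffs a b"
  obtains \<sigma> s where "\<sigma> \<noteq> 0" "b * cj \<sigma> = a * \<sigma>" "b * cj s - a * s = c"
proof -
  note P = paramD[OF assms(1)]
  have u: "a / b * cj (a / b) = 1"
    unfolding cj_divide times_divide_times_eq P(3) using P(2) by simp
  obtain \<sigma> where \<sigma>: "\<sigma> \<noteq> 0" "cj \<sigma> = a / b * \<sigma>"
    using hilbert90[OF u] .
  have "b * cj c = - cj a * c"
    using assms(2) by (simp add: pencil_coeffs_def)
  then have "cj c = - cj a * c / b"
    using P(2) by (metis eq_divide_eq mult.commute)
  then have "cj (c / b) = - cj (a / b) * (c / b)"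
    unfolding cj_divide by simp
  then have "c / b \<in> range (\<lambda>x. cj x - a / b * x)"
    unfolding range_semilinear[OF u] by simp
  then obtain s where s: "c / b = cj s - a / b * s"
    by blast
  have "c = b * (c / b)"
    using P(2) by simp
  also have "\<dots> = b * cj s - a * s"
    unfolding s using P(2) by (simp add: right_diff_distrib)
  finally show ?thesis
    using that[of \<sigma> s] \<sigma> P(2) by simp
qed

text \<open>These are the solutions of \<open>cj x = - cj a / b * x\<close>, and the coefficient
  \<open>- cj a / b\<close> has norm 1.\<close>

lemma card_pencil_coeffs:
  assumes "param a b"
  shows "card (pencil_coeffs a b) = q"
proof -
  note P = paramD[OF assms]
  have "(- cj a / b) * cj (- cj a / b) = a * cj a / (b * cj b)"
    by (simp add: cj_divide cj_minus mult.commute)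
  also have "\<dots> = 1"
    unfolding P(3) using P(2) by simp
  finally have "card {x. cj x = - cj a / b * x} = q"
    by (rule card_semilinear_kernel)
  moreover have "cj x = - cj a / b * x \<longleftrightarrow> b * cj x = - cj a * x" for x
  proof -
    have "- cj a / b * x = - cj a * x / b"
      by simp
    then show ?thesis
      using P(2) by (metis eq_divide_eq mult.commute)
  qed
  ultimately show ?thesis
    by (simp add: pencil_coeffs_def)
qed

lemma mem_opp_line_iff: "x \<in> opp_line \<sigma> s r \<longleftrightarrow> (\<exists>i\<in>Fq. \<exists>j\<in>Fq. x = (r * (i * \<sigma> + j * s), r * j))"
  unfolding opp_line_def mem_lin_iff by (simp add: algebra_simps)

lemma opp_line_in_Lines:
  assumes "\<sigma> \<noteq> 0" "r \<noteq> 0"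
  shows "opp_line \<sigma> s r \<in> Lines"
  unfolding opp_line_def using assms
  by (intro lin_in_Lines) (auto simp: indep_def prod_eq_iff)

lemma opp_line_scale:
  assumes "k \<in> Fq" "k \<noteq> 0" "\<sigma> \<noteq> 0" "r \<noteq> 0"
  shows "opp_line \<sigma> s (k * r) = opp_line \<sigma> s r"
proof (rule Lines_eqI)
  show "opp_line \<sigma> s (k * r) \<subseteq> opp_line \<sigma> s r"
  proof
    fix x assume "x \<in> opp_line \<sigma> s (k * r)"
    then obtain i j where ij: "i \<in> Fq" "j \<in> Fq" "x = (k * r * (i * \<sigma> + j * s), k * r * j)"
      by (auto simp: mem_opp_line_iff)
    then show "x \<in> opp_line \<sigma> s r"
      unfolding mem_opp_line_iff using assms
      by (intro bexI[of _ "k * i"] bexI[of _ "k * j"]) (auto simp: algebra_simps Fq_mult)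
  qed
  show "card (opp_line \<sigma> s (k * r)) = q ^ 2"
    using opp_line_in_Lines[of \<sigma> "k * r"] assms by (auto simp: Lines_def)
qed (use opp_line_in_Lines assms in auto)

lemma opp_lineI: "i \<in> Fq \<Longrightarrow> j \<in> Fq \<Longrightarrow> w = (r * (i * \<sigma> + j * s), r * j) \<Longrightarrow> w \<in> opp_line \<sigma> s r"
  unfolding mem_opp_line_iff by blast

lemma reg_K_line_in_R_lines:
  assumes "param a b" "p \<noteq> 0" "reg a b c p"
  shows "K_line p \<in> R_lines a b c"
  unfolding R_lines_eq[OF paramD(4,5)[OF assms(1)]] using assms(2,3) by blast

lemma R_linesE:
  assumes "L \<in> R_lines a b c" "param a b"
  obtains p where "p \<noteq> 0" "reg a b c p" "L = K_line p"
  using assms(1) unfolding R_lines_eq[OF paramD(4,5)[OF assms(2)]] by blast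

context
  fixes a b c \<sigma> s :: 'a
  assumes par: "param a b" and \<sigma>: "\<sigma> \<noteq> 0" "b * cj \<sigma> = a * \<sigma>" and s: "b * cj s - a * s = c"
begin

private lemma reg_point:
  assumes "k \<in> Fq"
  shows "reg a b c (k * \<sigma> + s, 1)"
proof -
  have "cj k = k"
    using assms by (simp add: Fq_def)
  then have "b * cj (k * \<sigma> + s) - a * (k * \<sigma> + s) = k * (b * cj \<sigma> - a * \<sigma>) + (b * cj s - a * s)"
    by (simp add: cj_add cj_mult algebra_simps)
  then show ?thesis
    by (simp add: reg_normal \<sigma>(2) s)
qed

text \<open>Two solutions differ by an element of the kernel, and the ratio of two kernel elements
  is fixed by \<open>cj\<close>.\<close>

private lemma reg_point_cases:
  assumes "reg a b c (x, 1)"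
  obtains k where "k \<in> Fq" "x = k * \<sigma> + s"
proof
  have d: "b * cj (x - s) = a * (x - s)"
    using assms s by (simp add: reg_normal cj_diff algebra_simps)
  have "cj ((x - s) / \<sigma>) = (b * cj (x - s)) / (b * cj \<sigma>)"
    using paramD(2)[OF par] by (simp add: cj_divide)
  also have "\<dots> = (x - s) / \<sigma>"
    unfolding d \<sigma>(2) using paramD(1)[OF par] by simp
  finally show "(x - s) / \<sigma> \<in> Fq"
    by (simp add: Fq_def)
  show "x = (x - s) / \<sigma> * \<sigma> + s"
    using \<sigma>(1) by simp
qed

lemma opp_line_reg:
  assumes "w \<in> opp_line \<sigma> s r" "w \<noteq> 0" "r \<noteq> 0"
  shows "reg a b c w"
proof -
  obtain i j where ij: "i \<in> Fq" "j \<in> Fq" "w = (r * (i * \<sigma> + j * s), r * j)"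
    using assms(1) unfolding mem_opp_line_iff by blast
  show ?thesis
  proof (cases "j = 0")
    case True
    then show ?thesis
      using ij by (simp add: reg_horizontal)
  next
    case False
    have "r * (i * \<sigma> + j * s) = r * j * (i / j * \<sigma> + s)"
      using False by (simp add: distrib_left)
    then have w: "w = sm (r * j) (i / j * \<sigma> + s, 1)"
      by (simp only: ij(3) sm_simps mult_1_right)
    have "r * j \<noteq> 0"
      using False assms(3) by simp
    then show ?thesis
      unfolding w reg_sm[OF \<open>r * j \<noteq> 0\<close>] by (intro reg_point Fq_divide ij)
  qed
qed

text \<open>\<open>r\<close> is chosen so that \<open>w\<close> divided by \<open>r\<close> has
  coordinates in F_q with respect to (\<sigma>, 0) and (s, 1): it is the second coordinate of
  \<open>w\<close> or, if that is 0, the first one divided by \<open>\<sigma>\<close>.\<close>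

lemma opp_line_through:
  assumes "w \<noteq> 0" "reg a b c w"
  obtains r where "r \<noteq> 0" "w \<in> opp_line \<sigma> s r"
proof (cases "snd w = 0")
  case True
  then have "fst w / \<sigma> \<noteq> 0"
    using assms(1) \<sigma>(1) by (simp add: prod_eq_iff)
  moreover have "w \<in> opp_line \<sigma> s (fst w / \<sigma>)"
    using True \<sigma>(1) by (intro opp_lineI[of 1 0]) (simp_all add: prod_eq_iff)
  ultimately show ?thesis
    by (rule that)
next
  case False
  then have w: "w = sm (snd w) (fst w / snd w, 1)"
    by (simp add: prod_eq_iff)
  then have "reg a b c (fst w / snd w, 1)"
    using reg_sm[of "snd w" a b c "(fst w / snd w, 1)"] False assms(2) by simp
  then obtain k where k: "k \<in> Fq" "fst w / snd w = k * \<sigma> + s"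
    by (rule reg_point_cases)
  have "w \<in> opp_line \<sigma> s (snd w)"
  proof (rule opp_lineI[of k 1])
    show "w = (snd w * (k * \<sigma> + 1 * s), snd w * 1)"
      using w unfolding k(2) by simp
  qed (use k in simp_all)
  then show ?thesis
    using that False by blast
qed

text \<open>Comparing coordinates gives \<open>r * i = r' * i'\<close> and
  \<open>r * j = r' * j'\<close>. As \<open>i\<close> and \<open>j\<close> are not both 0,
  \<open>r\<close> and \<open>r'\<close> differ by a factor in F_q.\<close>

lemma opp_line_unique:
  assumes "w \<in> opp_line \<sigma> s r" "w \<in> opp_line \<sigma> s r'" "w \<noteq> 0" "r \<noteq> 0" "r' \<noteq> 0"
  shows "opp_line \<sigma> s r = opp_line \<sigma> s r'"
proof -
  obtain i j where ij: "i \<in> Fq" "j \<in> Fq" "w = (r * (i * \<sigma> + j * s), r * j)"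
    using assms(1) unfolding mem_opp_line_iff by blast
  obtain i' j' where ij': "i' \<in> Fq" "j' \<in> Fq" "w = (r' * (i' * \<sigma> + j' * s), r' * j')"
    using assms(2) unfolding mem_opp_line_iff by blast
  have eq: "r * (i * \<sigma> + j * s) = r' * (i' * \<sigma> + j' * s)" and 2: "r * j = r' * j'"
    using trans[OF sym[OF ij(3)] ij'(3)] by simp_all
  have "r * i * \<sigma> + r * j * s = r' * i' * \<sigma> + r' * j' * s"
    using eq by (simp add: distrib_left mult.assoc)
  then have 1: "r * i = r' * i'"
    unfolding 2 using \<sigma>(1) by simp
  have "j \<noteq> 0 \<or> i \<noteq> 0"
    using ij assms(3) by (auto simp: prod_eq_iff)
  then have "\<exists>k\<in>Fq. k \<noteq> 0 \<and> r' = k * r"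
  proof
    assume "j \<noteq> 0"
    moreover from this have "j' \<noteq> 0"
      using 2 assms(4) by auto
    ultimately show ?thesis
      using 2 ij(2) ij'(2) by (intro bexI[of _ "j / j'"]) (auto simp: Fq_divide field_simps)
  next
    assume "i \<noteq> 0"
    moreover from this have "i' \<noteq> 0"
      using 1 assms(4) by auto
    ultimately show ?thesis
      using 1 ij(1) ij'(1) by (intro bexI[of _ "i / i'"]) (auto simp: Fq_divide field_simps)
  qed
  then show ?thesis
    using opp_line_scale \<sigma>(1) assms(4) by metis
qed

text \<open>To recognise a line of the opposite regulus, three members of the regulus suffice:
  meeting the K-lines of (1, 0), (s, 1) and (\<sigma> + s, 1) already forces \<open>m\<close> to be
  an \<open>opp_line\<close>.\<close>

lemma opp_R_lines_eq: "opp (R_lines a b c) = {opp_line \<sigma> s r | r. r \<noteq> 0}"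
proof (intro set_eqI iffI)
  fix m
  {
    assume "m \<in> {opp_line \<sigma> s r | r. r \<noteq> 0}"
    then obtain r where r: "r \<noteq> 0" "m = opp_line \<sigma> s r"
      by blast
    have "\<exists>w. w \<noteq> 0 \<and> w \<in> m \<and> w \<in> K_line p" if p: "p \<noteq> 0" "reg a b c p" for p
    proof -
      obtain r' where r': "r' \<noteq> 0" "p \<in> opp_line \<sigma> s r'"
        using opp_line_through[OF p] .
      then obtain i j where ij: "i \<in> Fq" "j \<in> Fq" "p = (r' * (i * \<sigma> + j * s), r' * j)"
        unfolding mem_opp_line_iff by blast
      then have "sm (r / r') p = (r * (i * \<sigma> + j * s), r * j)"
        unfolding ij(3) using r'(1) by simp
      then have "sm (r / r') p \<in> m"
        unfolding r(2) by (rule opp_lineI[OF ij(1,2)])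
      moreover have "sm (r / r') p \<in> K_line p"
        by (rule K_line_closed(3)) simp
      ultimately show ?thesis
        using r(1) r'(1) p(1) by (intro exI[of _ "sm (r / r') p"]) simp
    qed
    then have "\<exists>w. w \<noteq> 0 \<and> w \<in> m \<and> w \<in> L" if "L \<in> R_lines a b c" for L
      using R_linesE[OF that par] by metis
    then show "m \<in> opp (R_lines a b c)"
      unfolding opp_def using opp_line_in_Lines[OF \<sigma>(1) r(1)] r(2) by simp
  }
  assume "m \<in> opp (R_lines a b c)"
  then have m: "m \<in> Lines" and "\<forall>r\<in>R_lines a b c. \<exists>w. w \<noteq> 0 \<and> w \<in> m \<and> w \<in> r"
    unfolding opp_def by blast+
  then have meets: "\<exists>k. k \<noteq> 0 \<and> sm k p \<in> m" if p: "p \<noteq> 0" "reg a b c p" for p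
  proof -
    obtain w where w: "w \<noteq> 0" "w \<in> m" "w \<in> K_line p"
      using \<open>\<forall>r\<in>R_lines a b c. _\<close> reg_K_line_in_R_lines[OF par p] by blast
    then obtain k where "w = sm k p"
      unfolding mem_K_line_iff by blast
    then show ?thesis
      using w by (intro exI[of _ k]) auto
  qed
  have nz: "(1, 0) \<noteq> (0 :: 'a \<times> 'a)" "(x, 1) \<noteq> (0 :: 'a \<times> 'a)" for x
    by (simp_all add: prod_eq_iff)
  obtain x where x: "x \<noteq> 0" "(x, 0) \<in> m"
    using meets[OF nz(1) reg_horizontal] by auto
  obtain \<mu> where \<mu>: "\<mu> \<noteq> 0" "(\<mu> * s, \<mu>) \<in> m"
    using meets[OF nz(2) reg_point[OF Fq_0]] by auto
  obtain \<nu> where \<nu>: "\<nu> \<noteq> 0" "(\<nu> * (\<sigma> + s), \<nu>) \<in> m"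
    using meets[OF nz(2) reg_point[OF Fq_1]] by auto
  have ind: "indep (x, 0) (\<mu> * s, \<mu>)" if "x \<noteq> 0" for x
    unfolding indep_def
  proof (intro ballI impI)
    fix i j assume eq: "sm i (x, 0) + sm j (\<mu> * s, \<mu>) = 0"
    have "j = 0"
      using arg_cong[OF eq, of snd] \<mu>(1) by simp
    moreover from this have "i = 0"
      using arg_cong[OF eq, of fst] that by simp
    ultimately show "i = 0 \<and> j = 0"
      by simp
  qed
  have "m = lin (x, 0) (\<mu> * s, \<mu>)"
    using Lines_eq_lin[OF m x(2) \<mu>(2) ind[OF x(1)]] .
  then have "(\<nu> * (\<sigma> + s), \<nu>) \<in> lin (x, 0) (\<mu> * s, \<mu>)"
    using \<nu>(2) by (rule subst)
  then obtain i j where ij: "i \<in> Fq" "j \<in> Fq" "(\<nu> * (\<sigma> + s), \<nu>) = sm i (x, 0) + sm j (\<mu> * s, \<mu>)"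
    unfolding mem_lin_iff by blast
  have \<nu>_eq: "\<nu> * (\<sigma> + s) = i * x + j * (\<mu> * s)" "\<nu> = j * \<mu>"
    using arg_cong[OF ij(3), of fst] arg_cong[OF ij(3), of snd] by simp_all
  have "j \<noteq> 0"
    using \<nu>(1) \<nu>_eq(2) by auto
  \<comment> \<open>Expressing the third point by the first two makes
    \<open>\<mu> * \<sigma>\<close> an F_q-multiple of \<open>x\<close>, which puts the required
    vector \<open>(\<mu> * \<sigma>, 0)\<close> into \<open>m\<close>.\<close>
  have "j * (\<mu> * \<sigma>) = i * x"
    using \<nu>_eq(1) unfolding \<nu>_eq(2) by (simp add: distrib_left mult.assoc)
  then have "\<mu> * \<sigma> = i / j * x"
    using \<open>j \<noteq> 0\<close> by (simp add: eq_divide_eq mult.commute)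
  then have "(\<mu> * \<sigma>, 0) = sm (i / j) (x, 0)"
    by simp
  then have "(\<mu> * \<sigma>, 0) \<in> m"
    using Lines_sm[OF m Fq_divide[OF ij(1,2)] x(2)] by simp
  then have "m = opp_line \<sigma> s \<mu>"
    unfolding opp_line_def by (rule Lines_eq_lin[OF m _ \<mu>(2) ind]) (use \<mu>(1) \<sigma>(1) in simp)
  then show "m \<in> {opp_line \<sigma> s r | r. r \<noteq> 0}"
    using \<mu>(1) by blast
qed

end

lemma opp_opp_line:
  assumes "param a b" "c \<in> pencil_coeffs a b" "m \<in> opp (R_lines a b c)"
  obtains \<sigma> s r where "\<sigma> \<noteq> 0" "b * cj \<sigma> = a * \<sigma>" "b * cj s - a * s = c" "r \<noteq> 0" "m = opp_line \<sigma> s r"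
proof -
  obtain \<sigma> s where \<sigma>: "\<sigma> \<noteq> 0" "b * cj \<sigma> = a * \<sigma>" "b * cj s - a * s = c"
    using opp_basis[OF assms(1,2)] .
  then show ?thesis
    using that assms(3) unfolding opp_R_lines_eq[OF assms(1) \<sigma>] by blast
qed

lemma opp_line_points:
  "(r * \<sigma>, 0) \<in> opp_line \<sigma> s r" "(r * s, r) \<in> opp_line \<sigma> s r" "(r * (\<sigma> + s), r) \<in> opp_line \<sigma> s r"
  using opp_lineI[of 1 0 _ r \<sigma> s] opp_lineI[of 0 1 _ r \<sigma> s] opp_lineI[of 1 1 _ r \<sigma> s] by simp_all

text \<open>A regulus and its opposite cover the same points, namely those satisfying
  \<open>reg\<close>. Through such a point there is exactly one \<open>opp_line\<close>; through any
  other point the line of \<open>S_lines\<close> is kept.\<close>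

lemma spread_switched:
  assumes "param a b" "c \<in> pencil_coeffs a b"
  shows "spread (switched a b c)"
  unfolding spread_def
proof (intro conjI allI impI)
  note P = paramD(4,5)[OF assms(1)]
  have S: "spread (S_lines a b c)"
    by (rule spread_S_lines[OF P])
  show "switched a b c \<subseteq> Lines"
    unfolding switched_def opp_def using spread_Lines[OF S] by blast
  fix w :: "'a \<times> 'a" assume w: "w \<noteq> 0"
  obtain \<sigma> s where \<sigma>: "\<sigma> \<noteq> 0" "b * cj \<sigma> = a * \<sigma>" "b * cj s - a * s = c"
    using opp_basis[OF assms] .
  note opp = opp_R_lines_eq[OF assms(1) \<sigma>]
  show "\<exists>!W. W \<in> switched a b c \<and> w \<in> W"
  proof (cases "reg a b c w")
    case True
    obtain r where r: "r \<noteq> 0" "w \<in> opp_line \<sigma> s r"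
      using opp_line_through[OF assms(1) \<sigma> w True] .
    have K_line: "K_line w \<in> R_lines a b c"
      by (rule reg_K_line_in_R_lines[OF assms(1) w True])
    show ?thesis
    proof (rule ex1I[of _ "opp_line \<sigma> s r"])
      show "opp_line \<sigma> s r \<in> switched a b c \<and> w \<in> opp_line \<sigma> s r"
        unfolding switched_def opp using r by blast
      fix W assume W: "W \<in> switched a b c \<and> w \<in> W"
      have "W \<notin> S_lines a b c - R_lines a b c"
        using spread_unique[OF S, of W "K_line w" w] W w K_line by (auto simp: R_lines_def)
      then obtain r' where "r' \<noteq> 0" "W = opp_line \<sigma> s r'"
        using W unfolding switched_def opp by blast
      then show "W = opp_line \<sigma> s r"
        using opp_line_unique[OF assms(1) \<sigma>] W r w by blast
    qed
  next
    case False
    obtain W where W: "W \<in> S_lines a b c" "w \<in> W"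
      using spread_ex1[OF S w] by blast
    have "W \<notin> R_lines a b c"
    proof
      assume "W \<in> R_lines a b c"
      then obtain p where p: "W = K_line p" "reg a b c p"
        using R_linesE[OF _ assms(1)] by metis
      have "w \<in> K_line p"
        using W(2) p(1) by simp
      then obtain k where k: "w = sm k p"
        unfolding mem_K_line_iff by blast
      then have "k \<noteq> 0"
        using w by auto
      then show False
        using False p(2) reg_sm k by simp
    qed
    show ?thesis
    proof (rule ex1I[of _ W])
      show "W \<in> switched a b c \<and> w \<in> W"
        unfolding switched_def using W \<open>W \<notin> R_lines a b c\<close> by blast
      fix W' assume W': "W' \<in> switched a b c \<and> w \<in> W'"
      then have "W' \<in> S_lines a b c"
        unfolding switched_def opp using opp_line_reg[OF assms(1) \<sigma> _ w] False by blast
      then show "W' = W"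
        using spread_unique[OF S _ W(1) _ W(2) w] W' by blast
    qed
  qed
qed

text \<open>A line of the opposite regulus contains (r \<sigma>, 0) and (r s, r), which are not on
  one K-line. The other lines of \<open>D_lines\<close> in the spread have been removed with the
  regulus.\<close>

lemma switched_Int_D_lines:
  assumes "param a b" "c \<in> pencil_coeffs a b"
  shows "switched a b c \<inter> D_lines = {}"
proof -
  have "m \<notin> D_lines" if m: "m \<in> opp (R_lines a b c)" for m
  proof
    assume "m \<in> D_lines"
    then obtain p where p: "m = K_line p"
      unfolding D_lines_def by blast
    obtain \<sigma> s r where "\<sigma> \<noteq> 0" "b * cj \<sigma> = a * \<sigma>" "b * cj s - a * s = c" "r \<noteq> 0" "m = opp_line \<sigma> s r"
      using opp_opp_line[OF assms m] .
    then have "(r * \<sigma>, 0) \<in> K_line p" "(r * s, r) \<in> K_line p" "r * \<sigma> \<noteq> 0" "r \<noteq> 0"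
      using opp_line_points p by auto
    then show False
      by (auto simp: mem_K_line_iff sm_def)
  qed
  then show ?thesis
    unfolding switched_def R_lines_def by blast
qed

text \<open>A line of an opposite regulus meets the horizontal K-line, which belongs to the regulus
  of the second spread. A line of that spread through the common point is the horizontal K-line
  itself.\<close>

lemma opp_Int_S_lines:
  assumes "param a b" "c \<in> pencil_coeffs a b" "param a' b'"
  shows "opp (R_lines a b c) \<inter> (S_lines a' b' c' - R_lines a' b' c') = {}"
proof (rule equals0I)
  fix m assume m: "m \<in> opp (R_lines a b c) \<inter> (S_lines a' b' c' - R_lines a' b' c')"
  then have "m \<in> opp (R_lines a b c)"
    by blast
  from opp_opp_line[OF assms(1,2) this] obtain \<sigma> s r where r: "\<sigma> \<noteq> 0" "r \<noteq> 0" "m = opp_line \<sigma> s r"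
    by metis
  have R: "K_line (r * \<sigma>, 0) \<in> R_lines a' b' c'"
    using r by (intro reg_K_line_in_R_lines[OF assms(3)]) (auto simp: reg_horizontal prod_eq_iff)
  have "m = K_line (r * \<sigma>, 0)"
  proof (rule spread_unique[OF spread_S_lines[OF paramD(4,5)[OF assms(3)]]])
    show "K_line (r * \<sigma>, 0) \<in> S_lines a' b' c'"
      using R unfolding R_lines_def by blast
    show "(r * \<sigma>, 0) \<in> m"
      unfolding r(3) by (rule opp_line_points)
  qed (use m r in \<open>auto simp: prod_eq_iff\<close>)
  then show False
    using m R by blast
qed

text \<open>The points of a common line over \<open>s\<close> and \<open>\<sigma> + s\<close>
  satisfy both affine equations; the difference gives the homogeneous equation for
  \<open>\<sigma>\<close>.\<close>

lemma opp_common_reg: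
  assumes "param a b" "c \<in> pencil_coeffs a b" "param a' b'" "c' \<in> pencil_coeffs a' b'"
    and "m \<in> opp (R_lines a b c)" "m \<in> opp (R_lines a' b' c')"
  obtains \<sigma> s where "\<sigma> \<noteq> 0" "b * cj \<sigma> = a * \<sigma>" "b * cj s - a * s = c"
    "b' * cj \<sigma> = a' * \<sigma>" "b' * cj s - a' * s = c'"
proof -
  obtain \<sigma> s r where r: "\<sigma> \<noteq> 0" "b * cj \<sigma> = a * \<sigma>" "b * cj s - a * s = c" "r \<noteq> 0" "m = opp_line \<sigma> s r"
    using opp_opp_line[OF assms(1,2,5)] .
  obtain \<sigma>' s' r' where r': "\<sigma>' \<noteq> 0" "b' * cj \<sigma>' = a' * \<sigma>'" "b' * cj s' - a' * s' = c'"
    "r' \<noteq> 0" "m = opp_line \<sigma>' s' r'"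
    using opp_opp_line[OF assms(3,4,6)] .
  have reg: "reg a' b' c' (x, 1)" if "(r * x, r) \<in> m" for x
  proof -
    have "reg a' b' c' (r * x, r)"
      using opp_line_reg[OF assms(3) r'(1-3) _ _ r'(4)] that r(4) unfolding r'(5)
      by (simp add: prod_eq_iff)
    then show ?thesis
      using reg_sm[OF r(4), of a' b' c' "(x, 1)"] by simp
  qed
  have 1: "b' * cj s - a' * s = c'"
    using reg[of s] opp_line_points(2) r(5) by (simp add: reg_normal)
  moreover have 2: "b' * cj (\<sigma> + s) - a' * (\<sigma> + s) = c'"
    using reg[of "\<sigma> + s"] opp_line_points(3) r(5) by (simp add: reg_normal)
  have "b' * cj \<sigma> - a' * \<sigma> = (b' * cj (\<sigma> + s) - a' * (\<sigma> + s)) - (b' * cj s - a' * s)"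
    by (simp add: cj_add algebra_simps)
  then have "b' * cj \<sigma> = a' * \<sigma>"
    unfolding 1 2 by simp
  with that r(1-3) 1 show ?thesis
    by blast
qed

lemma S_lines_minus_R_lines_cases:
  assumes "param a b" "L \<in> S_lines a b c - R_lines a b c"
  obtains s where "L = M a b c ` K_line (s, 1)" "\<not> reg a b c (s, 1)"
proof -
  note P = paramD(4,5)[OF assms(1)]
  obtain p where p: "p \<noteq> 0" "L = M a b c ` K_line p"
    using assms(2) unfolding S_lines_def by blast
  then have nr: "\<not> reg a b c p"
    using assms(2) M_K_line_in_R_lines_iff[OF P, of p c] by blast
  then have "snd p \<noteq> 0"
    using reg_horizontal by blast
  then have "p = sm (snd p) (fst p / snd p, 1)"
    by (simp add: prod_eq_iff)
  then show ?thesis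
    using that[of "fst p / snd p"] p nr K_line_eq_normal[OF \<open>snd p \<noteq> 0\<close>]
      reg_sm[OF \<open>snd p \<noteq> 0\<close>, of a b c "(fst p / snd p, 1)"] by metis
qed

section \<open>Common lines of two switched spreads\<close>

text \<open>Cramer's rule for the unknowns \<open>X\<close>, \<open>Y\<close> with coefficient rows
  (1, 1) and (\<omega>, w).\<close>

lemma conflict_scalar:
  fixes x y X Y :: 'a
  assumes "X + Y = \<mu> * x + m * y" "\<omega> * X + w * Y = \<nu> * x + n * y" "\<omega> - w \<noteq> 0"
  shows "X = (\<nu> - w * \<mu>) / (\<omega> - w) * x + (n - w * m) / (\<omega> - w) * y"
    and "Y = (\<omega> * \<mu> - \<nu>) / (\<omega> - w) * x + (\<omega> * m - n) / (\<omega> - w) * y"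
proof -
  have "(\<omega> - w) * X = (\<omega> * X + w * Y) - w * (X + Y)"
    by (simp add: algebra_simps)
  also have "\<dots> = (\<nu> - w * \<mu>) * x + (n - w * m) * y"
    unfolding assms(1,2) by (simp add: algebra_simps)
  finally show "X = (\<nu> - w * \<mu>) / (\<omega> - w) * x + (n - w * m) / (\<omega> - w) * y"
    using assms(3) by (simp add: eq_divide_eq mult.commute flip: add_divide_distrib)
  have "(\<omega> - w) * Y = \<omega> * (X + Y) - (\<omega> * X + w * Y)"
    by (simp add: algebra_simps)
  also have "\<dots> = (\<omega> * \<mu> - \<nu>) * x + (\<omega> * m - n) * y"
    unfolding assms(1,2) by (simp add: algebra_simps)
  finally show "Y = (\<omega> * \<mu> - \<nu>) / (\<omega> - w) * x + (\<omega> * m - n) / (\<omega> - w) * y"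
    using assms(3) by (simp add: eq_divide_eq mult.commute flip: add_divide_distrib)
qed

text \<open>The images of \<open>p'\<close> and of its multiple by some \<open>\<omega>\<close>
  outside F_q lie on the common line. The two resulting equations are solved for \<open>p'\<close>
  and \<open>g'\<close>.\<close>

lemma conflict_coeffs:
  assumes "M a b c ` K_line p = M a' b' c' ` K_line p'"
  obtains \<gamma> \<delta> where "p' = sm \<gamma> p + sm \<delta> (G a b c p)"
    "G a' b' c' p' = sm (cj \<delta>) p + sm (cj \<gamma>) (G a b c p)"
proof -
  define g where "g = G a b c p"
  define g' where "g' = G a' b' c' p'"
  have ex: "\<exists>\<mu>. sm l p' + sm (cj l) g' = sm \<mu> p + sm (cj \<mu>) g" for l
  proof -
    have "M a' b' c' (sm l p') \<in> M a b c ` K_line p"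
      unfolding assms by (rule imageI) (auto simp: mem_K_line_iff)
    then obtain x where x: "x \<in> K_line p" "M a' b' c' (sm l p') = M a b c x"
      by blast
    then obtain \<mu> where \<mu>: "x = sm \<mu> p"
      unfolding mem_K_line_iff by blast
    show ?thesis
      using x(2) unfolding \<mu> M_sm g_def g'_def by (rule exI)
  qed
  obtain \<omega> where "\<omega> \<notin> Fq"
    by (rule ex_not_Fq)
  then have d: "\<omega> - cj \<omega> \<noteq> 0"
    by (auto simp: Fq_def)
  obtain \<mu> where \<mu>: "p' + g' = sm \<mu> p + sm (cj \<mu>) g"
    using ex[of 1] by auto
  obtain \<nu> where \<nu>: "sm \<omega> p' + sm (cj \<omega>) g' = sm \<nu> p + sm (cj \<nu>) g"
    using ex[of \<omega>] by auto
  define \<gamma> where "\<gamma> = (\<nu> - cj \<omega> * \<mu>) / (\<omega> - cj \<omega>)"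
  define \<delta> where "\<delta> = (cj \<nu> - cj \<omega> * cj \<mu>) / (\<omega> - cj \<omega>)"
  \<comment> \<open>Conjugation exchanges \<open>\<omega>\<close> and \<open>cj \<omega>\<close>,
    which changes the sign of the denominator. So the coefficients of \<open>g'\<close> are the
    conjugates of those of \<open>p'\<close> in swapped order.\<close>
  have cj: "cj \<gamma> = (\<omega> * cj \<mu> - cj \<nu>) / (\<omega> - cj \<omega>)" "cj \<delta> = (\<omega> * \<mu> - \<nu>) / (\<omega> - cj \<omega>)"
    unfolding \<gamma>_def \<delta>_def cj_hom cj_cj
    by (metis minus_diff_eq minus_divide_divide)+
  note 1 = conflict_scalar[OF arg_cong[OF \<mu>, of fst, simplified] arg_cong[OF \<nu>, of fst, simplified] d]
  note 2 = conflict_scalar[OF arg_cong[OF \<mu>, of snd, simplified] arg_cong[OF \<nu>, of snd, simplified] d]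
  have "p' = sm \<gamma> p + sm \<delta> g" "g' = sm (cj \<delta>) p + sm (cj \<gamma>) g"
    unfolding cj prod_eq_iff using 1 2 by (simp_all add: \<gamma>_def \<delta>_def)
  then show ?thesis
    using that unfolding g_def g'_def by blast
qed

text \<open>Converse of \<open>conflict_coeffs\<close>: the vector \<open>sm l p'\<close> has the
  same image as the multiple of \<open>p\<close> by
  \<open>l * \<gamma> + cj l * cj \<delta>\<close>.\<close>

lemma M_K_line_eqI:
  assumes "param a b" "param a' b'" "p \<noteq> 0" "p' \<noteq> 0"
    and "p' = sm \<gamma> p + sm \<delta> (G a b c p)"
    and "G a' b' c' p' = sm (cj \<delta>) p + sm (cj \<gamma>) (G a b c p)"
  shows "M a' b' c' ` K_line p' = M a b c ` K_line p"
proof (rule Lines_eqI)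
  show "card (M a' b' c' ` K_line p') = q ^ 2"
    using M_K_line_in_Lines[OF paramD(4,5)[OF assms(2)] assms(4)] by (simp add: Lines_def)
  show "M a b c ` K_line p \<in> Lines"
    by (rule M_K_line_in_Lines[OF paramD(4,5)[OF assms(1)] assms(3)])
  have "M a' b' c' (sm l p') = M a b c (sm (l * \<gamma> + cj l * cj \<delta>) p)" for l
    unfolding M_sm assms(6) cj_add cj_mult cj_cj
    by (subst assms(5)) (simp add: prod_eq_iff algebra_simps)
  then show "M a' b' c' ` K_line p' \<subseteq> M a b c ` K_line p"
    unfolding K_line_def by blast
qed

text \<open>Necessary and sufficient for the image of the \<open>K\<close>-line of \<open>(s, 1)\<close> under \<open>M a b c\<close> to be a member of
  the spread with parameters \<open>a'\<close>, \<open>b'\<close>, \<open>c'\<close>; obtained by eliminating \<open>\<gamma>\<close> and \<open>\<delta>\<close> from the equations in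
  \<open>conflict_coeffs\<close>.\<close>

definition meet_eq :: "'a \<Rightarrow> 'a \<Rightarrow> 'a \<Rightarrow> 'a \<Rightarrow> 'a \<Rightarrow> 'a \<Rightarrow> 'a \<Rightarrow> bool" where
  "meet_eq a b c a' b' c' s \<longleftrightarrow>
     (1 - b' * cj b) * ((a' - a) * s + (c' - c)) =
     (b' - b) * ((1 - a' * cj a) * cj s - a' * cj c - c' * cj b)"

text \<open>The relations of \<open>conflict_coeffs\<close> become two homogeneous linear equations
  \<open>A\<close> and \<open>B\<close> in \<gamma> and \<delta>. These are not both 0 since
  \<open>p'\<close> is not, so the determinant vanishes, and this is \<open>meet_eq\<close>.\<close>

lemma meet_eq_necessary:
  assumes "M a b c ` K_line (s, 1) = M a' b' c' ` K_line p'" "p' \<noteq> 0"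
  shows "meet_eq a b c a' b' c' s"
proof -
  obtain \<gamma> \<delta> where 1: "p' = sm \<gamma> (s, 1) + sm \<delta> (G a b c (s, 1))"
    and 2: "G a' b' c' p' = sm (cj \<delta>) (s, 1) + sm (cj \<gamma>) (G a b c (s, 1))"
    using conflict_coeffs[OF assms(1)] .
  have x: "fst p' = \<gamma> * s + \<delta> * (cj a * cj s + cj c)" and y: "snd p' = \<gamma> + \<delta> * cj b"
    unfolding 1 by (simp_all add: G_def cj_hom)
  have "cj (a' * fst p' + c' * snd p') = cj \<delta> * s + cj \<gamma> * (cj a * cj s + cj c)"
    and "cj (b' * snd p') = cj \<delta> + cj \<gamma> * cj b"
    using arg_cong[OF 2, of fst] arg_cong[OF 2, of snd] by (simp_all add: G_def cj_hom)
  then have "a' * fst p' + c' * snd p' = cj (cj \<delta> * s + cj \<gamma> * (cj a * cj s + cj c))"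
    and "b' * snd p' = cj (cj \<delta> + cj \<gamma> * cj b)"
    by (metis cj_cj)+
  then have A: "a' * (\<gamma> * s + \<delta> * (cj a * cj s + cj c)) + c' * (\<gamma> + \<delta> * cj b) = \<delta> * cj s + \<gamma> * (a * s + c)"
    and B: "b' * (\<gamma> + \<delta> * cj b) = \<delta> + \<gamma> * b"
    by (simp_all add: cj_hom x y)
  define X where "X = (a' - a) * s + (c' - c)"
  define Y where "Y = (1 - a' * cj a) * cj s - a' * cj c - c' * cj b"
  have A: "\<gamma> * X = \<delta> * Y"
    using A unfolding X_def Y_def by (simp add: algebra_simps)
  have B: "\<gamma> * (b' - b) = \<delta> * (1 - b' * cj b)"
    using B by (simp add: algebra_simps)
  have "\<gamma> \<noteq> 0 \<or> \<delta> \<noteq> 0"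
  proof (rule ccontr)
    assume "\<not> (\<gamma> \<noteq> 0 \<or> \<delta> \<noteq> 0)"
    then have "p' = 0"
      unfolding 1 by (simp add: zero_prod_def)
    then show False
      using assms(2) by simp
  qed
  moreover have "\<gamma> * ((1 - b' * cj b) * X) = \<gamma> * ((b' - b) * Y)"
  proof -
    have "\<gamma> * ((1 - b' * cj b) * X) = (1 - b' * cj b) * (\<gamma> * X)"
      by (simp add: mult_ac)
    also have "\<dots> = (\<delta> * (1 - b' * cj b)) * Y"
      unfolding A by (simp add: mult_ac)
    also have "\<dots> = \<gamma> * ((b' - b) * Y)"
      unfolding B[symmetric] by (simp add: mult_ac)
    finally show ?thesis .
  qed
  moreover have "\<delta> * ((1 - b' * cj b) * X) = \<delta> * ((b' - b) * Y)"
  proof -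
    have "\<delta> * ((1 - b' * cj b) * X) = (\<delta> * (1 - b' * cj b)) * X"
      by (simp add: mult_ac)
    also have "\<dots> = (b' - b) * (\<gamma> * X)"
      unfolding B[symmetric] by (simp add: mult_ac)
    also have "\<dots> = \<delta> * ((b' - b) * Y)"
      unfolding A by (simp add: mult_ac)
    finally show ?thesis .
  qed
  ultimately show ?thesis
    unfolding meet_eq_def X_def[symmetric] Y_def[symmetric] by (elim disjE) simp_all
qed

lemma meet_eq_sufficient:
  assumes par: "param a b" "param a' b'" and eq: "meet_eq a b c a' b' c' s"
  obtains p' where "p' \<noteq> 0" "M a' b' c' ` K_line p' = M a b c ` K_line (s, 1)"
proof -
  \<comment> \<open>This choice satisfies the equation for the second coordinates identically, and
    \<open>meet_eq\<close> becomes the one for the first coordinates. The second coordinate of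
    \<open>p'\<close> is \<open>1 - b * cj b\<close>, hence not 0.\<close>
  define \<gamma> where "\<gamma> = 1 - b' * cj b"
  define \<delta> where "\<delta> = b' - b"
  define p' where "p' = sm \<gamma> (s, 1) + sm \<delta> (G a b c (s, 1))"
  have x: "fst p' = \<gamma> * s + \<delta> * (cj a * cj s + cj c)" and y: "snd p' = \<gamma> + \<delta> * cj b"
    unfolding p'_def by (simp_all add: G_def cj_hom)
  have y': "snd p' = 1 - b * cj b"
    unfolding y \<gamma>_def \<delta>_def by (simp add: algebra_simps)
  then have "p' \<noteq> 0"
    using paramD(5)[OF par(1)] by auto
  have "b' * snd p' = \<delta> + \<gamma> * b"
    unfolding y' \<gamma>_def \<delta>_def by (simp add: algebra_simps)
  moreover have "a' * fst p' + c' * snd p' = \<delta> * cj s + \<gamma> * (a * s + c)"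
    using eq unfolding x y meet_eq_def \<gamma>_def[symmetric] \<delta>_def[symmetric]
    by (simp add: algebra_simps)
  ultimately have "G a' b' c' p' = (cj (\<delta> * cj s + \<gamma> * (a * s + c)), cj (\<delta> + \<gamma> * b))"
    by (simp add: G_def)
  also have "\<dots> = sm (cj \<delta>) (s, 1) + sm (cj \<gamma>) (G a b c (s, 1))"
    by (simp add: G_def cj_hom)
  finally have "M a' b' c' ` K_line p' = M a b c ` K_line (s, 1)"
    by (intro M_K_line_eqI[OF par _ \<open>p' \<noteq> 0\<close> p'_def]) (simp_all add: prod_eq_iff)
  then show ?thesis
    using that \<open>p' \<noteq> 0\<close> by blast
qed

text \<open>\<open>A\<close>, \<open>B\<close>, \<open>A'\<close>, \<open>B'\<close> stand for the
  conjugates and are treated as independent variables, subject only to the norm equations.\<close>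

lemma norm_identity:
  fixes n n' :: 'a
  assumes "a * A = n" "b * B = n" "a' * A' = n'" "b' * B' = n'"
  shows "((1 - b' * B) * (a' - a)) * ((1 - B' * b) * (A' - A)) -
    ((b' - b) * (1 - a' * A)) * ((B' - B) * (1 - A' * a)) =
    (1 - n) * (1 - n') * ((b' * B + B' * b) - (a' * A + A' * a))"
proof -
  have "(1 - b' * B) * (1 - B' * b) = 1 - (b' * B + B' * b) + (b' * B') * (b * B)"
    "(a' - a) * (A' - A) = a' * A' - (a' * A + A' * a) + a * A"
    "(b' - b) * (B' - B) = b' * B' - (b' * B + B' * b) + b * B"
    "(1 - a' * A) * (1 - A' * a) = 1 - (a' * A + A' * a) + (a' * A') * (a * A)"
    by (simp_all add: algebra_simps)
  note * = this[unfolded assms]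
  have "((1 - b' * B) * (a' - a)) * ((1 - B' * b) * (A' - A)) -
    ((b' - b) * (1 - a' * A)) * ((B' - B) * (1 - A' * a)) =
    ((1 - b' * B) * (1 - B' * b)) * ((a' - a) * (A' - A)) -
    ((b' - b) * (B' - B)) * ((1 - a' * A) * (1 - A' * a))"
    by (simp only: mult_ac)
  also have "\<dots> = (1 - n) * (1 - n') * ((b' * B + B' * b) - (a' * A + A' * a))"
    unfolding * by (simp add: algebra_simps)
  finally show ?thesis .
qed

text \<open>\<open>a' * cj a\<close> and \<open>b' * cj b\<close> have the same norm. If their
  traces agree too, they are roots of one quadratic, hence equal or conjugate; multiplication by
  \<open>a * b\<close> or \<open>a * cj b\<close> turns this into the two alternatives.\<close>

lemma norms_eq_iff:
  assumes par: "param a b" "param a' b'"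
  defines "E \<equiv> (1 - b' * cj b) * (a' - a)" and "F \<equiv> (b' - b) * (1 - a' * cj a)"
  shows "E * cj E = F * cj F \<longleftrightarrow> a * b' = b * a' \<or> a * cj b' = cj b * a'"
proof -
  note P = paramD[OF par(1)] and P' = paramD[OF par(2)]
  define n where "n = a * cj a"
  define n' where "n' = a' * cj a'"
  have n: "a * cj a = n" "b * cj b = n" "a' * cj a' = n'" "b' * cj b' = n'"
    using P(3) P'(3) by (simp_all add: n_def n'_def)
  have "E * cj E - F * cj F = (1 - n) * (1 - n') * ((b' * cj b + cj b' * b) - (a' * cj a + cj a' * a))"
    using norm_identity[OF n] by (simp add: E_def F_def cj_hom)
  then have "E * cj E = F * cj F \<longleftrightarrow> b' * cj b + cj b' * b = a' * cj a + cj a' * a"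
    using P(4) P'(4) n by auto
  also have "\<dots> \<longleftrightarrow> (a' * cj a - b' * cj b) * (a' * cj a - cj b' * b) = 0"
  proof -
    have "(b' * cj b) * (cj b' * b) = (b' * cj b') * (b * cj b)"
      by (simp only: mult_ac)
    also have "\<dots> = (a' * cj a') * (a * cj a)"
      unfolding n ..
    also have "\<dots> = (a' * cj a) * (cj a' * a)"
      by (simp only: mult_ac)
    finally have "(a' * cj a - b' * cj b) * (a' * cj a - cj b' * b) =
        a' * cj a * (a' * cj a + cj a' * a - (b' * cj b + cj b' * b))"
      by algebra
    then show ?thesis
      using P(1) P'(1) by auto
  qed
  also have "\<dots> \<longleftrightarrow> a * b' = b * a' \<or> a * cj b' = cj b * a'"
  proof -
    have "a * b * (a' * cj a - b' * cj b) = (a * cj a) * (b * a') - (b * cj b) * (a * b')"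
      by (simp add: algebra_simps)
    also have "\<dots> = n * (b * a' - a * b')"
      unfolding n by (simp add: right_diff_distrib)
    finally have "a * b * (a' * cj a - b' * cj b) = n * (b * a' - a * b')" .
    moreover have "a * cj b * (a' * cj a - cj b' * b) =
        (a * cj a) * (cj b * a') - (b * cj b) * (a * cj b')"
      by (simp add: algebra_simps)
    then have "a * cj b * (a' * cj a - cj b' * b) = n * (cj b * a' - a * cj b')"
      unfolding n by (simp add: right_diff_distrib)
    moreover have "n \<noteq> 0"
      using P(1) by (simp add: n_def)
    ultimately show ?thesis
      using P(1,2) by (metis cj_eq_0_iff mult_eq_0_iff right_minus_eq)
  qed
  finally show ?thesis .
qed

text \<open>Cramer's rule for the two equations, taken as a linear system in \<open>cj s\<close> and
  \<open>s\<close>. What has to be checked is that the two values found are conjugate.\<close>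

lemma common_regulus_point:
  assumes par: "param a b" "param a' b'" and c: "c \<in> pencil_coeffs a b" "c' \<in> pencil_coeffs a' b'"
    and ne: "a * b' \<noteq> b * a'"
  obtains s where "b * cj s - a * s = c" "b' * cj s - a' * s = c'"
proof -
  note P = paramD[OF par(1)] and P' = paramD[OF par(2)]
  define d where "d = b * a' - a * b'"
  define s where "s = (c * b' - c' * b) / d"
  have d: "d \<noteq> 0"
    using ne by (simp add: d_def)
  have C: "b * cj c = - cj a * c" "b' * cj c' = - cj a' * c'"
    using c by (simp_all add: pencil_coeffs_def)
  have "cj d * (c * a' - c' * a) = d * cj (c * b' - c' * b)"
  proof -
    \<comment> \<open>The extra factor lets the norm equations and the conditions on
      \<open>c\<close> and \<open>c'\<close> enter as polynomial relations; it is cancelled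
      afterwards.\<close>
    have "(a * b * a' * b') * (cj d * (c * a' - c' * a)) = (a * b * a' * b') * (d * cj (c * b' - c' * b))"
      unfolding d_def cj_diff cj_mult using C P(3) P'(3) by algebra
    then show ?thesis
      using P(1,2) P'(1,2) by simp
  qed
  then have cs: "cj s = (c * a' - c' * a) / d"
    using d by (simp add: s_def cj_divide frac_eq_eq mult.commute)
  have "b * cj s - a * s = (b * (c * a' - c' * a) - a * (c * b' - c' * b)) / d"
    unfolding cs unfolding s_def by (simp only: times_divide_eq_right flip: diff_divide_distrib)
  also have "b * (c * a' - c' * a) - a * (c * b' - c' * b) = c * d"
    by (simp add: d_def algebra_simps)
  finally have 1: "b * cj s - a * s = c"
    using d by simp
  have "b' * cj s - a' * s = (b' * (c * a' - c' * a) - a' * (c * b' - c' * b)) / d"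
    unfolding cs unfolding s_def by (simp only: times_divide_eq_right flip: diff_divide_distrib)
  also have "b' * (c * a' - c' * a) - a' * (c * b' - c' * b) = c' * d"
    by (simp add: d_def algebra_simps)
  finally have "b' * cj s - a' * s = c'"
    using d by simp
  with 1 show ?thesis
    by (rule that)
qed

text \<open>Behind this: \<open>reg\<close> holds at (s, 1) for both parameter triples, so both maps
  \<open>M\<close> send its K-line into itself.\<close>

lemma meet_eq_common_regulus_point:
  assumes "param a b" "b * cj s - a * s = c" "b' * cj s - a' * s = c'"
  shows "meet_eq a b c a' b' c' s"
proof -
  have "a * cj a = b * cj b"
    using paramD[OF assms(1)] by blast
  moreover have "cj c = cj b * s - cj a * cj s"
    unfolding assms(2)[symmetric] by (simp add: cj_hom)
  ultimately show ?thesis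
    unfolding meet_eq_def using assms(2,3) by algebra
qed

text \<open>Of the four intersections between the parts of the two switched spreads, the mixed ones
  are empty by \<open>opp_Int_S_lines\<close>. The others are covered by \<open>opp\<close> and,
  through \<open>meet_eq_necessary\<close>, by \<open>meet\<close>.\<close>

lemma switched_disjointI:
  assumes "param a b" "c \<in> pencil_coeffs a b" "param a' b'" "c' \<in> pencil_coeffs a' b'"
    and opp: "opp (R_lines a b c) \<inter> opp (R_lines a' b' c') = {}"
    and meet: "\<And>s. meet_eq a b c a' b' c' s \<Longrightarrow> reg a b c (s, 1)"
  shows "switched a b c \<inter> switched a' b' c' = {}"
proof -
  have "(S_lines a b c - R_lines a b c) \<inter> (S_lines a' b' c' - R_lines a' b' c') = {}"
  proof (rule equals0I)
    fix L assume L: "L \<in> (S_lines a b c - R_lines a b c) \<inter> (S_lines a' b' c' - R_lines a' b' c')"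
    then obtain s where s: "L = M a b c ` K_line (s, 1)" "\<not> reg a b c (s, 1)"
      using S_lines_minus_R_lines_cases[OF assms(1)] by (metis IntD1)
    obtain p' where "p' \<noteq> 0" "L = M a' b' c' ` K_line p'"
      using L unfolding S_lines_def by blast
    then show False
      using meet_eq_necessary meet s by metis
  qed
  moreover have "opp (R_lines a b c) \<inter> (S_lines a' b' c' - R_lines a' b' c') = {}"
    by (rule opp_Int_S_lines[OF assms(1-3)])
  moreover have "opp (R_lines a' b' c') \<inter> (S_lines a b c - R_lines a b c) = {}"
    by (rule opp_Int_S_lines[OF assms(3,4,1)])
  ultimately show ?thesis
    unfolding switched_def using opp by blast
qed

text \<open>With equal \<open>a\<close> and \<open>b\<close>, \<open>meet_eq\<close> shrinks to
  \<open>(1 - b * cj b) * (c' - c) = 0\<close>, which is impossible; and a common line of the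
  opposite reguli would give \<open>c = c'\<close>.\<close>

lemma switched_disjoint_same_pair:
  assumes "param a b" "c \<in> pencil_coeffs a b" "c' \<in> pencil_coeffs a b" "c \<noteq> c'"
  shows "switched a b c \<inter> switched a b c' = {}"
proof (rule switched_disjointI[OF assms(1,2) assms(1,3)])
  show "opp (R_lines a b c) \<inter> opp (R_lines a b c') = {}"
    using opp_common_reg[OF assms(1,2,1,3)] assms(4) by (metis disjoint_iff)
  have "1 - b * cj b \<noteq> 0"
    using paramD(5)[OF assms(1)] by simp
  then show "reg a b c (s, 1)" if "meet_eq a b c a b c' s" for s
    using that assms(4) by (simp add: meet_eq_def)
qed

text \<open>A solution \<open>s\<close> of \<open>meet_eq\<close> differs from the common regulus
  point \<open>t\<close> by a solution x of E x = F cj x. Only x = 0 is possible when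
  \<open>E\<close> and \<open>F\<close> have different norms.\<close>

lemma switched_disjoint_good:
  assumes par: "param a b" "param a' b'" and c: "c \<in> pencil_coeffs a b" "c' \<in> pencil_coeffs a' b'"
    and good: "a * b' \<noteq> b * a'" "a * cj b' \<noteq> cj b * a'"
  shows "switched a b c \<inter> switched a' b' c' = {}"
proof (rule switched_disjointI[OF par(1) c(1) par(2) c(2)])
  show "opp (R_lines a b c) \<inter> opp (R_lines a' b' c') = {}"
  proof (rule equals0I)
    fix m assume m: "m \<in> opp (R_lines a b c) \<inter> opp (R_lines a' b' c')"
    obtain \<sigma> where \<sigma>: "\<sigma> \<noteq> 0" "b * cj \<sigma> = a * \<sigma>" "b' * cj \<sigma> = a' * \<sigma>"
      using opp_common_reg[OF par(1) c(1) par(2) c(2)] m by (metis IntD1 IntD2)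
    have "(a * b' - b * a') * \<sigma> = 0"
      using \<sigma>(2,3) by algebra
    then show False
      using good(1) \<sigma>(1) by simp
  qed
  fix s assume s: "meet_eq a b c a' b' c' s"
  obtain t where t: "b * cj t - a * t = c" "b' * cj t - a' * t = c'"
    using common_regulus_point[OF par c good(1)] .
  define E where "E = (1 - b' * cj b) * (a' - a)"
  define F where "F = (b' - b) * (1 - a' * cj a)"
  have "meet_eq a b c a' b' c' t"
    by (rule meet_eq_common_regulus_point[OF par(1) t])
  then have EF: "E * (s - t) = F * cj (s - t)"
    using s unfolding meet_eq_def E_def F_def cj_diff by algebra
  have "cj E * cj (s - t) = cj F * (s - t)"
    using arg_cong[OF EF, of cj] by (simp add: cj_mult)
  then have "(E * cj E - F * cj F) * (s - t) = 0"
    using EF by algebra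
  moreover have "E * cj E \<noteq> F * cj F"
    using norms_eq_iff[OF par] good unfolding E_def F_def by simp
  ultimately have "s = t"
    by simp
  then show "reg a b c (s, 1)"
    using t by (simp add: reg_normal)
qed

lemma zero_in_pencil_coeffs [simp]: "0 \<in> pencil_coeffs a b"
  by (simp add: pencil_coeffs_def)

text \<open>The lines with c = 0 of the two pencils already conflict. If
  \<open>a * b' = b * a'\<close>, the kernels agree and with them the opposite reguli; otherwise
  \<open>E\<close> and \<open>F\<close> have the same norm, and \<open>hilbert90\<close> yields a
  non-zero solution of E s = F cj s.\<close>

lemma switched_conflict:
  assumes par: "param a b" "param a' b'"
    and bad: "a * b' = b * a' \<or> a * cj b' = cj b * a'"
  shows "switched a b 0 \<inter> switched a' b' 0 \<noteq> {}"
proof (cases "a * b' = b * a'")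
  case True
  note P = paramD[OF par(1)]
  obtain \<sigma> s where \<sigma>: "\<sigma> \<noteq> 0" "b * cj \<sigma> = a * \<sigma>"
    using opp_basis[OF par(1) zero_in_pencil_coeffs] .
  have "b * (b' * cj \<sigma>) = b * (a' * \<sigma>)"
    using \<sigma>(2) True by algebra
  then have \<sigma>': "b' * cj \<sigma> = a' * \<sigma>"
    using P(2) by simp
  have "opp_line \<sigma> 0 1 \<in> opp (R_lines a b 0)"
    using opp_R_lines_eq[OF par(1) \<sigma>, of 0 0] by auto
  moreover have "opp_line \<sigma> 0 1 \<in> opp (R_lines a' b' 0)"
    using opp_R_lines_eq[OF par(2) \<sigma>(1) \<sigma>', of 0 0] by auto
  ultimately show ?thesis
    unfolding switched_def by blast
next
  case False
  note P = paramD[OF par(1)]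
  define E where "E = (1 - b' * cj b) * (a' - a)"
  define F where "F = (b' - b) * (1 - a' * cj a)"
  have EF: "E * cj E = F * cj F"
    using norms_eq_iff[OF par] bad unfolding E_def F_def by simp
  \<comment> \<open>This keeps the solution found below outside the regulus, where the common line
    would be switched away.\<close>
  have ne: "E * b \<noteq> F * a"
  proof
    assume "E * b = F * a"
    then have "(1 - a * cj a) * (a * b' - b * a') = 0"
      unfolding E_def F_def using P(3) by algebra
    then show False
      using P(4) False by simp
  qed
  have "F \<noteq> 0"
    using ne EF by auto
  have "E / F * cj (E / F) = 1"
    using EF \<open>F \<noteq> 0\<close> by (simp add: cj_divide)
  then obtain s where s: "s \<noteq> 0" "cj s = E / F * s"
    by (rule hilbert90)
  have Fs: "F * cj s = E * s"
    unfolding s(2) using \<open>F \<noteq> 0\<close> by simp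
  have "meet_eq a b 0 a' b' 0 s"
    using Fs by (simp add: meet_eq_def E_def F_def mult.assoc)
  then obtain p' where p': "p' \<noteq> 0" "M a' b' 0 ` K_line p' = M a b 0 ` K_line (s, 1)"
    using meet_eq_sufficient[OF par] by blast
  have nr: "\<not> reg a b 0 (s, 1)"
  proof
    assume "reg a b 0 (s, 1)"
    then have "b * cj s = a * s"
      by (simp add: reg_normal)
    then have "(E * b - F * a) * s = 0"
      using Fs by algebra
    then show False
      using ne s(1) by simp
  qed
  have nz: "(s, 1) \<noteq> (0 :: 'a \<times> 'a)"
    by (simp add: prod_eq_iff)
  have "M a b 0 ` K_line (s, 1) \<notin> R_lines a b 0"
    using M_K_line_in_R_lines_iff[OF P(4,5) nz] nr by blast
  moreover have S: "M a b 0 ` K_line (s, 1) \<in> S_lines a b 0"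
    unfolding S_lines_def using nz by blast
  moreover have S': "M a b 0 ` K_line (s, 1) \<in> S_lines a' b' 0"
    unfolding S_lines_def using p' by blast
  ultimately have "M a b 0 ` K_line (s, 1) \<in> switched a b 0" "M a b 0 ` K_line (s, 1) \<in> switched a' b' 0"
    unfolding switched_def R_lines_def by blast+
  then show ?thesis
    by blast
qed

end

section \<open>Coordinates of points and lines\<close>

lemma mem_pt_iff: "y \<in> pt x \<longleftrightarrow> (\<exists>k. y = k *s x)"
  unfolding pt_def vec.span_singleton by auto

lemma pt_scale:
  assumes "k \<noteq> 0"
  shows "pt (k *s x) = pt x"
proof (intro set_eqI)
  fix y
  have "y = l *s x \<longleftrightarrow> y = (l / k) *s (k *s x)" for l
    using assms by simp
  then show "y \<in> pt (k *s x) \<longleftrightarrow> y \<in> pt x"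
    unfolding mem_pt_iff by (metis vec.scale_scale)
qed

lemma pt_eqD: "pt x = pt y \<Longrightarrow> \<exists>k. y = k *s x"
  by (metis mem_pt_iff vec.scale_one)

lemma pt_eq_iff:
  assumes "y \<noteq> 0"
  shows "pt x = pt y \<longleftrightarrow> (\<exists>k. k \<noteq> 0 \<and> y = k *s x)"
  using pt_eqD pt_scale assms by (metis vec.scale_zero_left)

lemma pt_in_pg_points: "x \<noteq> 0 \<Longrightarrow> pt x \<in> pg_points"
  unfolding pg_points_def by blast

definition comb :: "'a::field ^ 4 \<Rightarrow> 'a ^ 4 \<Rightarrow> 'a ppoint set" where
  "comb x y = {pt (i *s x + j *s y) | i j. i *s x + j *s y \<noteq> 0}"

lemma join_eq_comb: "join (pt x) (pt y) = comb x y"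
proof -
  have span: "vec.span (pt x \<union> pt y) = {v. \<exists>i j. v = i *s x + j *s y}"
    unfolding vec.span_Un pt_def vec.span_span unfolding vec.span_singleton by blast
  have "pt v \<subseteq> {v. \<exists>i j. v = i *s x + j *s y} \<longleftrightarrow> (\<exists>i j. v = i *s x + j *s y)" for v
  proof
    assume "pt v \<subseteq> {v. \<exists>i j. v = i *s x + j *s y}"
    moreover have "v \<in> pt v"
      unfolding mem_pt_iff by (metis vec.scale_one)
    ultimately show "\<exists>i j. v = i *s x + j *s y"
      by blast
  next
    assume "\<exists>i j. v = i *s x + j *s y"
    then obtain i j where v: "v = i *s x + j *s y"
      by blast
    have "k *s v = (k * i) *s x + (k * j) *s y" for k
      unfolding v by (simp add: vec.scale_right_distrib)
    then show "pt v \<subseteq> {v. \<exists>i j. v = i *s x + j *s y}"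
      unfolding mem_pt_iff subset_iff by blast
  qed
  then show ?thesis
    unfolding join_def span comb_def pg_points_def by force
qed

lemma comb_subset:
  assumes "x = i *s x' + j *s y'" "y = k *s x' + l *s y'"
  shows "comb x y \<subseteq> comb x' y'"
proof
  fix R assume "R \<in> comb x y"
  then obtain m n where R: "R = pt (m *s x + n *s y)" "m *s x + n *s y \<noteq> 0"
    unfolding comb_def by blast
  have "m *s x + n *s y = (m * i + n * k) *s x' + (m * j + n * l) *s y'"
    unfolding assms by (simp add: vec_eq_iff algebra_simps)
  with R show "R \<in> comb x' y'"
    unfolding comb_def by (metis (mono_tags, lifting) mem_Collect_eq)
qed

text \<open>Let \<open>d\<close> be the determinant of the coordinates of the two points.
  \<open>d = 0\<close> would make the points equal; otherwise inverting the matrix expresses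
  \<open>x\<close> and \<open>y\<close> by them.\<close>

lemma join_of_points_of_comb:
  assumes "P \<in> comb x y" "Q \<in> comb x y" "P \<noteq> Q"
  shows "join P Q = comb x y"
proof -
  obtain i j where P: "P = pt (i *s x + j *s y)" and "i *s x + j *s y \<noteq> 0"
    using assms(1) unfolding comb_def by blast
  obtain k l where Q: "Q = pt (k *s x + l *s y)" and "k *s x + l *s y \<noteq> 0"
    using assms(2) unfolding comb_def by blast
  define x' where "x' = i *s x + j *s y"
  define y' where "y' = k *s x + l *s y"
  define d where "d = i * l - j * k"
  have nz: "x' \<noteq> 0" "y' \<noteq> 0"
    unfolding x'_def y'_def by fact+
  have dx: "l *s x' - j *s y' = d *s x" and dy: "i *s y' - k *s x' = d *s y"
    by (simp_all add: x'_def y'_def d_def vec_eq_iff algebra_simps)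
  have "d \<noteq> 0"
  proof
    assume "d = 0"
    then have eq: "l *s x' = j *s y'" "i *s y' = k *s x'"
      using dx dy by simp_all
    have "\<exists>m. m \<noteq> 0 \<and> y' = m *s x'"
    proof (cases "j = 0")
      case False
      then have y': "y' = (l / j) *s x'"
        using arg_cong[OF eq(1), of "\<lambda>v. (1 / j) *s v"] by simp
      then have "l / j \<noteq> 0"
        using nz by (metis vec.scale_zero_left)
      with y' show ?thesis
        by blast
    next
      case True
      then have "i \<noteq> 0"
        using nz(1) unfolding x'_def by auto
      then have y': "y' = (k / i) *s x'"
        using arg_cong[OF eq(2), of "\<lambda>v. (1 / i) *s v"] by simp
      then have "k / i \<noteq> 0"
        using nz by (metis vec.scale_zero_left)
      with y' show ?thesis
        by blast
    qed
    then show False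
      using assms(3) pt_eq_iff[OF nz(2), of x'] unfolding P Q x'_def[symmetric] y'_def[symmetric] by blast
  qed
  have "x = (1 / d) *s (l *s x' - j *s y')" "y = (1 / d) *s (i *s y' - k *s x')"
    unfolding dx dy using \<open>d \<noteq> 0\<close> by simp_all
  then have "x = (l / d) *s x' + (- j / d) *s y'" "y = (- k / d) *s x' + (i / d) *s y'"
    by (simp_all add: vec_eq_iff right_diff_distrib)
  then have "comb x y \<subseteq> comb x' y'"
    by (rule comb_subset)
  moreover have "comb x' y' \<subseteq> comb x y"
    using x'_def y'_def by (rule comb_subset)
  ultimately show ?thesis
    unfolding P Q join_eq_comb x'_def y'_def by blast
qed

lemma in_comb: "x \<noteq> 0 \<Longrightarrow> pt x \<in> comb x y" "y \<noteq> 0 \<Longrightarrow> pt y \<in> comb x y"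
proof -
  have "x = 1 *s x + 0 *s y" "y = 0 *s x + 1 *s y"
    by simp_all
  then show "x \<noteq> 0 \<Longrightarrow> pt x \<in> comb x y" "y \<noteq> 0 \<Longrightarrow> pt y \<in> comb x y"
    unfolding comb_def by (metis (mono_tags, lifting) mem_Collect_eq)+
qed

lemma distinct_points_independent:
  assumes "x \<noteq> 0" "y \<noteq> 0" "pt x \<noteq> pt y" "i *s x + j *s y = 0"
  shows "i = 0 \<and> j = 0"
proof -
  have "j = 0"
  proof (rule ccontr)
    assume "j \<noteq> 0"
    have "y = (1 / j) *s (i *s x + j *s y) - (i / j) *s x"
      using \<open>j \<noteq> 0\<close> by (simp add: vec_eq_iff distrib_left)
    then have y: "y = (- i / j) *s x"
      unfolding assms(4) by (simp add: vec_eq_iff)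
    then have "- i / j \<noteq> 0"
      using assms(2) by (metis vec.scale_zero_left)
    then show False
      using y pt_scale assms(3) by metis
  qed
  then show ?thesis
    using assms by simp
qed

abbreviation vec4 :: "'a \<Rightarrow> 'a \<Rightarrow> 'a \<Rightarrow> 'a \<Rightarrow> 'a::field ^ 4" where
  "vec4 x y z w \<equiv> vector [x, y, z, w]"

lemma vec4_nth [simp]:
  "vec4 x y z w $ 1 = x" "vec4 x y z w $ 2 = y" "vec4 x y z w $ 3 = z" "vec4 x y z w $ 4 = w"
  unfolding vector_def by simp_all

lemma vec4_eq_iff:
  fixes v w :: "'a::field ^ 4"
  shows "v = w \<longleftrightarrow> v $ 1 = w $ 1 \<and> v $ 2 = w $ 2 \<and> v $ 3 = w $ 3 \<and> v $ 4 = w $ 4"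
  by (simp add: vec_eq_iff forall_4)

section \<open>Baer subgeometries as K^2 modulo F_q\<close>

context quadratic_extension
begin

text \<open>\<open>\<alpha>\<close> is kept general, since pencils involve
  \<open>Sigma_geom q \<alpha>\<close> while the spreads live in
  \<open>Sigma_geom q \<eta>\<close>.\<close>

definition sv :: "'a \<Rightarrow> 'a \<times> 'a \<Rightarrow> 'a ^ 4" where
  "sv \<alpha> w = vec4 (fst w) (snd w) (\<alpha> * cj (fst w)) (\<alpha> * cj (snd w))"

definition psi :: "'a \<Rightarrow> 'a \<times> 'a \<Rightarrow> 'a ppoint" where
  "psi \<alpha> w = pt (sv \<alpha> w)"

definition Phi :: "'a \<Rightarrow> ('a \<times> 'a) set \<Rightarrow> 'a ppoint set" where
  "Phi \<alpha> W = psi \<alpha> ` (W - {0})"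

lemma Sigma_geom_eq: "Sigma_geom q \<alpha> = Phi \<alpha> UNIV"
  unfolding Sigma_geom_def Phi_def psi_def sv_def cj_eq[symmetric] zero_prod_def by force

lemma sv_eq_0_iff [simp]: "sv \<alpha> w = 0 \<longleftrightarrow> w = 0"
  by (auto simp: sv_def vec4_eq_iff prod_eq_iff)

lemma sv_lin:
  assumes "i \<in> Fq" "j \<in> Fq"
  shows "sv \<alpha> (sm i v + sm j w) = i *s sv \<alpha> v + j *s sv \<alpha> w"
  using assms by (simp add: sv_def vec4_eq_iff cj_hom Fq_def algebra_simps)

lemma psi_sm:
  assumes "k \<in> Fq" "k \<noteq> 0"
  shows "psi \<alpha> (sm k w) = psi \<alpha> w"
  using sv_lin[OF assms(1) Fq_0, of \<alpha> w w] pt_scale[OF assms(2)] by (simp add: psi_def)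

text \<open>Computing the conjugate coordinates in two ways yields a vanishing combination with
  coefficients \<open>cj i - i\<close> and \<open>cj j - j\<close>. Distinct points are independent
  over K, so both coefficients are 0.\<close>

lemma sv_combination:
  assumes "\<alpha> \<noteq> 0" "v \<noteq> 0" "w \<noteq> 0" "psi \<alpha> v \<noteq> psi \<alpha> w"
    and eq: "sv \<alpha> x = i *s sv \<alpha> v + j *s sv \<alpha> w"
  shows "i \<in> Fq" "j \<in> Fq" "x = sm i v + sm j w"
proof -
  note eq' = eq[unfolded sv_def vec4_eq_iff vector_add_component vector_smult_component vec4_nth]
  have comps: "fst x = i * fst v + j * fst w" "snd x = i * snd v + j * snd w"
    using eq' by blast+
  have comps': "\<alpha> * cj (fst x) = \<alpha> * (i * cj (fst v) + j * cj (fst w))"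
    "\<alpha> * cj (snd x) = \<alpha> * (i * cj (snd v) + j * cj (snd w))"
    using eq'[THEN conjunct2, THEN conjunct2, THEN conjunct1]
      eq'[THEN conjunct2, THEN conjunct2, THEN conjunct2]
    unfolding distrib_left by (simp_all only: mult.left_commute)
  show "x = sm i v + sm j w"
    using comps by (simp add: prod_eq_iff)
  have "cj (fst x) = i * cj (fst v) + j * cj (fst w)" "cj (snd x) = i * cj (snd v) + j * cj (snd w)"
    using comps' assms(1) by (metis mult_left_cancel)+
  then have c: "(cj i - i) * cj (fst v) + (cj j - j) * cj (fst w) = 0"
    "(cj i - i) * cj (snd v) + (cj j - j) * cj (snd w) = 0"
    unfolding comps by (simp_all add: cj_hom left_diff_distrib flip: add_diff_add)
  \<comment> \<open>Conjugation maps \<open>cj i - i\<close> to its negative, so the relations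
    between conjugate coordinates pass to the coordinates themselves.\<close>
  have c1: "(cj i - i) * fst v + (cj j - j) * fst w = 0" "(cj i - i) * snd v + (cj j - j) * snd w = 0"
    using arg_cong[OF c(1), of "\<lambda>x. - cj x"] arg_cong[OF c(2), of "\<lambda>x. - cj x"]
    by (simp_all add: cj_hom left_diff_distrib)
  have c2: "(cj i - i) * (\<alpha> * cj (fst v)) + (cj j - j) * (\<alpha> * cj (fst w)) = 0"
    "(cj i - i) * (\<alpha> * cj (snd v)) + (cj j - j) * (\<alpha> * cj (snd w)) = 0"
    unfolding mult.left_commute[of _ \<alpha>] distrib_left[symmetric] c by simp_all
  have "(cj i - i) *s sv \<alpha> v + (cj j - j) *s sv \<alpha> w = 0"
    unfolding sv_def vec4_eq_iff vector_add_component vector_smult_component vec4_nth c1 c2 by simp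
  then have "cj i - i = 0 \<and> cj j - j = 0"
    using assms by (intro distinct_points_independent) (auto simp: psi_def)
  then show "i \<in> Fq" "j \<in> Fq"
    by (simp_all add: Fq_def)
qed

lemma psi_eqD:
  assumes "v \<noteq> 0" "w \<noteq> 0" "psi \<alpha> v = psi \<alpha> w" "\<alpha> \<noteq> 0"
  obtains k where "k \<in> Fq" "k \<noteq> 0" "w = sm k v"
proof -
  obtain k where k: "k \<noteq> 0" "sv \<alpha> w = k *s sv \<alpha> v"
    using pt_eq_iff[of "sv \<alpha> w" "sv \<alpha> v"] assms(2,3) by (auto simp: psi_def)
  have w: "w = sm k v"
    using k(2) by (simp add: sv_def vec4_eq_iff prod_eq_iff)
  have "\<alpha> * cj (fst w) = k * (\<alpha> * cj (fst v))" "\<alpha> * cj (snd w) = k * (\<alpha> * cj (snd v))"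
    using arg_cong[OF k(2), of "\<lambda>x. x $ 3"] arg_cong[OF k(2), of "\<lambda>x. x $ 4"]
    unfolding sv_def by simp_all
  then have "(cj k - k) * cj (fst v) = 0" "(cj k - k) * cj (snd v) = 0"
    unfolding w using \<open>\<alpha> \<noteq> 0\<close> by (simp_all add: cj_mult algebra_simps)
  moreover have "fst v \<noteq> 0 \<or> snd v \<noteq> 0"
    using assms(1) by (simp add: prod_eq_iff)
  ultimately have "k \<in> Fq"
    by (auto simp: Fq_def)
  then show ?thesis
    using that k(1) w by blast
qed

lemma psi_mem_Phi_iff:
  assumes "Fq_closed W" "w \<noteq> 0" "\<alpha> \<noteq> 0"
  shows "psi \<alpha> w \<in> Phi \<alpha> W \<longleftrightarrow> w \<in> W"
proof
  assume "psi \<alpha> w \<in> Phi \<alpha> W"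
  then obtain v where v: "v \<in> W" "v \<noteq> 0" "psi \<alpha> w = psi \<alpha> v"
    unfolding Phi_def by blast
  obtain k where "k \<in> Fq" "w = sm k v"
    using psi_eqD[OF v(2) assms(2) v(3)[symmetric] assms(3)] .
  then show "w \<in> W"
    using assms(1) v(1) unfolding Fq_closed_def by blast
qed (use assms in \<open>auto simp: Phi_def\<close>)

lemma Lines_Fq_closed: "W \<in> Lines \<Longrightarrow> Fq_closed W"
  by (simp add: Lines_def)

lemma inj_on_Phi:
  assumes "\<alpha> \<noteq> 0"
  shows "inj_on (Phi \<alpha>) Lines"
proof (rule inj_onI)
  fix V W assume VW: "V \<in> Lines" "W \<in> Lines" "Phi \<alpha> V = Phi \<alpha> W"
  have "w \<in> V \<longleftrightarrow> w \<in> W" for w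
  proof (cases "w = 0")
    case True
    then show ?thesis
      using Lines_0 VW by blast
  next
    case False
    then show ?thesis
      using psi_mem_Phi_iff[OF Lines_Fq_closed False assms] VW by metis
  qed
  then show "V = W"
    by blast
qed

lemma psi_neq:
  assumes "indep v w" "\<alpha> \<noteq> 0"
  shows "v \<noteq> 0" "w \<noteq> 0" "psi \<alpha> v \<noteq> psi \<alpha> w"
proof -
  show nz: "v \<noteq> 0" "w \<noteq> 0"
    using assms(1) Fq_0 Fq_1 unfolding indep_def by (metis add_0 add.right_neutral sm_simps(3,5) zero_neq_one)+
  show "psi \<alpha> v \<noteq> psi \<alpha> w"
  proof
    assume "psi \<alpha> v = psi \<alpha> w"
    then obtain k where k: "k \<in> Fq" "w = sm k v"
      using psi_eqD[OF nz _ assms(2)] by metis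
    then have "sm (- k) v + sm 1 w = 0"
      by (simp add: prod_eq_iff)
    then show False
      using assms(1) Fq_minus[OF k(1)] Fq_1 unfolding indep_def by (metis zero_neq_one)
  qed
qed

lemma Phi_linE:
  assumes "R \<in> Phi \<alpha> (lin v w)"
  obtains i j where "i \<in> Fq" "j \<in> Fq" "sm i v + sm j w \<noteq> 0" "R = psi \<alpha> (sm i v + sm j w)"
proof -
  obtain x where x: "x \<in> lin v w" "x \<noteq> 0" "R = psi \<alpha> x"
    using assms unfolding Phi_def by blast
  then obtain i j where "i \<in> Fq" "j \<in> Fq" "x = sm i v + sm j w"
    unfolding mem_lin_iff by blast
  with x that show ?thesis
    by blast
qed

lemma join_psi:
  assumes "indep v w" "\<alpha> \<noteq> 0"
  shows "join (psi \<alpha> v) (psi \<alpha> w) \<inter> Sigma_geom q \<alpha> = Phi \<alpha> (lin v w)"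
proof (intro set_eqI iffI)
  note nz = psi_neq[OF assms]
  fix R
  {
    assume "R \<in> join (psi \<alpha> v) (psi \<alpha> w) \<inter> Sigma_geom q \<alpha>"
    then obtain i j x where R: "R = pt (i *s sv \<alpha> v + j *s sv \<alpha> w)" "i *s sv \<alpha> v + j *s sv \<alpha> w \<noteq> 0"
      and x: "R = pt (sv \<alpha> x)" "x \<noteq> 0"
      unfolding psi_def join_eq_comb comb_def Sigma_geom_eq Phi_def by blast
    then obtain k where "sv \<alpha> x = k *s (i *s sv \<alpha> v + j *s sv \<alpha> w)"
      using pt_eqD by metis
    then have "sv \<alpha> x = (k * i) *s sv \<alpha> v + (k * j) *s sv \<alpha> w"
      by (simp add: vec.scale_right_distrib)
    from sv_combination[OF assms(2) nz this] have "x \<in> lin v w"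
      unfolding mem_lin_iff by blast
    then show "R \<in> Phi \<alpha> (lin v w)"
      using x unfolding Phi_def psi_def by blast
  }
  assume "R \<in> Phi \<alpha> (lin v w)"
  then obtain i j where ij: "i \<in> Fq" "j \<in> Fq" "sm i v + sm j w \<noteq> 0" "R = psi \<alpha> (sm i v + sm j w)"
    by (rule Phi_linE)
  then have "R \<in> join (psi \<alpha> v) (psi \<alpha> w)"
    unfolding psi_def join_eq_comb comb_def sv_lin[OF ij(1,2)]
    by (metis (mono_tags, lifting) mem_Collect_eq sv_eq_0_iff sv_lin)
  then show "R \<in> join (psi \<alpha> v) (psi \<alpha> w) \<inter> Sigma_geom q \<alpha>"
    unfolding Sigma_geom_eq Phi_def using ij by blast
qed

lemma indep_if_psi_neq:
  assumes "v \<noteq> 0" "psi \<alpha> v \<noteq> psi \<alpha> w" "w \<noteq> 0"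
  shows "indep v w"
proof (rule indepI[OF assms(1)])
  fix k assume "k \<in> Fq"
  then show "w \<noteq> sm k v"
    using psi_sm[of k \<alpha> v] assms(2,3) by (metis sm_simps(3))
qed

lemma Phi_Lines_join:
  assumes "W \<in> Lines" "\<alpha> \<noteq> 0"
  obtains v w where "v \<in> W" "w \<in> W" "indep v w" "Phi \<alpha> W = join (psi \<alpha> v) (psi \<alpha> w) \<inter> Sigma_geom q \<alpha>"
proof -
  obtain v where v: "v \<in> W" "v \<noteq> 0"
    using Lines_nonzero[OF assms(1)] .
  obtain w where w: "w \<in> W" "indep v w"
    using Lines_basis[OF assms(1) v] .
  then show ?thesis
    using that[OF v(1) w] join_psi[OF w(2) assms(2)] Lines_eq_lin[OF assms(1) v(1) w] by simp
qed

lemma sub_lines_eq: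
  assumes "\<alpha> \<noteq> 0"
  shows "sub_lines (Sigma_geom q \<alpha>) = Phi \<alpha> ` Lines"
proof (intro set_eqI iffI)
  fix l assume "l \<in> sub_lines (Sigma_geom q \<alpha>)"
  then obtain P Q where PQ: "P \<in> Phi \<alpha> UNIV" "Q \<in> Phi \<alpha> UNIV" "P \<noteq> Q"
    "l = join P Q \<inter> Sigma_geom q \<alpha>"
    unfolding sub_lines_def Sigma_geom_eq[symmetric] by blast
  then obtain v w where "P = psi \<alpha> v" "Q = psi \<alpha> w" "v \<noteq> 0" "w \<noteq> 0"
    unfolding Phi_def by blast
  with PQ have "v \<noteq> 0" "w \<noteq> 0" "psi \<alpha> v \<noteq> psi \<alpha> w"
    "l = join (psi \<alpha> v) (psi \<alpha> w) \<inter> Sigma_geom q \<alpha>"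
    by simp_all
  then show "l \<in> Phi \<alpha> ` Lines"
    using join_psi[OF _ assms] indep_if_psi_neq lin_in_Lines by blast
next
  fix l assume "l \<in> Phi \<alpha> ` Lines"
  then obtain W where W: "W \<in> Lines" "l = Phi \<alpha> W"
    by blast
  obtain v w where vw: "indep v w" "l = join (psi \<alpha> v) (psi \<alpha> w) \<inter> Sigma_geom q \<alpha>"
    using Phi_Lines_join[OF W(1) assms] W(2) by metis
  have "psi \<alpha> v \<in> Sigma_geom q \<alpha>" "psi \<alpha> w \<in> Sigma_geom q \<alpha>"
    using psi_neq[OF vw(1) assms] by (auto simp: Sigma_geom_eq Phi_def)
  then show "l \<in> sub_lines (Sigma_geom q \<alpha>)"
    unfolding sub_lines_def using vw(2) psi_neq(3)[OF vw(1) assms] by blast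
qed

lemma Phi_baer_subline:
  assumes "W \<in> Lines" "\<alpha> \<noteq> 0"
  shows "Phi \<alpha> W \<in> baer_sublines q"
proof -
  obtain v where v: "v \<in> W" "v \<noteq> 0"
    using Lines_nonzero[OF assms(1)] .
  obtain w where w: "w \<in> W" "indep v w"
    using Lines_basis[OF assms(1) v] .
  have W: "W = lin v w"
    using Lines_eq_lin[OF assms(1) v(1) w] .
  note nz = psi_neq[OF w(2) assms(2)]
  have "Phi \<alpha> W = {pt (a *s sv \<alpha> v + b *s sv \<alpha> w) | a b.
      a \<in> subfield_q q \<and> b \<in> subfield_q q \<and> (a, b) \<noteq> (0, 0)}"
  proof (intro set_eqI iffI)
    fix R assume "R \<in> Phi \<alpha> W"
    then have "R \<in> Phi \<alpha> (lin v w)"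
      unfolding W .
    then obtain i j where ij: "i \<in> Fq" "j \<in> Fq" "sm i v + sm j w \<noteq> 0" "R = psi \<alpha> (sm i v + sm j w)"
      by (rule Phi_linE)
    moreover have "(i, j) \<noteq> (0, 0)"
      using ij(3) by auto
    ultimately show "R \<in> {pt (a *s sv \<alpha> v + b *s sv \<alpha> w) | a b.
        a \<in> subfield_q q \<and> b \<in> subfield_q q \<and> (a, b) \<noteq> (0, 0)}"
      unfolding psi_def subfield_q_eq using sv_lin[OF ij(1,2)] by auto
  next
    fix R assume "R \<in> {pt (a *s sv \<alpha> v + b *s sv \<alpha> w) | a b.
        a \<in> subfield_q q \<and> b \<in> subfield_q q \<and> (a, b) \<noteq> (0, 0)}"
    then obtain i j where ij: "i \<in> Fq" "j \<in> Fq" "(i, j) \<noteq> (0, 0)" "R = psi \<alpha> (sm i v + sm j w)"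
      unfolding psi_def subfield_q_eq by (auto simp: sv_lin)
    moreover have "sm i v + sm j w \<noteq> 0"
    proof -
      have "\<not> (i = 0 \<and> j = 0)"
        using ij(3) by simp
      then show ?thesis
        using ij(1,2) w(2) unfolding indep_def by blast
    qed
    moreover have "sm i v + sm j w \<in> lin v w"
      unfolding mem_lin_iff using ij(1,2) by blast
    ultimately show "R \<in> Phi \<alpha> W"
      unfolding Phi_def W by blast
  qed
  then show ?thesis
    unfolding baer_sublines_def using nz unfolding psi_def
    by (intro CollectI exI[of _ "sv \<alpha> v"] exI[of _ "sv \<alpha> w"]) (simp only: sv_eq_0_iff simp_thms)
qed

section \<open>Spreads and pencils in coordinates\<close>

text \<open>With \<open>cj y = \<eta> * y\<close> from \<open>hilbert90\<close>, multiplication by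
  \<open>y\<close> takes the vectors for \<open>\<eta>\<close> to the vectors for 1. This allows
  \<eta> to be replaced by 1 from here on.\<close>

lemma Sigma_geom_norm_one:
  assumes "\<eta> * cj \<eta> = 1"
  shows "Sigma_geom q \<eta> = Sigma_geom q 1"
proof -
  obtain y where y: "y \<noteq> 0" "cj y = \<eta> * y"
    using hilbert90[OF assms] .
  have psi: "psi \<eta> w = psi 1 (sm y w)" for w
  proof -
    have "sv 1 (sm y w) = y *s sv \<eta> w"
      by (simp add: sv_def vec4_eq_iff cj_mult y(2))
    then show ?thesis
      unfolding psi_def using pt_scale[OF y(1), of "sv \<eta> w"] by simp
  qed
  have "surj (sm y)"
    by (rule surjI[of _ "sm (1 / y)"]) (use y(1) in simp)
  then have "sm y ` (UNIV - {0}) = UNIV - {0}"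
    using inj_on_image_set_diff[of "sm y" UNIV UNIV "{0}"] y(1) finite_UNIV_surj_inj[of "sm y"]
    by simp
  then show ?thesis
    unfolding Sigma_geom_eq Phi_def psi image_image[symmetric, of "psi 1" "sm y"] by simp
qed

text \<open>\<open>tau_vec\<close> with its factor \<open>\<eta> ^ (q + 1)\<close> equal to
  1.\<close>

definition tauv :: "'a ^ 4 \<Rightarrow> 'a ^ 4" where
  "tauv x = vec4 (cj (x $ 3)) (cj (x $ 4)) (cj (x $ 1)) (cj (x $ 2))"

lemma tau_pt:
  assumes "\<eta> * cj \<eta> = 1"
  shows "tau q \<eta> (pt x) = pt (tauv x)"
proof -
  have t: "tau_vec q \<eta> = tauv"
    unfolding tau_vec_def tauv_def norm_eq assms cj_eq[symmetric] by (simp add: fun_eq_iff)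
  have s: "tauv (k *s x) = cj k *s tauv x" for k
    by (simp add: tauv_def vec4_eq_iff cj_mult)
  show ?thesis
    unfolding tau_def t
  proof (intro set_eqI iffI)
    fix y assume "y \<in> tauv ` pt x"
    then obtain k where "y = cj k *s tauv x"
      unfolding pt_def vec.span_singleton using s by blast
    then show "y \<in> pt (tauv x)"
      unfolding mem_pt_iff by blast
  next
    fix y assume "y \<in> pt (tauv x)"
    then obtain k where "y = k *s tauv x"
      unfolding mem_pt_iff by blast
    then have "y = tauv (cj k *s x)"
      by (simp add: s)
    then show "y \<in> tauv ` pt x"
      using mem_pt_iff by blast
  qed
qed

definition lift :: "'a \<Rightarrow> 'a \<Rightarrow> 'a \<Rightarrow> 'a \<times> 'a \<Rightarrow> 'a ^ 4" where
  "lift a b c p = vec4 (fst p) (snd p) (a * fst p + c * snd p) (b * snd p)"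

text \<open>These are the lines through (1, 0, a, 0) in the plane X4 = b X2 other than
  \<open>r_U1\<close>; \<open>c\<close> tells them apart.\<close>

definition ell :: "'a \<Rightarrow> 'a \<Rightarrow> 'a \<Rightarrow> 'a ppoint set" where
  "ell a b c = {pt (lift a b c p) | p. p \<noteq> 0}"

lemma lift_eq_0_iff [simp]: "lift a b c p = 0 \<longleftrightarrow> p = 0"
  by (auto simp: lift_def vec4_eq_iff prod_eq_iff)

lemma pt_lift_in_ell: "p \<noteq> 0 \<Longrightarrow> pt (lift a b c p) \<in> ell a b c"
  unfolding ell_def by blast

lemma ell_eq_comb: "ell a b c = comb (lift a b c (1, 0)) (lift a b c (0, 1))"
proof -
  have l: "i *s lift a b c (1, 0) + j *s lift a b c (0, 1) = lift a b c (i, j)" for i j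
    by (simp add: lift_def vec4_eq_iff mult.commute)
  show ?thesis
    unfolding comb_def l ell_def lift_eq_0_iff by (metis surj_pair)
qed

text \<open>The right-hand side is a vector fixed by \<open>tauv\<close> on the join of the point
  and its image. This is why \<open>M\<close> describes the points of the subgeometry there.\<close>

lemma sv_M_sm: "sv 1 (M a b c (sm k p)) = k *s lift a b c p + cj k *s tauv (lift a b c p)"
  unfolding M_sm sv_def lift_def tauv_def vec4_eq_iff by (simp add: G_def cj_hom algebra_simps)

text \<open>By \<open>sv_M_sm\<close>, two different points of the image of the K-line lie on the
  join of the point and its image under \<tau>, so they span the same line.\<close>

lemma join_tau:
  assumes "a * cj a \<noteq> 1" "b * cj b \<noteq> 1" "p \<noteq> 0" "\<eta> * cj \<eta> = 1"
  shows "join (pt (lift a b c p)) (tau q \<eta> (pt (lift a b c p))) \<inter> Sigma_geom q \<eta> = Phi 1 (M a b c ` K_line p)"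
proof -
  let ?l = "lift a b c p"
  obtain v w where vw: "v \<in> M a b c ` K_line p" "w \<in> M a b c ` K_line p" "indep v w"
    "Phi 1 (M a b c ` K_line p) = join (psi 1 v) (psi 1 w) \<inter> Sigma_geom q 1"
    by (rule Phi_Lines_join[OF M_K_line_in_Lines[OF assms(1-3)], where \<alpha> = 1]) simp_all
  note nz = psi_neq[OF vw(3), of 1, OF one_neq_zero]
  have in_comb: "psi 1 v \<in> comb ?l (tauv ?l)" if "v \<in> M a b c ` K_line p" "v \<noteq> 0" for v
  proof -
    obtain k where k: "v = M a b c (sm k p)"
      using \<open>v \<in> M a b c ` K_line p\<close> unfolding K_line_def by blast
    have "sv 1 v \<noteq> 0"
      using \<open>v \<noteq> 0\<close> by simp
    then show ?thesis
      unfolding psi_def comb_def k sv_M_sm by blast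
  qed
  have "join (psi 1 v) (psi 1 w) = comb ?l (tauv ?l)"
    using in_comb[OF vw(1) nz(1)] in_comb[OF vw(2) nz(2)] nz(3) by (rule join_of_points_of_comb)
  then show ?thesis
    unfolding vw(4) tau_pt[OF assms(4)] join_eq_comb Sigma_geom_norm_one[OF assms(4)] by simp
qed

lemma S_spread_ell:
  assumes "a * cj a \<noteq> 1" "b * cj b \<noteq> 1" "\<eta> * cj \<eta> = 1"
  shows "S_spread q \<eta> (ell a b c) = Phi 1 ` S_lines a b c"
proof (intro set_eqI iffI)
  fix L assume "L \<in> S_spread q \<eta> (ell a b c)"
  then obtain p where "p \<noteq> 0" "L = join (pt (lift a b c p)) (tau q \<eta> (pt (lift a b c p))) \<inter> Sigma_geom q \<eta>"
    unfolding S_spread_def ell_def by blast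
  then show "L \<in> Phi 1 ` S_lines a b c"
    unfolding S_lines_def using join_tau[OF assms(1,2) _ assms(3)] by blast
next
  fix L assume "L \<in> Phi 1 ` S_lines a b c"
  then obtain p where p: "p \<noteq> 0" "L = Phi 1 (M a b c ` K_line p)"
    unfolding S_lines_def by blast
  then have "L = join (pt (lift a b c p)) (tau q \<eta> (pt (lift a b c p))) \<inter> Sigma_geom q \<eta>"
    using join_tau[OF assms(1,2) p(1) assms(3)] by simp
  then show "L \<in> S_spread q \<eta> (ell a b c)"
    unfolding S_spread_def using pt_lift_in_ell[OF p(1)] by blast
qed

lemma t1_eq: "t1 = ell 0 0 0"
  unfolding t1_def U1_def U2_def join_eq_comb ell_eq_comb lift_def by simp

lemma D_spread_eq: "\<eta> * cj \<eta> = 1 \<Longrightarrow> D_spread q \<eta> = Phi 1 ` D_lines"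
  unfolding D_spread_def t1_eq S_lines_0[symmetric] by (rule S_spread_ell) simp_all

lemma Phi_image_Int:
  "A \<subseteq> Lines \<Longrightarrow> B \<subseteq> Lines \<Longrightarrow> Phi 1 ` A \<inter> Phi 1 ` B = Phi 1 ` (A \<inter> B)"
  by (rule inj_on_image_Int[symmetric, OF inj_on_Phi]) simp_all

lemma Phi_image_Diff:
  "A \<subseteq> Lines \<Longrightarrow> B \<subseteq> Lines \<Longrightarrow> Phi 1 ` A - Phi 1 ` B = Phi 1 ` (A - B)"
  by (rule inj_on_image_set_diff[symmetric, OF inj_on_Phi]) auto

lemma Phi_meet_iff:
  assumes "V \<in> Lines" "W \<in> Lines"
  shows "Phi 1 V \<inter> Phi 1 W \<noteq> {} \<longleftrightarrow> (\<exists>w. w \<noteq> 0 \<and> w \<in> V \<and> w \<in> W)"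
proof
  assume "Phi 1 V \<inter> Phi 1 W \<noteq> {}"
  then obtain w where w: "w \<in> V" "w \<noteq> 0" "psi 1 w \<in> Phi 1 W"
    unfolding Phi_def by blast
  then have "w \<in> W"
    using psi_mem_Phi_iff[OF Lines_Fq_closed[OF assms(2)] w(2), of 1] by simp
  then show "\<exists>w. w \<noteq> 0 \<and> w \<in> V \<and> w \<in> W"
    using w by blast
next
  assume "\<exists>w. w \<noteq> 0 \<and> w \<in> V \<and> w \<in> W"
  then show "Phi 1 V \<inter> Phi 1 W \<noteq> {}"
    unfolding Phi_def by blast
qed

lemma opposite_regulus_Phi:
  assumes "R \<subseteq> Lines"
  shows "opposite_regulus (Sigma_geom q 1) (Phi 1 ` R) = Phi 1 ` opp R"
proof -
  have "opposite_regulus (Sigma_geom q 1) (Phi 1 ` R) =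
      Phi 1 ` {m \<in> Lines. \<forall>r\<in>R. Phi 1 m \<inter> Phi 1 r \<noteq> {}}"
    unfolding opposite_regulus_def sub_lines_eq[OF one_neq_zero] Compr_image_eq
    by (simp only: ball_simps)
  also have "{m \<in> Lines. \<forall>r\<in>R. Phi 1 m \<inter> Phi 1 r \<noteq> {}} = opp R"
    unfolding opp_def
  proof (rule Collect_cong, rule conj_cong[OF refl], rule ball_cong[OF refl])
    fix m r assume "m \<in> Lines" "r \<in> R"
    then show "Phi 1 m \<inter> Phi 1 r \<noteq> {} \<longleftrightarrow> (\<exists>w. w \<noteq> 0 \<and> w \<in> m \<and> w \<in> r)"
      by (rule Phi_meet_iff[OF _ subsetD[OF assms]])
  qed
  finally show ?thesis .
qed

lemma switched_spread_eq:
  assumes "param a b" "\<eta> * cj \<eta> = 1"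
  shows "(S_spread q \<eta> (ell a b c) - R_regulus q \<eta> (ell a b c)) \<union>
    opposite_regulus (Sigma_geom q \<eta>) (R_regulus q \<eta> (ell a b c)) = Phi 1 ` switched a b c"
proof -
  note P = paramD(4,5)[OF assms(1)]
  have L: "S_lines a b c \<subseteq> Lines" "D_lines \<subseteq> Lines" "R_lines a b c \<subseteq> Lines"
    using spread_Lines[OF spread_S_lines[OF P]] spread_Lines[OF spread_D_lines] unfolding R_lines_def by blast+
  have R: "R_regulus q \<eta> (ell a b c) = Phi 1 ` R_lines a b c"
    unfolding R_regulus_def D_spread_eq[OF assms(2)] S_spread_ell[OF P assms(2)] R_lines_def
    by (rule Phi_image_Int[OF L(2,1)])
  show ?thesis
    unfolding R S_spread_ell[OF P assms(2)] Sigma_geom_norm_one[OF assms(2)]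
      opposite_regulus_Phi[OF L(3)] Phi_image_Diff[OF L(1,3)] switched_def image_Un ..
qed

section \<open>Transfer of spreads and parallelisms to projective notions\<close>

lemma line_spread_Phi:
  assumes "spread S"
  shows "line_spread (Sigma_geom q 1) (Phi 1 ` S)"
  unfolding line_spread_def partition_on_def
proof (intro conjI)
  have L: "W \<in> Lines" if "W \<in> S" for W
    using spread_Lines[OF assms that] .
  then show "Phi 1 ` S \<subseteq> sub_lines (Sigma_geom q 1)"
    unfolding sub_lines_eq[OF one_neq_zero] by blast
  show "\<Union> (Phi 1 ` S) = Sigma_geom q 1"
  proof (intro set_eqI iffI)
    fix R :: "'a ppoint" assume "R \<in> Sigma_geom q 1"
    then obtain w where w: "w \<noteq> 0" "R = psi 1 w"
      unfolding Sigma_geom_eq Phi_def by blast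
    obtain W where "W \<in> S" "w \<in> W"
      using spread_ex1[OF assms w(1)] by blast
    then show "R \<in> \<Union> (Phi 1 ` S)"
      using w unfolding Phi_def by blast
  qed (auto simp: Sigma_geom_eq Phi_def)
  have "V = W" if "V \<in> S" "W \<in> S" "Phi 1 V \<inter> Phi 1 W \<noteq> {}" for V W
    using that(3) spread_unique[OF assms that(1,2)] unfolding Phi_meet_iff[OF L[OF that(1)] L[OF that(2)]]
    by blast
  then show "disjoint (Phi 1 ` S)"
    unfolding pairwise_def disjnt_def by blast
  show "{} \<notin> Phi 1 ` S"
  proof
    assume "{} \<in> Phi 1 ` S"
    then obtain W where W: "W \<in> S" "Phi 1 W = {}"
      by (metis imageE)
    obtain w where "w \<in> W" "w \<noteq> 0"
      using Lines_nonzero[OF L[OF W(1)]] .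
    then show False
      using W(2) unfolding Phi_def by blast
  qed
qed

text \<open>\<open>Phi 1\<close> is injective on \<open>Lines\<close>, so membership and uniqueness
  carry over. Disjointness follows from uniqueness: a shared line would lie in two spreads.\<close>

lemma line_parallelism_iff:
  assumes "\<And>S. S \<in> \<S> \<Longrightarrow> spread S"
  shows "line_parallelism (Sigma_geom q 1) ((`) (Phi 1) ` \<S>) \<longleftrightarrow> parallelism \<S>"
proof -
  have mem: "Phi 1 W \<in> Phi 1 ` S \<longleftrightarrow> W \<in> S" if "S \<in> \<S>" "W \<in> Lines" for S W
  proof -
    have "S \<subseteq> Lines"
      using spread_Lines[OF assms[OF that(1)]] by blast
    then show ?thesis
      using inj_on_image_mem_iff[OF inj_on_Phi[OF one_neq_zero] that(2)] by blast
  qed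
  have inj: "S = S'" if "S \<in> \<S>" "S' \<in> \<S>" "Phi 1 ` S = Phi 1 ` S'" for S S'
  proof -
    have "S \<subseteq> Lines" "S' \<subseteq> Lines"
      using spread_Lines[OF assms[OF that(1)]] spread_Lines[OF assms[OF that(2)]] by blast+
    then show ?thesis
      using inj_on_image_eq_iff[OF inj_on_Phi[OF one_neq_zero]] that(3) by metis
  qed
  have ex1: "(\<exists>!T. T \<in> (`) (Phi 1) ` \<S> \<and> Phi 1 W \<in> T) \<longleftrightarrow> (\<exists>!S. S \<in> \<S> \<and> W \<in> S)"
    if W: "W \<in> Lines" for W
  proof
    assume "\<exists>!T. T \<in> (`) (Phi 1) ` \<S> \<and> Phi 1 W \<in> T"
    then obtain T where T: "T \<in> (`) (Phi 1) ` \<S> \<and> Phi 1 W \<in> T"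
      and uniq: "\<forall>T'. T' \<in> (`) (Phi 1) ` \<S> \<and> Phi 1 W \<in> T' \<longrightarrow> T' = T"
      by (rule ex1E)
    then obtain S where S: "S \<in> \<S>" "T = Phi 1 ` S"
      by blast
    show "\<exists>!S. S \<in> \<S> \<and> W \<in> S"
    proof (rule ex1I[of _ S])
      show "S \<in> \<S> \<and> W \<in> S"
        using S T mem[OF S(1) W] by simp
      fix S' assume S': "S' \<in> \<S> \<and> W \<in> S'"
      then have "Phi 1 ` S' = Phi 1 ` S"
        using uniq S(2) by blast
      then show "S' = S"
        using inj S(1) S' by simp
    qed
  next
    assume "\<exists>!S. S \<in> \<S> \<and> W \<in> S"
    then obtain S where S: "S \<in> \<S>" "W \<in> S" and uniq: "\<And>S'. S' \<in> \<S> \<Longrightarrow> W \<in> S' \<Longrightarrow> S' = S"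
      by blast
    show "\<exists>!T. T \<in> (`) (Phi 1) ` \<S> \<and> Phi 1 W \<in> T"
    proof (rule ex1I[of _ "Phi 1 ` S"])
      show "Phi 1 ` S \<in> (`) (Phi 1) ` \<S> \<and> Phi 1 W \<in> Phi 1 ` S"
        using S by blast
      fix T assume "T \<in> (`) (Phi 1) ` \<S> \<and> Phi 1 W \<in> T"
      then obtain S' where "S' \<in> \<S>" "T = Phi 1 ` S'" "W \<in> S'"
        using mem[OF _ W] by blast
      then show "T = Phi 1 ` S"
        using uniq by blast
    qed
  qed
  have all: "(\<forall>l\<in>sub_lines (Sigma_geom q 1). \<exists>!T. T \<in> (`) (Phi 1) ` \<S> \<and> l \<in> T) \<longleftrightarrow>
      (\<forall>W\<in>Lines. \<exists>!S. S \<in> \<S> \<and> W \<in> S)"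
    unfolding sub_lines_eq[OF one_neq_zero] ball_simps using ex1 by (rule ball_cong[OF refl])
  have "disjoint ((`) (Phi 1) ` \<S>)" if par: "parallelism \<S>"
    unfolding pairwise_def disjnt_def
  proof (intro ballI impI)
    fix T T' assume T: "T \<in> (`) (Phi 1) ` \<S>" "T' \<in> (`) (Phi 1) ` \<S>" "T \<noteq> T'"
    then obtain S S' where S: "S \<in> \<S>" "S' \<in> \<S>" "T = Phi 1 ` S" "T' = Phi 1 ` S'"
      by blast
    have "S \<inter> S' = {}"
    proof (rule equals0I)
      fix W assume W: "W \<in> S \<inter> S'"
      then have "W \<in> Lines"
        using spread_Lines[OF assms[OF S(1)]] by blast
      then have "S = S'"
        using parallelism_ex1[OF par] W S(1,2) by blast
      then show False
        using S T by simp
    qed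
    then show "T \<inter> T' = {}"
      unfolding S using Phi_image_Int spread_Lines[OF assms[OF S(1)]] spread_Lines[OF assms[OF S(2)]]
      by (simp add: subset_iff)
  qed
  moreover have "\<forall>T\<in>(`) (Phi 1) ` \<S>. line_spread (Sigma_geom q 1) T"
    using line_spread_Phi assms by blast
  moreover have "parallelism \<S> \<longleftrightarrow> (\<forall>W\<in>Lines. \<exists>!S. S \<in> \<S> \<and> W \<in> S)"
    unfolding parallelism_def by (simp only: assms simp_thms ball_triv cong: ball_cong)
  ultimately show ?thesis
    unfolding line_parallelism_def all by argo
qed

section \<open>The pencils in coordinates\<close>

lemma P_point_eq: "P_point a = pt (lift a b c (1, 0))"
  by (simp add: P_point_def lift_def)

lemma r_U1_eq: "r_U1 = comb (vec4 1 0 0 0) (vec4 0 0 1 0)"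
  unfolding r_U1_def U1_def U3_def join_eq_comb ..

lemma P_point_inject: "P_point a = P_point a' \<longleftrightarrow> a = a'"
proof
  assume "P_point a = P_point a'"
  then obtain k where "vec4 1 0 a' 0 = k *s vec4 1 0 a 0"
    unfolding P_point_def using pt_eqD by blast
  then show "a = a'"
    by (auto simp: vec4_eq_iff)
qed simp

lemma pt_in_pi_plane_iff: "x \<noteq> 0 \<Longrightarrow> pt x \<in> pi_plane b \<longleftrightarrow> x $ 4 = b * x $ 2"
proof
  assume "x \<noteq> 0" "pt x \<in> pi_plane b"
  moreover have "x \<in> pt x"
    unfolding mem_pt_iff by (metis vec.scale_one)
  ultimately show "x $ 4 = b * x $ 2"
    unfolding pi_plane_def by blast
next
  assume "x \<noteq> 0" "x $ 4 = b * x $ 2"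
  then show "pt x \<in> pi_plane b"
    unfolding pi_plane_def using pt_in_pg_points by (auto simp: mem_pt_iff)
qed

lemma pi_plane_inject: "pi_plane b = pi_plane b' \<longleftrightarrow> b = b'"
proof
  assume eq: "pi_plane b = pi_plane b'"
  have nz: "vec4 0 1 0 b \<noteq> 0"
    by (simp add: vec4_eq_iff)
  then have "pt (vec4 0 1 0 b) \<in> pi_plane b'"
    unfolding eq[symmetric] pt_in_pi_plane_iff[OF nz] by simp
  then show "b = b'"
    unfolding pt_in_pi_plane_iff[OF nz] by simp
qed simp

lemma baer_subline_other_point:
  fixes B :: "'a ppoint set"
  assumes "B \<in> baer_sublines q"
  obtains Q where "Q \<in> B" "Q \<noteq> P"
proof -
  obtain x y where xy: "pt x \<noteq> pt y" and
    B: "B = {pt (a *s x + b *s y) | a b. a \<in> subfield_q q \<and> b \<in> subfield_q q \<and> (a, b) \<noteq> (0, 0)}"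
    using assms unfolding baer_sublines_def by blast
  have "pt x \<in> B"
    unfolding B by (rule CollectI, rule exI[of _ 1], rule exI[of _ 0]) (simp add: subfield_q_eq)
  moreover have "pt y \<in> B"
    unfolding B by (rule CollectI, rule exI[of _ 0], rule exI[of _ 1]) (simp add: subfield_q_eq)
  ultimately show ?thesis
    using that xy by metis
qed

text \<open>The Baer subline supplies a second point \<open>Q\<close> of the subgeometry on
  \<open>l\<close>. As \<open>Q\<close> is in the plane, its second coordinate y satisfies cj y = v
  y; \<open>c\<close> is read off from its third coordinate, and conjugation gives the condition on
  \<open>c\<close>.\<close>

lemma pencil_subset:
  assumes "\<alpha> \<noteq> 0" "u * cj u = 1" "v * cj v = 1"
    and l: "l \<in> pencil q \<alpha> (P_point (\<alpha> * u)) (pi_plane (\<alpha> * v))" "l \<noteq> r_U1"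
  shows "l \<in> ell (\<alpha> * u) (\<alpha> * v) ` pencil_coeffs (\<alpha> * u) (\<alpha> * v)"
proof -
  let ?P = "P_point (\<alpha> * u)" and ?\<pi> = "pi_plane (\<alpha> * v)"
  have l': "l \<in> pg_lines" "l \<subseteq> ?\<pi>" "?P \<in> l" "l \<inter> (?\<pi> \<inter> Sigma_geom q \<alpha>) \<in> baer_sublines q"
    using l(1) unfolding pencil_def by blast+
  obtain Q where Q: "Q \<in> l" "Q \<in> ?\<pi>" "Q \<in> Sigma_geom q \<alpha>" "Q \<noteq> ?P"
    using baer_subline_other_point[OF l'(4), of ?P] by blast
  obtain x y where "l = comb x y"
    using l'(1) unfolding pg_lines_def pg_points_def using join_eq_comb by blast
  then have join: "join ?P Q = l"
    using join_of_points_of_comb l'(3) Q(1,4) by metis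
  obtain w where w: "w \<noteq> 0" "Q = pt (sv \<alpha> w)"
    using Q(3) unfolding Sigma_geom_eq Phi_def psi_def by blast
  have "sv \<alpha> w \<noteq> 0"
    using w(1) by simp
  then have "sv \<alpha> w $ 4 = \<alpha> * v * sv \<alpha> w $ 2"
    using Q(2) pt_in_pi_plane_iff unfolding w(2) by blast
  then have y: "cj (snd w) = v * snd w"
    using assms(1) by (simp add: sv_def)
  \<comment> \<open>Otherwise \<open>Q\<close> would lie on \<open>r_U1\<close> together with
    \<open>?P\<close> and make \<open>l\<close> equal to it.\<close>
  have y0: "snd w \<noteq> 0"
  proof
    assume "snd w = 0"
    then have "sv \<alpha> w = fst w *s vec4 1 0 0 0 + (\<alpha> * cj (fst w)) *s vec4 0 0 1 0"
      by (simp add: sv_def vec4_eq_iff)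
    then have "Q \<in> r_U1"
      unfolding r_U1_eq comb_def w(2) using \<open>sv \<alpha> w \<noteq> 0\<close> by auto
    moreover have "?P \<in> r_U1"
    proof -
      have v: "vec4 1 0 (\<alpha> * u) 0 = 1 *s vec4 1 0 0 0 + (\<alpha> * u) *s vec4 0 0 1 0"
        and nz: "1 *s vec4 1 0 0 0 + (\<alpha> * u) *s vec4 0 0 1 0 \<noteq> 0"
        by (simp_all add: vec4_eq_iff)
      show ?thesis
        unfolding r_U1_eq comb_def P_point_def v using nz by blast
    qed
    ultimately have "join ?P Q = r_U1"
      unfolding r_U1_eq using Q(4) join_of_points_of_comb by blast
    then show False
      using join l(2) by simp
  qed
  define c where "c = (\<alpha> * cj (fst w) - \<alpha> * u * fst w) / snd w"
  have "sv \<alpha> w = lift (\<alpha> * u) (\<alpha> * v) c w"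
    using y0 y by (simp add: sv_def lift_def vec4_eq_iff c_def)
  then have "Q \<in> ell (\<alpha> * u) (\<alpha> * v) c"
    unfolding w(2) using pt_lift_in_ell[OF w(1)] by simp
  moreover have "?P \<in> ell (\<alpha> * u) (\<alpha> * v) c"
    unfolding P_point_eq[of _ "\<alpha> * v" c] by (rule pt_lift_in_ell) (simp add: prod_eq_iff)
  ultimately have "l = ell (\<alpha> * u) (\<alpha> * v) c"
    using join Q(4) join_of_points_of_comb unfolding ell_eq_comb by metis
  moreover have "c \<in> pencil_coeffs (\<alpha> * u) (\<alpha> * v)"
  proof -
    have c: "c * snd w = \<alpha> * cj (fst w) - \<alpha> * u * fst w"
      using y0 by (simp add: c_def)
    have "cj c * (v * snd w) = cj \<alpha> * fst w - cj \<alpha> * cj u * cj (fst w)"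
      using arg_cong[OF c, of cj] by (simp add: cj_hom y mult.assoc)
    moreover have "(\<alpha> * v * cj c) * snd w = \<alpha> * (cj c * (v * snd w))"
      by (simp only: mult_ac)
    ultimately have "(\<alpha> * v * cj c) * snd w = \<alpha> * cj \<alpha> * (fst w - cj u * cj (fst w))"
      by (simp add: right_diff_distrib mult.assoc)
    also have "\<dots> = - (cj \<alpha> * cj u) * (c * snd w)"
      unfolding c using assms(2) by algebra
    finally have "(\<alpha> * v * cj c) * snd w = (- cj (\<alpha> * u) * c) * snd w"
      by (simp add: cj_mult)
    then have "\<alpha> * v * cj c = - cj (\<alpha> * u) * c"
      using mult_right_cancel[OF y0] by blast
    then show ?thesis
      unfolding pencil_coeffs_def by (rule CollectI)
  qed
  ultimately show ?thesis
    by blast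
qed

text \<open>A second point of the subgeometry on the line is needed. Its second coordinate comes
  from \<open>hilbert90\<close>; the first solves \<open>c * y / \<alpha> = cj x - u * x\<close>,
  and the condition on \<open>c\<close> makes this solvable.\<close>

lemma ell_in_pencil:
  assumes "\<alpha> \<noteq> 0" "u * cj u = 1" "v * cj v = 1" "c \<in> pencil_coeffs (\<alpha> * u) (\<alpha> * v)"
  shows "ell (\<alpha> * u) (\<alpha> * v) c \<in> pencil q \<alpha> (P_point (\<alpha> * u)) (pi_plane (\<alpha> * v)) - {r_U1}"
proof -
  let ?P = "P_point (\<alpha> * u)" and ?\<pi> = "pi_plane (\<alpha> * v)" and ?l = "ell (\<alpha> * u) (\<alpha> * v) c"
  obtain y where y: "y \<noteq> 0" "cj y = v * y"
    using hilbert90[OF assms(3)] .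
  \<comment> \<open>\<open>z\<close> rescales the vector of \<open>?P\<close> to one of the form
    \<open>sv \<alpha> (z, 0)\<close>.\<close>
  obtain z where z: "z \<noteq> 0" "cj z = u * z"
    using hilbert90[OF assms(2)] .
  have C: "\<alpha> * v * cj c = - (cj \<alpha> * cj u) * c"
    using assms(4) by (simp add: pencil_coeffs_def cj_mult)
  have "cj (c * y / \<alpha>) = - cj u * (c * y / \<alpha>)"
  proof -
    have "cj c * cj y * \<alpha> = (\<alpha> * v * cj c) * y"
      unfolding y(2) by (simp add: mult_ac)
    also have "\<dots> = - cj u * (c * y) * cj \<alpha>"
      unfolding C by (simp add: mult_ac)
    finally have h: "cj c * cj y * \<alpha> = - cj u * (c * y) * cj \<alpha>" .
    have "cj (c * y / \<alpha>) = (cj c * cj y * \<alpha>) / (cj \<alpha> * \<alpha>)"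
      using assms(1) by (simp add: cj_divide cj_mult)
    also have "\<dots> = - cj u * (c * y / \<alpha>)"
      unfolding h using assms(1) by simp
    finally show ?thesis .
  qed
  then have "c * y / \<alpha> \<in> range (\<lambda>x. cj x - u * x)"
    unfolding range_semilinear[OF assms(2)] by simp
  then obtain x where x: "c * y / \<alpha> = cj x - u * x"
    by blast
  have "c * y = \<alpha> * (c * y / \<alpha>)"
    using assms(1) by simp
  then have cy: "\<alpha> * cj x = \<alpha> * u * x + c * y"
    unfolding x by (simp add: algebra_simps)
  have svw: "sv \<alpha> (x, y) = lift (\<alpha> * u) (\<alpha> * v) c (x, y)"
    by (simp add: sv_def lift_def vec4_eq_iff cy y(2))
  have xy: "(x, y) \<noteq> 0" "(z, 0) \<noteq> (0 :: 'a \<times> 'a)" "(1, 0) \<noteq> (0 :: 'a \<times> 'a)" "(0, 1) \<noteq> (0 :: 'a \<times> 'a)"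
    using y z by (simp_all add: prod_eq_iff)
  have P: "?P = psi \<alpha> (z, 0)"
  proof -
    have "sv \<alpha> (z, 0) = z *s vec4 1 0 (\<alpha> * u) 0"
      by (simp add: sv_def vec4_eq_iff z(2))
    then show ?thesis
      unfolding psi_def P_point_def using pt_scale[OF z(1)] by simp
  qed
  have ind: "indep (z, 0) (x, y)"
    using y(1) by (intro indepI[OF xy(2)]) simp
  have Pl: "?P \<in> ?l"
    unfolding P_point_eq[of _ "\<alpha> * v" c] by (rule pt_lift_in_ell[OF xy(3)])
  have Ql: "psi \<alpha> (x, y) \<in> ?l"
    unfolding psi_def svw by (rule pt_lift_in_ell[OF xy(1)])
  have l: "?l = join ?P (psi \<alpha> (x, y))"
    using join_of_points_of_comb Pl Ql psi_neq(3)[OF ind assms(1)] unfolding ell_eq_comb P by metis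
  have sub: "?l \<subseteq> ?\<pi>"
  proof
    fix R assume "R \<in> ?l"
    then obtain p where p: "p \<noteq> 0" "R = pt (lift (\<alpha> * u) (\<alpha> * v) c p)"
      unfolding ell_def by blast
    have "lift (\<alpha> * u) (\<alpha> * v) c p \<noteq> 0"
      using p(1) by simp
    then show "R \<in> ?\<pi>"
      unfolding p(2) using pt_in_pi_plane_iff[of "lift (\<alpha> * u) (\<alpha> * v) c p"] by (simp add: lift_def)
  qed
  have "?l \<inter> (?\<pi> \<inter> Sigma_geom q \<alpha>) = ?l \<inter> Sigma_geom q \<alpha>"
    using sub by blast
  also have "\<dots> = Phi \<alpha> (lin (z, 0) (x, y))"
    unfolding l P by (rule join_psi[OF ind assms(1)])
  also have "\<dots> \<in> baer_sublines q"
    by (rule Phi_baer_subline[OF lin_in_Lines[OF ind] assms(1)])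
  finally have baer: "?l \<inter> (?\<pi> \<inter> Sigma_geom q \<alpha>) \<in> baer_sublines q" .
  have "?l \<in> pg_lines"
  proof -
    have "?P \<in> pg_points" "psi \<alpha> (x, y) \<in> pg_points"
      unfolding P psi_def using xy by (auto intro!: pt_in_pg_points)
    then show ?thesis
      unfolding pg_lines_def l using psi_neq(3)[OF ind assms(1)] P by blast
  qed
  moreover have "?l \<noteq> r_U1"
  proof
    assume "?l = r_U1"
    then have "pt (lift (\<alpha> * u) (\<alpha> * v) c (0, 1)) \<in> r_U1"
      using pt_lift_in_ell[OF xy(4), of "\<alpha> * u" "\<alpha> * v" c] by simp
    then obtain i j where "pt (i *s vec4 1 0 0 0 + j *s vec4 0 0 1 0) = pt (lift (\<alpha> * u) (\<alpha> * v) c (0, 1))"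
      unfolding r_U1_eq comb_def by blast
    then obtain k where k: "lift (\<alpha> * u) (\<alpha> * v) c (0, 1) = k *s (i *s vec4 1 0 0 0 + j *s vec4 0 0 1 0)"
      using pt_eqD by blast
    show False
      using arg_cong[OF k, of "\<lambda>x. x $ 2"] by (simp add: lift_def)
  qed
  ultimately show ?thesis
    unfolding pencil_def using sub Pl baer by blast
qed

lemma pencil_eq:
  assumes "\<alpha> \<noteq> 0" "u \<in> norm_one q" "v \<in> norm_one q"
  shows "pencil q \<alpha> (P_point (\<alpha> * u)) (pi_plane (\<alpha> * v)) - {r_U1} =
    ell (\<alpha> * u) (\<alpha> * v) ` pencil_coeffs (\<alpha> * u) (\<alpha> * v)"
  using pencil_subset[OF assms(1)] ell_in_pencil[OF assms(1)] assms(2,3) unfolding norm_one_iff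
  by blast

section \<open>Line-parallelisms and good sets\<close>

text \<open>For odd \<open>q\<close> the coincidence 1 = -1 has to be excluded. It would leave at
  most 1 + (q - 3) elements to cover the q - 1 non-zero elements of F_q.\<close>

lemma one_notin_norms:
  fixes A :: "'a set"
  assumes "admissible_set q A" "q \<ge> 3"
  shows "1 \<notin> (if even q then A else A \<union> {-1})"
proof (cases "even q")
  case True
  then show ?thesis
    using assms(1) by (auto simp: admissible_set_def)
next
  case False
  then have A: "card A = (q - 3) div 2" "{1, -1} \<union> A \<union> inverse ` A = Fq - {0}" "1 \<notin> A"
    using assms(1) by (auto simp: admissible_set_def subfield_q_eq)
  have "(1 :: 'a) \<noteq> - 1"
  proof
    assume "(1 :: 'a) = - 1"
    then have m: "- 1 = (1 :: 'a)"
      by (rule sym)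
    have "{1, -1} \<union> A \<union> inverse ` A = {1} \<union> A \<union> inverse ` A"
      unfolding m by simp
    then have "q - 1 = card ({1} \<union> A \<union> inverse ` A)"
      using A(2) card_Fq by (simp add: card_Diff_singleton)
    also have "\<dots> \<le> 1 + card A + card A"
      using card_Un_le[of "{1} \<union> A" "inverse ` A"] card_Un_le[of "{1}" A]
        card_image_le[of A inverse] by simp
    finally show False
      unfolding A(1) using assms(2) False by presburger
  qed
  then show ?thesis
    using A(3) False by simp
qed

lemma index_set_norm:
  fixes \<Lambda> A :: "'a set"
  assumes "admissible_set q A" "q \<ge> 3" "norm_transversal q \<Lambda>" "\<alpha> \<in> index_set q \<Lambda> A"
  shows "\<alpha> \<noteq> 0" "\<alpha> * cj \<alpha> \<noteq> 1"
proof -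
  show "\<alpha> \<noteq> 0"
    using assms(3,4) by (auto simp: norm_transversal_def index_set_def)
  have "\<alpha> * cj \<alpha> \<in> (if even q then A else A \<union> {-1})"
    using assms(4) unfolding index_set_def norm_eq by blast
  then show "\<alpha> * cj \<alpha> \<noteq> 1"
    using one_notin_norms[OF assms(1,2)] by metis
qed

lemma norm_mult_norm_one: "u * cj u = 1 \<Longrightarrow> (\<alpha> * u) * cj (\<alpha> * u) = \<alpha> * cj \<alpha>"
proof -
  assume u: "u * cj u = 1"
  have "(\<alpha> * u) * cj (\<alpha> * u) = (\<alpha> * cj \<alpha>) * (u * cj u)"
    by (simp only: cj_mult mult_ac)
  then show ?thesis
    unfolding u by simp
qed

text \<open>A pair is recorded by the parameters \<alpha> u and \<alpha> v, which its point and its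
  plane determine.\<close>

definition coords :: "'a set \<Rightarrow> ('a ppoint \<times> 'a ppoint set) set \<Rightarrow> ('a \<times> 'a) set" where
  "coords I Ps = {(\<alpha> * u, \<alpha> * v) | \<alpha> u v. \<alpha> \<in> I \<and> u \<in> norm_one q \<and> v \<in> norm_one q \<and>
     (P_point (\<alpha> * u), pi_plane (\<alpha> * v)) \<in> Ps}"

lemma card_coords:
  assumes "Ps \<subseteq> pairs q I"
  shows "card (coords I Ps) = card Ps"
proof -
  have "(\<lambda>(a, b). (P_point a, pi_plane b)) ` coords I Ps = Ps"
  proof (intro set_eqI iffI)
    fix x assume x: "x \<in> Ps"
    then obtain \<alpha> u v where uv: "\<alpha> \<in> I" "u \<in> norm_one q" "v \<in> norm_one q"
      "x = (P_point (\<alpha> * u), pi_plane (\<alpha> * v))"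
      using assms unfolding pairs_def by blast
    then have "(\<alpha> * u, \<alpha> * v) \<in> coords I Ps"
      unfolding coords_def using x by blast
    then show "x \<in> (\<lambda>(a, b). (P_point a, pi_plane b)) ` coords I Ps"
      unfolding uv(4) by (intro image_eqI[of _ _ "(\<alpha> * u, \<alpha> * v)"]) simp_all
  qed (auto simp: coords_def)
  moreover have "inj_on (\<lambda>(a, b). (P_point a, pi_plane b)) (coords I Ps)"
    by (auto simp: inj_on_def P_point_inject pi_plane_inject)
  ultimately show ?thesis
    using card_image by metis
qed

lemma lines_of_pairs_eq:
  assumes "0 \<notin> I"
  shows "lines_of_pairs q I Ps = (\<lambda>((a, b), c). ell a b c) ` (SIGMA (a, b):coords I Ps. pencil_coeffs a b)"
proof (intro set_eqI iffI)
  fix l assume "l \<in> lines_of_pairs q I Ps"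
  then obtain \<alpha> u v where uv: "\<alpha> \<in> I" "u \<in> norm_one q" "v \<in> norm_one q"
    "(P_point (\<alpha> * u), pi_plane (\<alpha> * v)) \<in> Ps"
    "l \<in> pencil q \<alpha> (P_point (\<alpha> * u)) (pi_plane (\<alpha> * v)) - {r_U1}"
    unfolding lines_of_pairs_def by blast
  have "\<alpha> \<noteq> 0"
    using uv(1) assms by blast
  then obtain c where "c \<in> pencil_coeffs (\<alpha> * u) (\<alpha> * v)" "l = ell (\<alpha> * u) (\<alpha> * v) c"
    using uv(5) pencil_eq[OF _ uv(2,3)] by blast
  moreover have "(\<alpha> * u, \<alpha> * v) \<in> coords I Ps"
    unfolding coords_def using uv by blast
  ultimately show "l \<in> (\<lambda>((a, b), c). ell a b c) ` (SIGMA (a, b):coords I Ps. pencil_coeffs a b)"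
    by (intro image_eqI[of _ _ "((\<alpha> * u, \<alpha> * v), c)"]) simp_all
next
  fix l assume "l \<in> (\<lambda>((a, b), c). ell a b c) ` (SIGMA (a, b):coords I Ps. pencil_coeffs a b)"
  then obtain a b c where abc: "(a, b) \<in> coords I Ps" "c \<in> pencil_coeffs a b" "l = ell a b c"
    by auto
  then obtain \<alpha> u v where uv: "\<alpha> \<in> I" "u \<in> norm_one q" "v \<in> norm_one q"
    "(P_point (\<alpha> * u), pi_plane (\<alpha> * v)) \<in> Ps" "a = \<alpha> * u" "b = \<alpha> * v"
    unfolding coords_def by blast
  have "\<alpha> \<noteq> 0"
    using uv(1) assms by blast
  then have "l \<in> pencil q \<alpha> (P_point (\<alpha> * u)) (pi_plane (\<alpha> * v)) - {r_U1}"
    using abc(2,3) pencil_eq[OF _ uv(2,3)] unfolding uv(5,6) by blast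
  then show "l \<in> lines_of_pairs q I Ps"
    unfolding lines_of_pairs_def using uv(1-4) by blast
qed

text \<open>As norms are distinct on \<open>I\<close>, \<alpha> u determines \<alpha> and u, and
  then \<alpha> v determines v. The first condition is merely multiplied by \<alpha>
  \<beta>.\<close>

lemma good_set_iff_coords:
  assumes "0 \<notin> I" and inj: "inj_on (\<lambda>\<alpha>. \<alpha> * cj \<alpha>) I"
  shows "good_set q I Ps \<longleftrightarrow>
    (\<forall>a b a' b'. (a, b) \<in> coords I Ps \<longrightarrow> (a', b') \<in> coords I Ps \<longrightarrow>
      (a, b) \<noteq> (a', b') \<longrightarrow> a * b' \<noteq> b * a' \<and> a * cj b' \<noteq> cj b * a')" (is "?L \<longleftrightarrow> ?R")
proof -
  have eq: "(\<alpha>, u, v) = (\<beta>, u', v') \<longleftrightarrow> (\<alpha> * u, \<alpha> * v) = (\<beta> * u', \<beta> * v')"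
    if I: "\<alpha> \<in> I" "\<beta> \<in> I" and n: "u \<in> norm_one q" "u' \<in> norm_one q" for \<alpha> \<beta> u u' v v'
  proof
    assume e: "(\<alpha> * u, \<alpha> * v) = (\<beta> * u', \<beta> * v')"
    then have "(\<alpha> * u) * cj (\<alpha> * u) = (\<beta> * u') * cj (\<beta> * u')"
      by simp
    then have "\<alpha> * cj \<alpha> = \<beta> * cj \<beta>"
      using n norm_mult_norm_one unfolding norm_one_iff by metis
    then have "\<alpha> = \<beta>"
      using inj I by (auto dest: inj_onD)
    moreover have "\<alpha> \<noteq> 0"
      using I assms(1) by blast
    ultimately show "(\<alpha>, u, v) = (\<beta>, u', v')"
      using e by simp
  qed simp
  have cond: "u * v' - v * u' \<noteq> 0 \<and> \<alpha> * u * (\<beta> * v') ^ q - (\<alpha> * v) ^ q * (\<beta> * u') \<noteq> 0 \<longleftrightarrow>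
      (\<alpha> * u) * (\<beta> * v') \<noteq> (\<alpha> * v) * (\<beta> * u') \<and> (\<alpha> * u) * cj (\<beta> * v') \<noteq> cj (\<alpha> * v) * (\<beta> * u')"
    if "\<alpha> \<in> I" "\<beta> \<in> I" for \<alpha> \<beta> u v u' v'
  proof -
    have "\<alpha> * \<beta> \<noteq> 0"
      using that assms(1) by auto
    moreover have "(\<alpha> * u) * (\<beta> * v') - (\<alpha> * v) * (\<beta> * u') = (\<alpha> * \<beta>) * (u * v' - v * u')"
      by (simp add: algebra_simps)
    ultimately have "u * v' - v * u' \<noteq> 0 \<longleftrightarrow> (\<alpha> * u) * (\<beta> * v') \<noteq> (\<alpha> * v) * (\<beta> * u')"
      by (metis mult_eq_0_iff right_minus_eq)
    then show ?thesis
      unfolding cj_eq by simp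
  qed
  show ?thesis
  proof
    assume L: ?L
    show ?R
    proof (intro allI impI)
      fix a b a' b' assume ab: "(a, b) \<in> coords I Ps" "(a', b') \<in> coords I Ps" "(a, b) \<noteq> (a', b')"
      obtain \<alpha> u v where uv: "\<alpha> \<in> I" "u \<in> norm_one q" "v \<in> norm_one q"
        "(P_point (\<alpha> * u), pi_plane (\<alpha> * v)) \<in> Ps" "a = \<alpha> * u" "b = \<alpha> * v"
        using ab(1) unfolding coords_def by blast
      obtain \<beta> u' v' where uv': "\<beta> \<in> I" "u' \<in> norm_one q" "v' \<in> norm_one q"
        "(P_point (\<beta> * u'), pi_plane (\<beta> * v')) \<in> Ps" "a' = \<beta> * u'" "b' = \<beta> * v'"
        using ab(2) unfolding coords_def by blast
      have "(\<alpha>, u, v) \<noteq> (\<beta>, u', v')"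
        using ab(3) unfolding uv(5,6) uv'(5,6) by blast
      then show "a * b' \<noteq> b * a' \<and> a * cj b' \<noteq> cj b * a'"
        using L uv(1-4) uv'(1-4) cond[OF uv(1) uv'(1)] unfolding good_set_def uv(5,6) uv'(5,6) by blast
    qed
  next
    assume R: ?R
    show ?L
      unfolding good_set_def
    proof (intro ballI impI)
      fix \<alpha> u v \<beta> u' v'
      assume uv: "\<alpha> \<in> I" "u \<in> norm_one q" "v \<in> norm_one q" "(P_point (\<alpha> * u), pi_plane (\<alpha> * v)) \<in> Ps"
        and uv': "\<beta> \<in> I" "u' \<in> norm_one q" "v' \<in> norm_one q" "(P_point (\<beta> * u'), pi_plane (\<beta> * v')) \<in> Ps"
        and ne: "(\<alpha>, u, v) \<noteq> (\<beta>, u', v')"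
      have "(\<alpha> * u, \<alpha> * v) \<in> coords I Ps" "(\<beta> * u', \<beta> * v') \<in> coords I Ps"
        unfolding coords_def using uv uv' by blast+
      moreover have "(\<alpha> * u, \<alpha> * v) \<noteq> (\<beta> * u', \<beta> * v')"
        using ne eq[OF uv(1) uv'(1) uv(2) uv'(2)] by blast
      ultimately show "u * v' - v * u' \<noteq> 0 \<and> \<alpha> * u * (\<beta> * v') ^ q - (\<alpha> * v) ^ q * (\<beta> * u') \<noteq> 0"
        unfolding cond[OF uv(1) uv'(1)] using R by blast
    qed
  qed
qed

lemma line_parallelism_iff_good_set:
  fixes \<Lambda> A :: "'a set" and \<eta> :: 'a and Ps :: "('a ppoint \<times> 'a ppoint set) set"
  assumes "q \<ge> 3" and "norm_transversal q \<Lambda>" and "\<eta> \<in> norm_one q" and "admissible_set q A"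
    and "Ps \<subseteq> pairs q (index_set q \<Lambda> A)" and "card Ps = q + 1"
  shows "line_parallelism (Sigma_geom q \<eta>) (Pi_set q \<eta> (index_set q \<Lambda> A) Ps)
    \<longleftrightarrow> good_set q (index_set q \<Lambda> A) Ps"
proof -
  define I where "I = index_set q \<Lambda> A"
  define E where "E = coords I Ps"
  \<comment> \<open>Spreads are indexed by pairs together with a coefficient rather than by lines,
    which gives (q + 1) q indices; coincidences between spreads are left to the pairwise
    criterion.\<close>
  define J where "J = (SIGMA (a, b):E. pencil_coeffs a b)"
  define T where "T = (\<lambda>((a, b), c). switched a b c)"
  have \<eta>: "\<eta> * cj \<eta> = 1"
    using assms(3) by (simp add: norm_one_iff)
  note I = index_set_norm[OF assms(4,1,2), folded I_def]
  have I0: "0 \<notin> I"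
    using I(1) by blast
  have inj: "inj_on (\<lambda>\<alpha>. \<alpha> * cj \<alpha>) I"
    using assms(2) unfolding norm_transversal_def norm_eq I_def index_set_def
    by (auto intro: inj_on_subset)
  have par: "param a b" if ab: "(a, b) \<in> E" for a b
  proof -
    obtain \<alpha> u v where uv: "\<alpha> \<in> I" "u * cj u = 1" "v * cj v = 1" "a = \<alpha> * u" "b = \<alpha> * v"
      using ab unfolding E_def coords_def norm_one_iff by blast
    have "u \<noteq> 0" "v \<noteq> 0"
      using uv(2,3) by auto
    then show ?thesis
      unfolding param_def uv(4,5) norm_mult_norm_one[OF uv(2)] norm_mult_norm_one[OF uv(3)]
      using I[OF uv(1)] by simp
  qed
  have J: "((a, b), c) \<in> J \<longleftrightarrow> (a, b) \<in> E \<and> c \<in> pencil_coeffs a b" for a b c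
    by (simp add: J_def)
  have T: "T ((a, b), c) = switched a b c" for a b c
    by (simp add: T_def)
  have "card J = (\<Sum>(a, b)\<in>E. card (pencil_coeffs a b))"
    unfolding J_def by (simp add: case_prod_unfold)
  also have "\<dots> = (\<Sum>(a, b)\<in>E. q)"
    by (rule sum.cong[OF refl]) (use par card_pencil_coeffs in auto)
  also have "\<dots> = q ^ 2 + q"
    unfolding case_prod_unfold using card_coords[OF assms(5)] assms(6)
    by (simp add: E_def I_def power2_eq_square)
  finally have card_J: "card J = q ^ 2 + q" .
  have spr: "spread (T j)" if "j \<in> J" for j
  proof -
    obtain a b c where "j = ((a, b), c)"
      by (metis surj_pair)
    then show ?thesis
      using that spread_switched par by (simp add: J T)
  qed
  have TD: "T j \<inter> D_lines = {}" if "j \<in> J" for j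
  proof -
    obtain a b c where "j = ((a, b), c)"
      by (metis surj_pair)
    then show ?thesis
      using that switched_Int_D_lines par by (simp add: J T)
  qed
  have "Pi_set q \<eta> I Ps = (\<lambda>j. Phi 1 ` T j) ` J \<union> {Phi 1 ` D_lines}"
  proof -
    have sw: "(S_spread q \<eta> l - R_regulus q \<eta> l) \<union>
        opposite_regulus (Sigma_geom q \<eta>) (R_regulus q \<eta> l) = Phi 1 ` T j"
      if "j \<in> J" "l = (\<lambda>((a, b), c). ell a b c) j" for j l
    proof -
      obtain a b c where "j = ((a, b), c)"
        by (metis surj_pair)
      then show ?thesis
        using that switched_spread_eq[OF par \<eta>] by (simp add: J T)
    qed
    have "Pi_set q \<eta> I Ps = (\<lambda>l. (S_spread q \<eta> l - R_regulus q \<eta> l) \<union>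
        opposite_regulus (Sigma_geom q \<eta>) (R_regulus q \<eta> l)) ` lines_of_pairs q I Ps \<union> {D_spread q \<eta>}"
      unfolding Pi_set_def by blast
    also have "\<dots> = (\<lambda>j. Phi 1 ` T j) ` J \<union> {Phi 1 ` D_lines}"
      unfolding lines_of_pairs_eq[OF I0] D_spread_eq[OF \<eta>] image_image E_def[symmetric] J_def[symmetric]
      using sw by (metis (no_types, lifting) image_cong)
    finally show ?thesis .
  qed
  also have "\<dots> = (`) (Phi 1) ` (T ` J \<union> {D_lines})"
    by (simp add: image_image)
  finally have Pi: "Pi_set q \<eta> I Ps = (`) (Phi 1) ` (T ` J \<union> {D_lines})" .
  have "spread S" if "S \<in> T ` J \<union> {D_lines}" for S
    using that spr spread_D_lines by blast
  then have "line_parallelism (Sigma_geom q \<eta>) (Pi_set q \<eta> I Ps) \<longleftrightarrow> parallelism (T ` J \<union> {D_lines})"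
    unfolding Pi Sigma_geom_norm_one[OF \<eta>] by (rule line_parallelism_iff)
  also have "\<dots> \<longleftrightarrow> (\<forall>i\<in>J. \<forall>j\<in>J. i \<noteq> j \<longrightarrow> T i \<inter> T j = {})"
    using parallelism_iff_pairwise_disjoint[OF _ card_J spr spread_D_lines TD] by simp
  also have "\<dots> \<longleftrightarrow> good_set q I Ps"
    unfolding good_set_iff_coords[OF I0 inj] E_def[symmetric]
  proof (intro iffI)
    assume disj: "\<forall>i\<in>J. \<forall>j\<in>J. i \<noteq> j \<longrightarrow> T i \<inter> T j = {}"
    show "\<forall>a b a' b'. (a, b) \<in> E \<longrightarrow> (a', b') \<in> E \<longrightarrow> (a, b) \<noteq> (a', b') \<longrightarrow> a * b' \<noteq> b * a' \<and> a * cj b' \<noteq> cj b * a'"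
    proof (intro allI impI)
      fix a b a' b' assume ab: "(a, b) \<in> E" "(a', b') \<in> E" "(a, b) \<noteq> (a', b')"
      \<comment> \<open>The coefficient 0 occurs in every pencil, and
        \<open>switched_conflict\<close> needs no other.\<close>
      then have "((a, b), 0) \<in> J" "((a', b'), 0) \<in> J" "((a, b), 0) \<noteq> ((a', b'), 0 :: 'a)"
        by (simp_all add: J)
      then have "T ((a, b), 0) \<inter> T ((a', b'), 0) = {}"
        using disj by blast
      then show "a * b' \<noteq> b * a' \<and> a * cj b' \<noteq> cj b * a'"
        unfolding T using switched_conflict[OF par[OF ab(1)] par[OF ab(2)]] by blast
    qed
  next
    assume good: "\<forall>a b a' b'. (a, b) \<in> E \<longrightarrow> (a', b') \<in> E \<longrightarrow> (a, b) \<noteq> (a', b') \<longrightarrow> a * b' \<noteq> b * a' \<and> a * cj b' \<noteq> cj b * a'"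
    show "\<forall>i\<in>J. \<forall>j\<in>J. i \<noteq> j \<longrightarrow> T i \<inter> T j = {}"
    proof (intro ballI impI)
      fix i j assume ij: "i \<in> J" "j \<in> J" "i \<noteq> j"
      obtain a b c a' b' c' where eq: "i = ((a, b), c)" "j = ((a', b'), c')"
        by (metis surj_pair)
      have ab: "(a, b) \<in> E" "c \<in> pencil_coeffs a b" "(a', b') \<in> E" "c' \<in> pencil_coeffs a' b'"
        using ij(1,2) unfolding eq J by blast+
      show "T i \<inter> T j = {}"
      proof (cases "(a, b) = (a', b')")
        case True
        then show ?thesis
          using switched_disjoint_same_pair[OF par[OF ab(1)] ab(2)] ab(4) ij(3) unfolding eq T by simp
      next
        case False
        then have "a * b' \<noteq> b * a' \<and> a * cj b' \<noteq> cj b * a'"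
          using good ab(1,3) by blast
        then show ?thesis
          unfolding eq T using switched_disjoint_good[OF par[OF ab(1)] par[OF ab(3)] ab(2,4)] by blast
      qed
    qed
  qed
  finally show ?thesis
    unfolding I_def .
qed

end

theorem theorem3p4:
  fixes q :: nat
    and \<Lambda> A :: "'a::{field,finite} set"
    and \<eta> :: 'a
    and Ps :: "('a ppoint \<times> 'a ppoint set) set"
  assumes "primepow q" and "q \<ge> 3"
    and "CARD('a) = q ^ 2"
    and "norm_transversal q \<Lambda>"
    and "\<eta> \<in> norm_one q \<inter> \<Lambda>"
    and "admissible_set q A"
    and "Ps \<subseteq> pairs q (index_set q \<Lambda> A)"
    and "card Ps = q + 1"
  shows "line_parallelism (Sigma_geom q \<eta>) (Pi_set q \<eta> (index_set q \<Lambda> A) Ps)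
         \<longleftrightarrow> good_set q (index_set q \<Lambda> A) Ps"
proof -
  interpret quadratic_extension q "\<lambda>x :: 'a. x ^ q"
    by unfold_locales (use assms in simp_all)
  show ?thesis
    using line_parallelism_iff_good_set assms by blast
qed

end
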